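(* Let $X$ be a topological space, let $A_x$, $x\in X$, be a graph continuous family of injective semi-Fredholm symmetric operators on $H$, and let $\tilde A_x$, $x\in X$, be a graph continuous family of invertible self-adjoint operators on $H$ such that $\tilde A_x$ is an extension of $A_x$. Let $K_x=\ker A_x^*$ and let $L=(L_x)_{x\in X}$ be a continuous family of Fredholm self-adjoint relations in $K_x$. Let $A_L$ be the family of self-adjoint extensions $A_{L_x}$ of $A_x$ defined by $L_x$ and the reference operator $\tilde A_x$. Then $$\operatorname{ind}A_L=\operatorname{ind}L\in K^1(X).$$
   Context: $H$ is a separable infinite-dimensional complex Hilbert space. Domains of closed operators carry the graph inner product. A symmetric operator is assumed closed and densely defined; it is semi-Fredholm if its range is closed and its kernel is finite-dimensional. A closed operator $B$ is invertible if $B:\operatorname{dom}B\to H$ is bijective. Families of closed subspaces are continuous when the orthogonal projections are norm continuous; families of operators are graph continuous when their graphs form a continuous family in $H\oplus H$. The subspaces $K_x\subset H$ form a continuous family. Extensions defined by a reference operator. For $A$ injective semi-Fredholm symmetric, $\tilde A$ an invertible self-adjoint extension of $A$ and $K=\ker A^*$, one has the direct sum decomposition $$\operatorname{dom}A^*=\operatorname{dom}A\dotplus K\dotplus\tilde A^{-1}K,$$ and the map $\Gamma:\operatorname{dom}A^*\to K\oplus K$, $\Gamma(\zeta+\xi_0+\tilde A^{-1}\xi_1)=(\xi_0,\xi_1)$ for $\zeta\in\operatorname{dom}A$, $\xi_0,\xi_1\in K$, satisfies $\langle A^*\xi,\eta\rangle-\langle\xi,A^*\eta\rangle=\omega(\Gamma\xi,\Gamma\eta)$,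 where $$\omega((\xi_0,\xi_1),(\eta_0,\eta_1))=\langle\xi_1,\eta_0\rangle-\langle\xi_0,\eta_1\rangle=\langle J\xi,\eta\rangle,\qquad J(\xi_0,\xi_1)=(\xi_1,-\xi_0).$$ A self-adjoint relation in $K$ is a Lagrangian subspace $L\subset K\oplus K$ (equal to its $\omega$-annihilator); it is Fredholm if $(L,K\oplus0)$ is a Fredholm pair in $K\oplus K$, i.e. $L+(K\oplus0)$ is closed and $\dim(L\cap(K\oplus0))$, $\operatorname{codim}(L+(K\oplus0))$ are finite. $A_L$ is the restriction of $A^*$ to $\{\xi\in\operatorname{dom}A^*:\Gamma\xi\in L\}$. Under the hypotheses the $A_{L_x}$ are Fredholm self-adjoint and form a graph continuous family. Continuity of $L_x\subset K_x\oplus K_x$ is understood in $H\oplus H$. $K^1$ index. For a Hilbert space $W$ let $\mathcal U(W)$ be the unitary group with the norm topology, $\mathcal U_K(W)=\{u\in\mathcal U(W): u-1\text{ compact}\}$ and $\mathcal U_F(W)=\{u\in\mathcal U(W): u+1\text{ Fredholm}\}$. For arbitrary $X$, $K^1(X):=[X,\mathcal U_K(H)]=[X,\mathcal U_F(H)]$ (the inclusion is a homotopy equivalence), with addition given by direct sum and zero element the constant map $1$. The index of a continuous $f:X\to\mathcal U_F(W)$ is the class of $f\oplus1:X\to\mathcal U_F(W\oplus H')$, $H'$ an auxiliary infinite-dimensional separable Hilbert space. The index of a graph continuous family $(B_x)$ of Fredholm self-adjoint operators is the index of the family of Cayley transforms $(B_x-i)(B_x+i)^{-1}\in\mathcal U_F(H)$.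 For a Hilbert space $\Lambda$ with skew-adjoint unitary $J$, put $\Lambda^\pm=\ker(J\mp i)$; each Lagrangian $L$ is the graph of a unitary $u_L:\Lambda^+\to\Lambda^-$. For a continuous family of Fredholm Lagrangian pairs $(L_x,M_x)$ in $\Lambda_x$ (a continuous family of $J$-invariant subspaces of a fixed symplectic space), $\operatorname{ind}_\Lambda(L,M)\in K^1(X)$ is the index of $x\mapsto-u_{M_x}^{-1}u_{L_x}\in\mathcal U_F(\Lambda_x^+)$, computed after stabilization (adding the identity of an auxiliary infinite-dimensional Hilbert space) and a trivialization of the resulting family of Hilbert spaces by a norm continuous family of unitaries (independent of the trivialization). The index $\operatorname{ind}L$ of a continuous family of Fredholm self-adjoint relations $L_x$ in $K_x$ is $\operatorname{ind}_{K\oplus K}(L,K\oplus0)$. *)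

theory Defs
  imports "HOL-Analysis.Analysis"
begin

section \<open>Complex Hilbert spaces\<close>

text \<open>The complex inner product is linear in the first argument; its real part is the
  real inner product of the underlying \<^class>\<open>real_inner\<close> space, so that norm and topology
  are the ones of the library.\<close>

class complex_hilbert = real_inner + complete_space +
  fixes scaleC :: "complex \<Rightarrow> 'a \<Rightarrow> 'a" (infixr "*\<^sub>C" 75)
    and cinner :: "'a \<Rightarrow> 'a \<Rightarrow> complex"
  assumes scaleC_add_right: "c *\<^sub>C (x + y) = c *\<^sub>C x + c *\<^sub>C y"
    and scaleC_add_left: "(c + d) *\<^sub>C x = c *\<^sub>C x + d *\<^sub>C x"
    and scaleC_scaleC: "c *\<^sub>C (d *\<^sub>C x) = (c * d) *\<^sub>C x"
    and scaleC_of_real: "complex_of_real r *\<^sub>C x = r *\<^sub>R x"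
    and cinner_commute: "cinner x y = cnj (cinner y x)"
    and cinner_add_left: "cinner (x + y) z = cinner x z + cinner y z"
    and cinner_scaleC_left: "cinner (c *\<^sub>C x) y = c * cinner x y"
    and Re_cinner: "Re (cinner x y) = inner x y"

global_interpretation complex_vector: vector_space "scaleC :: complex \<Rightarrow> 'a \<Rightarrow> 'a :: complex_hilbert"
  defines csubspace = complex_vector.subspace
    and cspan = complex_vector.span
proof unfold_locales
  show "1 *\<^sub>C x = x" for x :: 'a
    using scaleC_of_real[of 1 x] by simp
qed (simp_all add: scaleC_add_right scaleC_add_left scaleC_scaleC)

instantiation prod :: (complex_hilbert, complex_hilbert) complex_hilbert
begin

definition scaleC_prod_def: "scaleC c p = (c *\<^sub>C fst p, c *\<^sub>C snd p)"

definition cinner_prod_def: "cinner p q = cinner (fst p) (fst q) + cinner (snd p) (snd q)"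

instance
proof
  fix c d :: complex and r :: real and x y z :: "'a \<times> 'b"
  show "c *\<^sub>C (x + y) = c *\<^sub>C x + c *\<^sub>C y" "(c + d) *\<^sub>C x = c *\<^sub>C x + d *\<^sub>C x"
    "c *\<^sub>C (d *\<^sub>C x) = (c * d) *\<^sub>C x" "complex_of_real r *\<^sub>C x = r *\<^sub>R x"
    by (auto simp: scaleC_prod_def scaleC_add_right scaleC_add_left scaleC_scaleC
        scaleC_of_real prod_eq_iff)
  show "cinner x y = cnj (cinner y x)"
    by (metis cinner_prod_def cinner_commute complex_cnj_add)
  show "cinner (x + y) z = cinner x z + cinner y z" "cinner (c *\<^sub>C x) y = c * cinner x y"
    "Re (cinner x y) = inner x y"
    by (auto simp: cinner_prod_def scaleC_prod_def cinner_add_left cinner_scaleC_left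
        Re_cinner inner_prod_def algebra_simps)
qed

end

definition finite_cdim :: "'a::complex_hilbert set \<Rightarrow> bool" where
  "finite_cdim S \<longleftrightarrow> (\<exists>B. finite B \<and> S \<subseteq> cspan B)"

definition finite_ccodim_in :: "'a::complex_hilbert set \<Rightarrow> 'a set \<Rightarrow> bool" where
  "finite_ccodim_in V S \<longleftrightarrow> (\<exists>B. finite B \<and> cspan (S \<union> B) = V)"


section \<open>Continuous families of closed subspaces\<close>

definition orth_proj :: "'a::complex_hilbert set \<Rightarrow> 'a \<Rightarrow>\<^sub>L 'a" where
  "orth_proj S = Blinfun (\<lambda>v. THE w. w \<in> S \<and> (\<forall>s\<in>S. cinner (v - w) s = 0))"

definition continuous_subspaces :: "'x topology \<Rightarrow> ('x \<Rightarrow> 'a::complex_hilbert set) \<Rightarrow> bool" where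
  "continuous_subspaces X S \<longleftrightarrow>
     (\<forall>x\<in>topspace X. csubspace (S x) \<and> closed (S x)) \<and>
     continuous_map X euclidean (\<lambda>x. orth_proj (S x))"


section \<open>Unbounded operators\<close>

text \<open>An operator \<open>A\<close> with domain in \<open>H\<close> is represented by its graph
  \<open>{(\<xi>, A \<xi>) | \<xi> \<in> dom A}\<close>, a subset of \<open>H \<times> H\<close>. Thus \<^const>\<open>Domain\<close> and \<^const>\<open>Range\<close> are its
  domain and range, inclusion means extension, and a family of operators is graph continuous iff
  it satisfies \<^const>\<open>continuous_subspaces\<close>.\<close>

definition closed_operator :: "('h::complex_hilbert \<times> 'h) set \<Rightarrow> bool" where
  "closed_operator A \<longleftrightarrow> csubspace A \<and> single_valued A \<and> closed A"

definition op_kernel :: "('h::complex_hilbert \<times> 'h) set \<Rightarrow> 'h set" where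
  "op_kernel A = {\<xi>. (\<xi>, 0) \<in> A}"

definition op_adjoint :: "('h::complex_hilbert \<times> 'h) set \<Rightarrow> ('h \<times> 'h) set" where
  "op_adjoint A = {(\<eta>, \<eta>'). \<forall>(\<xi>, \<xi>')\<in>A. cinner \<xi>' \<eta> = cinner \<xi> \<eta>'}"

definition symmetric_operator :: "('h::complex_hilbert \<times> 'h) set \<Rightarrow> bool" where
  "symmetric_operator A \<longleftrightarrow>
     closed_operator A \<and> closure (Domain A) = UNIV \<and> A \<subseteq> op_adjoint A"

definition self_adjoint_operator :: "('h::complex_hilbert \<times> 'h) set \<Rightarrow> bool" where
  "self_adjoint_operator A \<longleftrightarrow>
     closed_operator A \<and> closure (Domain A) = UNIV \<and> op_adjoint A = A"

definition injective_operator :: "('h::complex_hilbert \<times> 'h) set \<Rightarrow> bool" where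
  "injective_operator A \<longleftrightarrow> single_valued (A\<inverse>)"

definition semi_Fredholm_operator :: "('h::complex_hilbert \<times> 'h) set \<Rightarrow> bool" where
  "semi_Fredholm_operator A \<longleftrightarrow> closed (Range A) \<and> finite_cdim (op_kernel A)"

definition invertible_operator :: "('h::complex_hilbert \<times> 'h) set \<Rightarrow> bool" where
  "invertible_operator A \<longleftrightarrow> closed_operator A \<and> (\<forall>\<eta>. \<exists>!\<xi>. (\<xi>, \<eta>) \<in> A)"

text \<open>\<open>(A - i) (A + i)\<inverse>\<close>, which maps \<open>A \<xi> + i \<xi>\<close> to \<open>A \<xi> - i \<xi>\<close>.\<close>

definition cayley_transform :: "('h::complex_hilbert \<times> 'h) set \<Rightarrow> 'h \<Rightarrow>\<^sub>L 'h" where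
  "cayley_transform A =
     Blinfun (\<lambda>v. THE w. \<exists>(\<xi>, \<eta>)\<in>A. v = \<eta> + \<i> *\<^sub>C \<xi> \<and> w = \<eta> - \<i> *\<^sub>C \<xi>)"


section \<open>The group \<open>K\<^sup>1\<close>\<close>

definition clinear_blinfun :: "'a::complex_hilbert \<Rightarrow>\<^sub>L 'b::complex_hilbert \<Rightarrow> bool" where
  "clinear_blinfun u \<longleftrightarrow> (\<forall>c v. u (c *\<^sub>C v) = c *\<^sub>C u v)"

text \<open>\<open>u\<close> is a unitary from its domain onto the closed subspace \<open>S\<close>.\<close>

definition unitary_onto :: "'b::complex_hilbert set \<Rightarrow> 'a::complex_hilbert \<Rightarrow>\<^sub>L 'b \<Rightarrow> bool" where
  "unitary_onto S u \<longleftrightarrow> clinear_blinfun u \<and> (\<forall>v. norm (u v) = norm v) \<and> range u = S"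

definition Fredholm_blinfun :: "'a::complex_hilbert \<Rightarrow>\<^sub>L 'a \<Rightarrow> bool" where
  "Fredholm_blinfun T \<longleftrightarrow>
     finite_cdim {v. T v = 0} \<and> closed (range T) \<and> finite_ccodim_in UNIV (range T)"

definition UF :: "('a::complex_hilbert \<Rightarrow>\<^sub>L 'a) set" where
  "UF = {u. unitary_onto UNIV u \<and> Fredholm_blinfun (u + id_blinfun)}"

definition K1_rel :: "'x topology \<Rightarrow> (('x \<Rightarrow> 'h::complex_hilbert \<Rightarrow>\<^sub>L 'h) \<times> ('x \<Rightarrow> 'h \<Rightarrow>\<^sub>L 'h)) set" where
  "K1_rel X = {(f, g). homotopic_with (\<lambda>_. True) X (top_of_set UF) f g}"

text \<open>\<open>K\<^sup>1(X) = [X, \<U>\<^sub>F(H)]\<close>, where \<open>H\<close> is the type \<open>'h\<close>. The relation identifies functions that agree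
  on the carrier of \<open>X\<close>.\<close>

definition K1 :: "'x topology \<Rightarrow> ('x \<Rightarrow> 'h::complex_hilbert \<Rightarrow>\<^sub>L 'h) set set" where
  "K1 X = {f. continuous_map X (top_of_set UF) f} // K1_rel X"

definition K1_class ::
    "'x topology \<Rightarrow> ('x \<Rightarrow> 'h::complex_hilbert \<Rightarrow>\<^sub>L 'h) \<Rightarrow> ('x \<Rightarrow> 'h \<Rightarrow>\<^sub>L 'h) set" where
  "K1_class X f = K1_rel X `` {f}"

text \<open>The stabilization \<open>f \<oplus> 1\<close> of a map \<open>f : W \<rightarrow> W\<close>, transported by a unitary
  \<open>V : H \<rightarrow> W \<oplus> H'\<close>. Here \<open>W\<close> is a closed subspace of the type \<open>'w\<close>, so that the values of \<open>f\<close>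
  outside \<open>W\<close> are irrelevant, and the auxiliary space \<open>H'\<close> is a copy of \<open>H\<close>.\<close>

definition stab_transport ::
    "('h::complex_hilbert \<Rightarrow>\<^sub>L ('w::complex_hilbert \<times> 'h)) \<Rightarrow> ('w \<Rightarrow> 'w) \<Rightarrow> 'h \<Rightarrow>\<^sub>L 'h" where
  "stab_transport V f = Blinfun (\<lambda>h. inv (blinfun_apply V) (map_prod f id (V h)))"

text \<open>The index of a family of operators on a fixed space: \<open>W \<oplus> H'\<close> is identified with \<open>H\<close> by any
  fixed unitary.\<close>

definition K1_index ::
    "'x topology \<Rightarrow> ('x \<Rightarrow> 'w::complex_hilbert \<Rightarrow>\<^sub>L 'w) \<Rightarrow> ('x \<Rightarrow> 'h::complex_hilbert \<Rightarrow>\<^sub>L 'h) set" where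
  "K1_index X f =
     (THE c. \<exists>V :: 'h \<Rightarrow>\<^sub>L ('w \<times> 'h). unitary_onto UNIV V \<and>
        c = K1_class X (\<lambda>x. stab_transport V (f x)))"

text \<open>A trivialization of the family \<open>(W\<^sub>x \<oplus> H')\<^sub>x\<close>, given by the inverse unitaries
  \<open>V\<^sub>x : H \<rightarrow> W\<^sub>x \<oplus> H'\<close>. Norm continuity of \<open>V\<close> in the ambient space is equivalent to norm continuity of
  the adjoint family, whose members are \<open>V\<^sub>x\<inverse>\<close> on \<open>W\<^sub>x \<oplus> H'\<close> and zero on its orthogonal
  complement.\<close>

definition trivialization ::
    "'x topology \<Rightarrow> ('x \<Rightarrow> 'w::complex_hilbert set) \<Rightarrow>
     ('x \<Rightarrow> 'h::complex_hilbert \<Rightarrow>\<^sub>L ('w \<times> 'h)) \<Rightarrow> bool" where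
  "trivialization X W V \<longleftrightarrow>
     continuous_map X euclidean V \<and> (\<forall>x\<in>topspace X. unitary_onto (W x \<times> UNIV) (V x))"

definition K1_index_family ::
    "'x topology \<Rightarrow> ('x \<Rightarrow> 'w::complex_hilbert set) \<Rightarrow> ('x \<Rightarrow> 'w \<Rightarrow> 'w) \<Rightarrow>
     ('x \<Rightarrow> 'h::complex_hilbert \<Rightarrow>\<^sub>L 'h) set" where
  "K1_index_family X W f =
     (THE c. \<exists>V :: 'x \<Rightarrow> 'h \<Rightarrow>\<^sub>L ('w \<times> 'h). trivialization X W V \<and>
        c = K1_class X (\<lambda>x. stab_transport (V x) (f x)))"

definition operator_index ::
    "'x topology \<Rightarrow> ('x \<Rightarrow> ('h::complex_hilbert \<times> 'h) set) \<Rightarrow> ('x \<Rightarrow> 'h \<Rightarrow>\<^sub>L 'h) set" where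
  "operator_index X B = K1_index X (\<lambda>x. cayley_transform (B x))"


section \<open>Lagrangian subspaces\<close>

text \<open>The symplectic form is \<open>\<omega>(z, w) = \<langle>J z, w\<rangle>\<close> for a skew-adjoint unitary \<open>J\<close> of the ambient space;
  \<open>\<Lambda>\<close> is a closed \<open>J\<close>-invariant subspace.\<close>

definition lagrangian ::
    "('v::complex_hilbert \<Rightarrow> 'v) \<Rightarrow> 'v set \<Rightarrow> 'v set \<Rightarrow> bool" where
  "lagrangian J \<Lambda> L \<longleftrightarrow> csubspace L \<and> L = {z\<in>\<Lambda>. \<forall>w\<in>L. cinner (J z) w = 0}"

definition Fredholm_pair :: "'v::complex_hilbert set \<Rightarrow> 'v set \<Rightarrow> 'v set \<Rightarrow> bool" where
  "Fredholm_pair \<Lambda> L M \<longleftrightarrow>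
     closed {l + m | l m. l \<in> L \<and> m \<in> M} \<and>
     finite_cdim (L \<inter> M) \<and>
     finite_ccodim_in \<Lambda> {l + m | l m. l \<in> L \<and> m \<in> M}"

definition J_plus :: "('v::complex_hilbert \<Rightarrow> 'v) \<Rightarrow> 'v set \<Rightarrow> 'v set" where
  "J_plus J \<Lambda> = {z\<in>\<Lambda>. J z = \<i> *\<^sub>C z}"

definition J_minus :: "('v::complex_hilbert \<Rightarrow> 'v) \<Rightarrow> 'v set \<Rightarrow> 'v set" where
  "J_minus J \<Lambda> = {z\<in>\<Lambda>. J z = - \<i> *\<^sub>C z}"

text \<open>The unitary \<open>u\<^sub>L : \<Lambda>\<^sup>+ \<rightarrow> \<Lambda>\<^sup>-\<close> whose graph is \<open>L\<close>.\<close>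

definition lagrangian_unitary ::
    "('v::complex_hilbert \<Rightarrow> 'v) \<Rightarrow> 'v set \<Rightarrow> 'v set \<Rightarrow> 'v \<Rightarrow> 'v" where
  "lagrangian_unitary J \<Lambda> L z = (THE w. w \<in> J_minus J \<Lambda> \<and> z + w \<in> L)"

definition lagrangian_pair_index ::
    "'x topology \<Rightarrow> ('v::complex_hilbert \<Rightarrow> 'v) \<Rightarrow> ('x \<Rightarrow> 'v set) \<Rightarrow> ('x \<Rightarrow> 'v set) \<Rightarrow>
     ('x \<Rightarrow> 'v set) \<Rightarrow> ('x \<Rightarrow> 'h::complex_hilbert \<Rightarrow>\<^sub>L 'h) set" where
  "lagrangian_pair_index X J \<Lambda> L M =
     K1_index_family X (\<lambda>x. J_plus J (\<Lambda> x))
       (\<lambda>x z. - inv_into (J_plus J (\<Lambda> x)) (lagrangian_unitary J (\<Lambda> x) (M x))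
                 (lagrangian_unitary J (\<Lambda> x) (L x) z))"


section \<open>Self-adjoint relations and extensions\<close>

definition J_std :: "'h::complex_hilbert \<times> 'h \<Rightarrow> 'h \<times> 'h" where
  "J_std = (\<lambda>(\<xi>0, \<xi>1). (\<xi>1, - \<xi>0))"

definition self_adjoint_relation :: "'h::complex_hilbert set \<Rightarrow> ('h \<times> 'h) set \<Rightarrow> bool" where
  "self_adjoint_relation K L \<longleftrightarrow> lagrangian J_std (K \<times> K) L"

definition Fredholm_relation :: "'h::complex_hilbert set \<Rightarrow> ('h \<times> 'h) set \<Rightarrow> bool" where
  "Fredholm_relation K L \<longleftrightarrow> Fredholm_pair (K \<times> K) L (K \<times> {0})"

definition relation_index ::
    "'x topology \<Rightarrow> ('x \<Rightarrow> 'h::complex_hilbert set) \<Rightarrow> ('x \<Rightarrow> ('h \<times> 'h) set) \<Rightarrow>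
     ('x \<Rightarrow> 'h \<Rightarrow>\<^sub>L 'h) set" where
  "relation_index X K L =
     lagrangian_pair_index X J_std (\<lambda>x. K x \<times> K x) L (\<lambda>x. K x \<times> {0})"

text \<open>\<open>\<Gamma> (\<zeta> + \<xi>0 + \<theta>) = (\<xi>0, \<xi>1)\<close> where \<open>\<zeta> \<in> dom A\<close>, \<open>\<xi>0, \<xi>1 \<in> K = ker A\<^sup>*\<close> and \<open>\<theta> = R\<inverse> \<xi>1\<close> for the
  reference operator \<open>R\<close>.\<close>

definition boundary_map ::
    "('h::complex_hilbert \<times> 'h) set \<Rightarrow> ('h \<times> 'h) set \<Rightarrow> 'h \<Rightarrow> 'h \<times> 'h" where
  "boundary_map A R \<xi> =
     (THE (\<xi>0, \<xi>1). \<xi>0 \<in> op_kernel (op_adjoint A) \<and> \<xi>1 \<in> op_kernel (op_adjoint A) \<and>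
        (\<exists>\<zeta>\<in>Domain A. \<exists>\<theta>. (\<theta>, \<xi>1) \<in> R \<and> \<xi> = \<zeta> + \<xi>0 + \<theta>))"

definition extension_by ::
    "('h::complex_hilbert \<times> 'h) set \<Rightarrow> ('h \<times> 'h) set \<Rightarrow> ('h \<times> 'h) set \<Rightarrow> ('h \<times> 'h) set" where
  "extension_by A R L = {(\<xi>, \<eta>) \<in> op_adjoint A. boundary_map A R \<xi> \<in> L}"

end

theory Submission
  imports Defs
begin

text \<open>
  Let \<open>R\<close> be the inverse of the reference operator, which is bounded, and \<open>P\<close> the projection onto \<open>K\<close>.
  The graph of \<open>A\<^sub>L\<close> is \<open>{(R \<eta> + \<xi>, \<eta>) | (\<xi>, P \<eta>) \<in> L}\<close>. Replacing \<open>R\<close> by \<open>t R\<close> gives self-adjoint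
  Fredholm relations with the same kernel and range, hence a homotopy of Cayley transforms from the
  Cayley transform of \<open>A\<^sub>L\<close> at \<open>t = 1\<close> to that of \<open>L\<close>, extended by \<open>1\<close> on the complement of \<open>K\<close>, at
  \<open>t = 0\<close>. The latter is \<open>- u\<^sub>M\<inverse> u\<^sub>L\<close> for \<open>M = K \<oplus> 0\<close>.

  That the index does not depend on the trivialization amounts to \<open>g F g\<inverse>\<close> being homotopic to \<open>F\<close>
  for families \<open>F\<close> in the Fredholm class and norm continuous families \<open>g\<close> of unitaries. The family \<open>F\<close>
  is first deformed, by functional calculus, to finite rank perturbations of \<open>1\<close>. It can then be
  compressed along a strongly continuous path of isometries onto a subspace of infinite codimension,
  and there is room to rotate \<open>g\<close> away. No form of Kuiper's theorem is needed, and \<open>X\<close> is arbitrary.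
\<close>

section \<open>Real Hilbert spaces\<close>

text \<open>Both indices are definite descriptions over all admissible identifications, so each
  needs an explicit one and independence of it. The identity and an isometry of infinite codimension
  cannot be joined in norm, because the semi-Fredholm index is locally constant. Hence the merely
  strongly continuous path, and hence the reduction to finite rank: \<open>u + 1\<close> Fredholm
  does not make \<open>u - 1\<close> compact. The reduction uses a gap of the essential spectrum of
  \<open>u\<close> at -1; since \<open>X\<close> is arbitrary, the width of the gap has to depend
  continuously on \<open>u\<close>. Shearing by \<open>t R\<close> stays in the Fredholm class
  because 1 plus the sheared Cayley transform is \<open>1 + c\<close> times an invertible operator,
  \<open>c\<close> being the Cayley transform at \<open>t = 0\<close>. The positive part varies with
  \<open>x\<close>. It is trivialized by an infinite repetition that uses only the projections onto
  \<open>K x\<close>, so norm continuity can be read off the formula. Bounded operators are real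
  linear here. Projections, adjoints and inverses are built over the reals, and complex linearity is
  recovered from commutation with multiplication by \<open>i\<close>.\<close>

lemma exists_orthogonal_projection:
  fixes S :: "'a::{real_inner,complete_space} set"
  assumes S: "subspace S" "closed S"
  obtains w where "w \<in> S" "\<And>s. s \<in> S \<Longrightarrow> inner (v - w) s = 0"
proof -
  define d where "d = infdist v S"
  \<comment> \<open>Nested closed sets of almost nearest points. By the parallelogram law, applied
    at the midpoint, their diameters tend to 0, so completeness yields a common point; it is nearest
    to \<open>v\<close>.\<close>
  define T where "T n = {w \<in> S. (norm (v - w))\<^sup>2 \<le> d\<^sup>2 + 1 / real (Suc n)}" for n
  have ne: "S \<noteq> {}" using S(1) subspace_0 by blast
  have d0: "0 \<le> d" by (simp add: d_def infdist_nonneg)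
  have dle: "d \<le> norm (v - w)" if "w \<in> S" for w
    using infdist_le[OF that, of v] by (simp add: d_def dist_norm)
  have T_ne: "T n \<noteq> {}" for n
  proof -
    have "sqrt (d\<^sup>2 + 1 / real (Suc n)) > d"
      by (rule real_less_rsqrt) simp
    then have "(INF w\<in>S. dist v w) < sqrt (d\<^sup>2 + 1 / real (Suc n))"
      using ne by (simp add: d_def infdist_def)
    then obtain w where w: "w \<in> S" "dist v w < sqrt (d\<^sup>2 + 1 / real (Suc n))"
      using cInf_lessD[of "dist v ` S"] ne by auto
    then have "(dist v w)\<^sup>2 \<le> (sqrt (d\<^sup>2 + 1 / real (Suc n)))\<^sup>2"
      by (intro power_mono) auto
    then show ?thesis using w(1) by (auto simp: T_def dist_norm)
  qed
  have T_closed: "closed (T n)" for n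
  proof -
    have "T n = S \<inter> {w. (norm (v - w))\<^sup>2 \<le> d\<^sup>2 + 1 / real (Suc n)}"
      by (auto simp: T_def)
    then show ?thesis
      using S(2) by (auto intro!: closed_Int closed_Collect_le continuous_intros)
  qed
  have T_mono: "T n \<subseteq> T m" if "m \<le> n" for m n
  proof -
    have "1 / real (Suc n) \<le> 1 / real (Suc m)"
      using that by (simp add: frac_le)
    then show ?thesis by (auto simp: T_def)
  qed
  have T_diam: "\<exists>n. \<forall>x\<in>T n. \<forall>y\<in>T n. dist x y < e" if "e > 0" for e
  proof -
    obtain n where n: "4 / e\<^sup>2 < real n" using reals_Archimedean2 by blast
    have "dist x y < e" if x: "x \<in> T n" and y: "y \<in> T n" for x y
    proof -
      have "(1/2) *\<^sub>R (x + y) \<in> S"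
        using x y S(1) by (auto simp: T_def intro!: subspace_scale subspace_add)
      then have "d\<^sup>2 \<le> (norm (v - (1/2) *\<^sub>R (x + y)))\<^sup>2"
        using dle d0 by (intro power_mono) auto
      moreover have "(norm (x - y))\<^sup>2 =
          2 * (norm (v - x))\<^sup>2 + 2 * (norm (v - y))\<^sup>2 - 4 * (norm (v - (1/2) *\<^sub>R (x + y)))\<^sup>2"
        unfolding power2_norm_eq_inner
        by (simp add: inner_diff_left inner_diff_right inner_add_left inner_add_right
            inner_commute algebra_simps)
      ultimately have "(norm (x - y))\<^sup>2 \<le> 4 / real (Suc n)"
        using x y by (auto simp: T_def)
      also have "\<dots> < e\<^sup>2"
      proof -
        have "4 / e\<^sup>2 < real (Suc n)" using n by simp
        then show ?thesis using \<open>e > 0\<close> by (simp add: field_simps del: of_nat_Suc)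
      qed
      finally show ?thesis
        using \<open>e > 0\<close> by (simp add: dist_norm power_less_imp_less_base)
    qed
    then show ?thesis by blast
  qed
  obtain w where w: "\<And>n. w \<in> T n"
    using decreasing_closed_nest[of T] T_closed T_ne T_mono T_diam by metis
  have wS: "w \<in> S" using w by (auto simp: T_def)
  have wd: "(norm (v - w))\<^sup>2 \<le> d\<^sup>2"
  proof (rule LIMSEQ_le_const)
    show "(\<lambda>n. d\<^sup>2 + 1 / real (Suc n)) \<longlonglongrightarrow> d\<^sup>2"
      using tendsto_add[OF tendsto_const LIMSEQ_inverse_real_of_nat, of "d\<^sup>2"]
      by (simp add: inverse_eq_divide)
    show "\<exists>N. \<forall>n\<ge>N. (norm (v - w))\<^sup>2 \<le> d\<^sup>2 + 1 / real (Suc n)"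
      using w by (auto simp: T_def)
  qed
  have "inner (v - w) s = 0" if s: "s \<in> S" for s
  proof (cases "s = 0")
    case False
    \<comment> \<open>The minimizer of the squared distance from \<open>v\<close> to
      \<open>w + r s\<close> as a quadratic polynomial in \<open>r\<close>. The gain over
      \<open>r = 0\<close> is a square, and minimality of \<open>w\<close> forces it to
      vanish.\<close>
    define r where "r = inner (v - w) s / inner s s"
    have ss: "inner s s > 0" using False by simp
    have "w + r *\<^sub>R s \<in> S" using wS s S(1) by (auto intro!: subspace_scale subspace_add)
    then have "d\<^sup>2 \<le> (norm (v - (w + r *\<^sub>R s)))\<^sup>2" using dle d0 by (intro power_mono) auto
    also have "\<dots> = (norm (v - w))\<^sup>2 - 2 * r * inner (v - w) s + r * r * inner s s"
      unfolding power2_norm_eq_inner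
      by (simp add: inner_diff_left inner_diff_right inner_add_left inner_add_right
            inner_commute algebra_simps)
    also have "\<dots> = (norm (v - w))\<^sup>2 - (inner (v - w) s)\<^sup>2 / inner s s"
      using ss by (simp add: r_def field_simps power2_eq_square)
    finally have "(inner (v - w) s)\<^sup>2 / inner s s \<le> 0" using wd by linarith
    then have "(inner (v - w) s)\<^sup>2 \<le> 0" using ss by (simp add: divide_le_0_iff)
    then show ?thesis by simp
  qed simp
  then show ?thesis using that wS by blast
qed

lemma closed_subspace_eq_UNIV:
  fixes S :: "'a::{real_inner,complete_space} set"
  assumes "subspace S" "closed S" "\<And>v. (\<And>s. s \<in> S \<Longrightarrow> inner v s = 0) \<Longrightarrow> v = 0"
  shows "S = UNIV"
proof -
  have "v \<in> S" for v
  proof -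
    obtain w where w: "w \<in> S" "\<And>s. s \<in> S \<Longrightarrow> inner (v - w) s = 0"
      using exists_orthogonal_projection[OF assms(1,2), of v] by blast
    then have "v - w = 0" using assms(3) by blast
    then show ?thesis using w(1) by simp
  qed
  then show ?thesis by auto
qed

lemma Riesz_representation:
  fixes f :: "'a::{real_inner,complete_space} \<Rightarrow> real"
  assumes "bounded_linear f"
  obtains a where "\<And>x. f x = inner a x"
proof (cases "\<forall>x. f x = 0")
  case True
  then show ?thesis using that[of 0] by simp
next
  case False
  then obtain x0 where x0: "f x0 \<noteq> 0" by blast
  interpret bounded_linear f by fact
  define S where "S = {x. f x = 0}"
  have "subspace S" by (auto simp: S_def subspace_def zero add scale)
  moreover have "closed S"
    unfolding S_def by (intro closed_Collect_eq continuous_intros continuous_on)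
  ultimately obtain w where w: "w \<in> S" "\<And>s. s \<in> S \<Longrightarrow> inner (x0 - w) s = 0"
    using exists_orthogonal_projection by blast
  define y where "y = x0 - w"
  have fy: "f y = f x0" using w(1) by (simp add: y_def S_def diff)
  then have y0: "inner y y > 0" using x0 zero by auto
  show ?thesis
  proof (rule that)
    fix x
    have "x - (f x / f y) *\<^sub>R y \<in> S" using fy x0 by (simp add: S_def diff scale)
    then have "inner y (x - (f x / f y) *\<^sub>R y) = 0" using w(2) by (simp add: y_def)
    then have "inner y x = (f x / f y) * inner y y" by (simp only: inner_diff_right inner_scaleR_right)
    then show "f x = inner ((f y / inner y y) *\<^sub>R y) x"
      using fy x0 y0 by (simp add: field_simps)
  qed
qed

text \<open>Uniform boundedness from Baire: the closed sets \<open>C n\<close> cover the space, so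
  one of them contains a ball. It takes the place of the open mapping and closed graph theorems
  below, both for lower bounds of Fredholm operators and for boundedness of the inverse of the
  reference operator.\<close>

lemma weakly_bounded_imp_bounded:
  fixes S :: "'a::{real_inner,complete_space} set"
  assumes wb: "\<And>y. \<exists>C. \<forall>s\<in>S. \<bar>inner y s\<bar> \<le> C"
  shows "bounded S"
proof -
  define C where "C n = {y. \<forall>s\<in>S. \<bar>inner y s\<bar> \<le> real n}" for n
  have cl: "closed (C n)" for n
  proof -
    have "C n = (\<Inter>s\<in>S. {y. \<bar>inner y s\<bar> \<le> real n})" by (auto simp: C_def)
    then show ?thesis by (auto intro!: closed_Collect_le continuous_intros)
  qed
  have "(\<Union>n. C n) = UNIV"
  proof -
    have "y \<in> (\<Union>n. C n)" for y
    proof -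
      obtain c where c: "\<forall>s\<in>S. \<bar>inner y s\<bar> \<le> c" using wb by blast
      obtain n where "c \<le> real n" using real_arch_simple by blast
      then have "y \<in> C n" using c by (force simp: C_def)
      then show ?thesis by blast
    qed
    then show ?thesis by auto
  qed
  then have "interior (\<Union>(range C)) \<noteq> {}" by simp
  moreover have "interior (\<Union>(range C)) = {}" if "\<And>n. interior (C n) = {}"
    using Met_TC.metric_Baire_category_alt[where ?'a='a, of "range C"] cl that
    by (auto simp: complete_UNIV)
  ultimately obtain n where "interior (C n) \<noteq> {}" by blast
  then obtain a e where e: "e > 0" "ball a e \<subseteq> C n"
    by (metis ex_in_conv mem_interior)
  have "norm s \<le> 4 * real n / e" if s: "s \<in> S" for s
  proof (cases "s = 0")
    case False
    define y where "y = (e / (2 * norm s)) *\<^sub>R s"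
    have "a + y \<in> ball a e" using e False by (simp add: y_def dist_norm)
    then have 1: "\<bar>inner (a + y) s\<bar> \<le> real n" using e s by (auto simp: C_def)
    have "a \<in> C n" using e by (meson centre_in_ball subsetD)
    then have 2: "\<bar>inner a s\<bar> \<le> real n" using s by (auto simp: C_def)
    have "inner y s = e * norm s / 2"
      using False by (simp add: y_def power2_norm_eq_inner[symmetric] power2_eq_square)
    moreover have "inner y s \<le> 2 * real n" using 1 2 by (simp add: inner_add_left)
    ultimately show ?thesis using e by (simp add: field_simps)
  qed (use e in simp)
  then show ?thesis unfolding bounded_iff by blast
qed


text \<open>Cancels a factor in estimates \<open>norm w * norm w \<le> b * norm w\<close> where
  \<open>norm w\<close> may vanish.\<close>

lemma le_of_mult_self_le: "a * a \<le> b * a \<Longrightarrow> 0 \<le> a \<Longrightarrow> 0 \<le> b \<Longrightarrow> a \<le> b" for a b :: real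
  by (cases "a = 0") (auto simp: mult_le_cancel_right)


subsection \<open>Adjoints\<close>

lemma inner_eqI: "u = v" if "\<And>z. inner z u = inner z v" for u v :: "'a::real_inner"
proof -
  have "inner (u - v) (u - v) = 0" using that[of "u - v"] by (simp add: inner_diff_right)
  then show ?thesis by simp
qed

text \<open>For a complex linear operator the adjoint with respect to the real part of the inner
  product is the complex adjoint, so one notion serves both structures.\<close>

definition adj :: "('a::{real_inner,complete_space} \<Rightarrow>\<^sub>L 'b::real_inner) \<Rightarrow> 'b \<Rightarrow>\<^sub>L 'a" where
  "adj T = Blinfun (adjoint (blinfun_apply T))"

text \<open>\<open>adjoint\<close> is a choice, meaningful once some adjoint function exists. Riesz
  representation supplies one, and testing against its own value bounds it.\<close>

lemma inner_adj: "inner x (adj T y) = inner (T x) y"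
proof -
  have ex: "\<exists>f'. \<forall>x y. inner (T x) y = inner x (f' y)"
  proof -
    have "\<forall>y. \<exists>a. \<forall>x. inner (T x) y = inner x a"
    proof
      fix y
      have "bounded_linear (\<lambda>x. inner (T x) y)" by (intro bounded_linear_intros)
      then obtain a where "\<And>x. inner (T x) y = inner a x" using Riesz_representation by blast
      then show "\<exists>a. \<forall>x. inner (T x) y = inner x a" by (auto simp: inner_commute)
    qed
    from choice[OF this] show ?thesis by blast
  qed
  have a: "inner (T x) y = inner x (adjoint (blinfun_apply T) y)" for x y
    unfolding adjoint_def using someI_ex[OF ex] by blast
  have eqI: "u = v" if "\<And>z. inner z u = inner z v" for u v :: 'a
    by (rule inner_eqI) (rule that)
  have "bounded_linear (adjoint (blinfun_apply T))"
  proof (rule bounded_linear_intro)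
    fix y z r
    show "adjoint (blinfun_apply T) (y + z) = adjoint (blinfun_apply T) y + adjoint (blinfun_apply T) z"
      by (rule eqI) (simp add: a[symmetric] inner_add_right)
    show "adjoint (blinfun_apply T) (r *\<^sub>R y) = r *\<^sub>R adjoint (blinfun_apply T) y"
      by (rule eqI) (simp add: a[symmetric])
    let ?z = "adjoint (blinfun_apply T) y"
    have "norm ?z * norm ?z = inner (T ?z) y"
      by (simp add: a power2_norm_eq_inner[symmetric] power2_eq_square)
    also have "\<dots> \<le> norm (T ?z) * norm y" by (rule norm_cauchy_schwarz)
    also have "\<dots> \<le> (norm T * norm ?z) * norm y"
      by (intro mult_right_mono norm_blinfun) simp
    finally have "norm ?z * norm ?z \<le> (norm y * norm T) * norm ?z" by (simp add: mult_ac)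
    then show "norm ?z \<le> norm y * norm T"
      by (rule le_of_mult_self_le) simp_all
  qed
  then show ?thesis by (simp add: adj_def bounded_linear_Blinfun_apply a)
qed

lemma inner_adj_left: "inner (adj T y) x = inner y (T x)"
  using inner_adj[of x T y] by (simp add: inner_commute)

lemma adjI: "adj T = S" if "\<And>x y. inner (T x) y = inner x (S y)"
  for T :: "'a::{real_inner,complete_space} \<Rightarrow>\<^sub>L 'b::real_inner" and S :: "'b \<Rightarrow>\<^sub>L 'a"
  by (rule blinfun_eqI, rule inner_eqI) (simp add: inner_adj that)

lemma adj_adj [simp]: "adj (adj T) = T"
  for T :: "'a::{real_inner,complete_space} \<Rightarrow>\<^sub>L 'b::{real_inner,complete_space}"
  by (rule adjI) (simp add: inner_adj_left)

lemma adj_compose: "adj (S o\<^sub>L T) = adj T o\<^sub>L adj S"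
  for T :: "'a::{real_inner,complete_space} \<Rightarrow>\<^sub>L 'b::{real_inner,complete_space}"
  by (rule adjI) (simp add: inner_adj)

lemma adj_id [simp]: "adj id_blinfun = id_blinfun"
  by (rule adjI) simp

lemma norm_adj_le: "norm (adj T) \<le> norm T"
proof (rule norm_blinfun_bound)
  fix y
  have "norm (adj T y) * norm (adj T y) = inner (T (adj T y)) y"
    by (simp add: inner_adj[symmetric] power2_norm_eq_inner[symmetric] power2_eq_square)
  also have "\<dots> \<le> norm (T (adj T y)) * norm y" by (rule norm_cauchy_schwarz)
  also have "\<dots> \<le> (norm T * norm (adj T y)) * norm y"
    by (intro mult_right_mono norm_blinfun) simp
  finally have "norm (adj T y) * norm (adj T y) \<le> (norm T * norm y) * norm (adj T y)"
    by (simp add: mult_ac)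
  then show "norm (adj T y) \<le> norm T * norm y"
    by (rule le_of_mult_self_le) simp_all
qed simp

lemma bounded_linear_adj: "bounded_linear adj"
proof (rule bounded_linear_intro[where K=1])
  show "adj (S + T) = adj S + adj T" for S T :: "'a \<Rightarrow>\<^sub>L 'b"
    by (rule adjI) (simp add: inner_adj blinfun.add_left inner_add_left inner_add_right)
  show "adj (r *\<^sub>R T) = r *\<^sub>R adj T" for r and T :: "'a \<Rightarrow>\<^sub>L 'b"
    by (rule adjI) (simp add: inner_adj blinfun.scaleR_left)
qed (use norm_adj_le in simp)

lemmas adj_add = bounded_linear.linear[OF bounded_linear_adj, THEN linear_add]
lemmas adj_diff = bounded_linear.linear[OF bounded_linear_adj, THEN linear_diff]
lemmas adj_scaleR = bounded_linear.linear[OF bounded_linear_adj, THEN linear_cmul]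
lemmas tendsto_adj [tendsto_intros] = bounded_linear.tendsto[OF bounded_linear_adj]

lemma inner_symmetric: "adj T = T \<Longrightarrow> inner (T x) y = inner x (T y)"
  for T :: "'a::{real_inner,complete_space} \<Rightarrow>\<^sub>L 'a"
  using inner_adj[of x T y] by simp

lemma isometry_adj: "adj T o\<^sub>L T = id_blinfun \<longleftrightarrow> (\<forall>v. norm (T v) = norm v)"
  for T :: "'a::{real_inner,complete_space} \<Rightarrow>\<^sub>L 'b::real_inner"
proof
  assume *: "adj T o\<^sub>L T = id_blinfun"
  have "(norm (T v))\<^sup>2 = (norm v)\<^sup>2" for v
  proof -
    have "(norm (T v))\<^sup>2 = inner v ((adj T o\<^sub>L T) v)" by (simp add: power2_norm_eq_inner inner_adj)
    then show ?thesis using * by (simp add: power2_norm_eq_inner)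
  qed
  then show "\<forall>v. norm (T v) = norm v" by simp
next
  assume *: "\<forall>v. norm (T v) = norm v"
  have iso: "inner (T x) (T y) = inner x y" for x y
    using * by (simp add: dot_norm blinfun.add_right[symmetric])
  show "adj T o\<^sub>L T = id_blinfun"
    by (rule blinfun_eqI, rule inner_eqI) (simp add: inner_adj iso)
qed

lemma isometry_inner: "(\<And>v. norm (T v) = norm v) \<Longrightarrow> inner (T x) (T y) = inner x y"
  for T :: "'a::real_inner \<Rightarrow>\<^sub>L 'b::real_inner"
  by (simp add: dot_norm blinfun.add_right[symmetric])

lemma isometry_adj_apply: "(\<And>v. norm (T v) = norm v) \<Longrightarrow> adj T (T v) = v"
  for T :: "'a::{real_inner,complete_space} \<Rightarrow>\<^sub>L 'b::real_inner"
  using isometry_adj[of T] blinfun_apply_blinfun_compose[of "adj T" T v] by simp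


subsection \<open>Inverses\<close>

definition invertible_blinfun :: "('a::real_normed_vector \<Rightarrow>\<^sub>L 'b::real_normed_vector) \<Rightarrow> bool" where
  "invertible_blinfun T \<longleftrightarrow> (\<exists>S. S o\<^sub>L T = id_blinfun \<and> T o\<^sub>L S = id_blinfun)"

definition blinfun_inverse :: "('a::real_normed_vector \<Rightarrow>\<^sub>L 'b::real_normed_vector) \<Rightarrow> 'b \<Rightarrow>\<^sub>L 'a" where
  "blinfun_inverse T = (SOME S. S o\<^sub>L T = id_blinfun \<and> T o\<^sub>L S = id_blinfun)"

lemma
  assumes "invertible_blinfun T"
  shows blinfun_inverse_left: "blinfun_inverse T (T v) = v"
    and blinfun_inverse_right: "T (blinfun_inverse T w) = w"
proof -
  have "blinfun_inverse T o\<^sub>L T = id_blinfun \<and> T o\<^sub>L blinfun_inverse T = id_blinfun"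
    using assms unfolding invertible_blinfun_def blinfun_inverse_def by (rule someI_ex)
  then show "blinfun_inverse T (T v) = v" "T (blinfun_inverse T w) = w"
    using blinfun_apply_blinfun_compose[of "blinfun_inverse T" T v]
      blinfun_apply_blinfun_compose[of T "blinfun_inverse T" w] by simp_all
qed

lemma closed_range_bounded_below:
  fixes T :: "'a::{real_normed_vector,complete_space} \<Rightarrow>\<^sub>L 'b::real_normed_vector"
  assumes "0 < m" "subspace S" "closed S" "\<And>v. v \<in> S \<Longrightarrow> m * norm v \<le> norm (T v)"
  shows "closed (T ` S)"
proof (rule complete_imp_closed)
  show "complete (T ` S)"
    using complete_isometric_image[OF assms(1,2) blinfun.bounded_linear_right, of T] assms(3,4)
    by (simp add: complete_eq_closed mult.commute)
qed

text \<open>The lower bound gives injectivity, closedness of the range and the bound of the inverse;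
  injectivity of the adjoint makes the range dense.\<close>

lemma invertible_blinfunI:
  fixes T :: "'a::{real_inner,complete_space} \<Rightarrow>\<^sub>L 'b::{real_inner,complete_space}"
  assumes m: "0 < m" "\<And>v. m * norm v \<le> norm (T v)" and adj: "\<And>v. adj T v = 0 \<Longrightarrow> v = 0"
  shows "invertible_blinfun T"
proof -
  have inj: "inj T"
  proof (rule injI)
    fix x y assume "T x = T y"
    then have "m * norm (x - y) \<le> 0" using m(2)[of "x - y"] by (simp add: blinfun.diff_right)
    then show "x = y" using m(1) by (simp add: mult_le_0_iff)
  qed
  have "range T = UNIV"
  proof (rule closed_subspace_eq_UNIV)
    show "subspace (range T)"
      by (intro linear_subspace_image bounded_linear.linear blinfun.bounded_linear_right subspace_UNIV)
    show "closed (range T)"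
      using closed_range_bounded_below[OF m(1) subspace_UNIV closed_UNIV] m(2) by blast
    show "v = 0" if "\<And>s. s \<in> range T \<Longrightarrow> inner v s = 0" for v
    proof (rule adj)
      have "inner (adj T v) (adj T v) = 0" using that by (simp add: inner_adj_left)
      then show "adj T v = 0" by simp
    qed
  qed
  then have surj: "T (inv T w) = w" for w by (simp add: surj_f_inv_f)
  have "bounded_linear (inv T)"
  proof (rule bounded_linear_intro[where K="1/m"])
    fix x y r
    show "inv T (x + y) = inv T x + inv T y" "inv T (r *\<^sub>R x) = r *\<^sub>R inv T x"
      by (intro injD[OF inj], simp add: surj blinfun.add_right blinfun.scaleR_right)+
    show "norm (inv T x) \<le> norm x * (1 / m)"
      using m(2)[of "inv T x"] m(1) by (simp add: surj field_simps)
  qed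
  then have "blinfun_apply (Blinfun (inv T)) = inv T" by (rule bounded_linear_Blinfun_apply)
  then show ?thesis
    unfolding invertible_blinfun_def
    by (intro exI[of _ "Blinfun (inv T)"]) (auto intro!: blinfun_eqI simp: surj inv_f_f inj)
qed

text \<open>With \<open>S\<close> the inverse of \<open>T x\<close>, the identity
  \<open>S - S0 = - S (T x - T0) S0\<close> reduces the claim to a bound of \<open>S\<close> that is
  uniform near \<open>T0\<close>. Absorbing a perturbation smaller than \<open>1 / (2 * c)\<close>
  gives the bound \<open>2 * c\<close>.\<close>

lemma tendsto_blinfun_inverse [tendsto_intros]:
  assumes lim: "(T \<longlongrightarrow> T0) F" and inv: "eventually (\<lambda>x. invertible_blinfun (T x)) F" "invertible_blinfun T0"
  shows "((\<lambda>x. blinfun_inverse (T x)) \<longlongrightarrow> blinfun_inverse T0) F"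
proof -
  define S0 where "S0 = blinfun_inverse T0"
  \<comment> \<open>The summand 1 keeps \<open>c\<close> positive even on the zero space.\<close>
  define c where "c = norm S0 + 1"
  have c: "c > 0" "norm S0 \<le> c" using norm_ge_zero[of S0] unfolding c_def by linarith+
  have small: "eventually (\<lambda>x. norm (T x - T0) < 1 / (2 * c)) F"
    using lim c by (auto simp: tendsto_iff dist_norm)
  have "eventually (\<lambda>x. norm (blinfun_inverse (T x) - S0) \<le> norm (T x - T0) * (2 * c * c)) F"
    using small inv(1)
  proof eventually_elim
    case (elim x)
    let ?S = "blinfun_inverse (T x)"
    have bd: "norm (?S v) \<le> 2 * c * norm v" for v
    proof -
      let ?w = "?S v"
      have "norm ?w = norm (S0 (T0 ?w))" by (simp add: S0_def blinfun_inverse_left inv(2))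
      also have "\<dots> \<le> norm S0 * norm (T0 ?w)" by (rule norm_blinfun)
      also have "\<dots> \<le> c * norm (T0 ?w)" by (intro mult_right_mono c) simp
      also have "T0 ?w = v - (T x - T0) ?w"
        by (simp add: blinfun.diff_left blinfun_inverse_right elim)
      also have "norm (v - (T x - T0) ?w) \<le> norm v + 1 / (2 * c) * norm ?w"
      proof -
        have "norm ((T x - T0) ?w) \<le> 1 / (2 * c) * norm ?w"
          by (rule order_trans[OF norm_blinfun], rule mult_right_mono) (use elim(1) in simp_all)
        then show ?thesis using norm_triangle_ineq4[of v "(T x - T0) ?w"] by linarith
      qed
      finally have "norm ?w \<le> c * (norm v + 1 / (2 * c) * norm ?w)" using c(1) by simp
      also have "\<dots> = c * norm v + norm ?w / 2" using c(1) by (simp add: distrib_left)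
      finally show ?thesis by simp
    qed
    show ?case
    proof (rule norm_blinfun_bound)
      fix v
      have "(?S - S0) v = - ?S ((T x - T0) (S0 v))"
        by (simp add: blinfun.diff_left blinfun.diff_right blinfun_inverse_left elim
            S0_def blinfun_inverse_right inv(2))
      then have "norm ((?S - S0) v) \<le> 2 * c * norm ((T x - T0) (S0 v))" using bd by simp
      also have "\<dots> \<le> 2 * c * (norm (T x - T0) * norm (S0 v))"
        using c(1) by (intro mult_left_mono norm_blinfun) simp
      also have "norm (S0 v) \<le> c * norm v"
        by (rule order_trans[OF norm_blinfun], rule mult_right_mono[OF c(2)]) simp
      then have "2 * c * (norm (T x - T0) * norm (S0 v)) \<le> 2 * c * (norm (T x - T0) * (c * norm v))"
        using c(1) by (intro mult_left_mono) simp_all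
      finally show "norm ((?S - S0) v) \<le> norm (T x - T0) * (2 * c * c) * norm v"
        by (simp add: mult_ac)
    qed (use c in simp)
  qed
  moreover have "((\<lambda>x. norm (T x - T0) * (2 * c * c)) \<longlongrightarrow> norm (T0 - T0) * (2 * c * c)) F"
    by (intro tendsto_mult_right tendsto_norm tendsto_diff tendsto_const lim)
  then have "((\<lambda>x. norm (T x - T0) * (2 * c * c)) \<longlongrightarrow> 0) F" by simp
  ultimately have "((\<lambda>x. blinfun_inverse (T x) - S0) \<longlongrightarrow> 0) F"
    by (rule Lim_null_comparison)
  then show ?thesis unfolding S0_def by (rule LIM_zero_cancel)
qed

section \<open>The absolute value of a symmetric contraction\<close>

text \<open>A fixed point \<open>Y\<close> satisfies \<open>(1 - Y)^2 = 1 - X\<close>, so the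
  iteration approaches \<open>1 - sqrt (1 - X)\<close>. With \<open>X = 1 - S^2\<close> this
  produces the absolute value of \<open>S\<close> as a norm limit of polynomials.\<close>

primrec newton :: "('a::real_normed_vector \<Rightarrow>\<^sub>L 'a) \<Rightarrow> nat \<Rightarrow> 'a \<Rightarrow>\<^sub>L 'a" where
  "newton X 0 = 0"
| "newton X (Suc n) = (1/2) *\<^sub>R (X + (newton X n o\<^sub>L newton X n))"

text \<open>The scalar iteration at \<open>X = 1\<close>. It majorizes the operator iteration on the
  whole unit ball because the iterates are polynomials with nonnegative coefficients.\<close>

primrec newton_bound :: "nat \<Rightarrow> real" where
  "newton_bound 0 = 0"
| "newton_bound (Suc n) = (1 + newton_bound n * newton_bound n) / 2"

lemma newton_bound_range: "0 \<le> newton_bound n \<and> newton_bound n \<le> 1"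
proof (induction n)
  case (Suc n)
  then have "newton_bound n * newton_bound n \<le> 1 * 1" by (intro mult_mono) auto
  with Suc show ?case by simp
qed simp

lemma newton_bound_mono: "newton_bound n \<le> newton_bound (Suc n)"
proof -
  have "0 \<le> (1 - newton_bound n) * (1 - newton_bound n)" by (rule zero_le_square)
  then show ?thesis by (simp add: algebra_simps)
qed

lemma norm_newton_le:
  assumes "norm X \<le> 1"
  shows "norm (newton X n) \<le> newton_bound n"
proof (induction n)
  case (Suc n)
  have "norm (newton X n o\<^sub>L newton X n) \<le> newton_bound n * newton_bound n"
    by (rule order_trans[OF norm_blinfun_compose], rule mult_mono) (use Suc newton_bound_range in auto)
  then have "norm (X + (newton X n o\<^sub>L newton X n)) \<le> 1 + newton_bound n * newton_bound n"
    using assms norm_triangle_ineq[of X "newton X n o\<^sub>L newton X n"] by linarith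
  then show ?case by simp
qed simp

text \<open>For consecutive iterates \<open>Y\<close> and \<open>Z\<close>,
  \<open>Z^2 - Y^2 = Z (Z - Y) + (Z - Y) Y\<close>. The scalar majorant obeys the same identity, so
  the bound is inherited term by term.\<close>

lemma norm_newton_diff_Suc_le:
  assumes "norm X \<le> 1"
  shows "norm (newton X (Suc n) - newton X n) \<le> newton_bound (Suc n) - newton_bound n"
proof (induction n)
  case 0
  then show ?case using assms by simp
next
  case (Suc n)
  let ?Y = "newton X n" and ?Z = "newton X (Suc n)"
  let ?y = "newton_bound n" and ?z = "newton_bound (Suc n)"
  have "norm (newton X (Suc (Suc n)) - ?Z) = norm ((?Z o\<^sub>L (?Z - ?Y)) + ((?Z - ?Y) o\<^sub>L ?Y)) / 2"
  proof -
    have "newton X (Suc (Suc n)) - ?Z = (1/2) *\<^sub>R ((?Z o\<^sub>L (?Z - ?Y)) + ((?Z - ?Y) o\<^sub>L ?Y))"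
      by (rule blinfun_eqI)
        (simp add: blinfun.add_left blinfun.diff_left blinfun.diff_right blinfun.add_right
          blinfun.scaleR_left blinfun.scaleR_right algebra_simps)
    then show ?thesis by simp
  qed
  also have "\<dots> \<le> (?z * (?z - ?y) + (?z - ?y) * ?y) / 2"
  proof -
    have "norm ((?Z o\<^sub>L (?Z - ?Y))) \<le> ?z * (?z - ?y)"
      by (rule order_trans[OF norm_blinfun_compose], rule mult_mono[OF norm_newton_le[OF assms] Suc.IH])
        (use newton_bound_range[of "Suc n"] in auto)
    moreover have "norm (((?Z - ?Y) o\<^sub>L ?Y)) \<le> (?z - ?y) * ?y"
      by (rule order_trans[OF norm_blinfun_compose], rule mult_mono[OF Suc.IH norm_newton_le[OF assms]])
        (use newton_bound_mono[of n] in auto)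
    ultimately show ?thesis
      using norm_triangle_ineq[of "(?Z o\<^sub>L (?Z - ?Y))" "((?Z - ?Y) o\<^sub>L ?Y)"]
      by (intro divide_right_mono) linarith+
  qed
  also have "\<dots> = newton_bound (Suc (Suc n)) - ?z"
    by (simp add: field_simps)
  finally show ?case .
qed

lemma norm_newton_diff_le:
  assumes "norm X \<le> 1"
  shows "norm (newton X (n + k) - newton X n) \<le> newton_bound (n + k) - newton_bound n"
proof (induction k)
  case (Suc k)
  have "newton X (n + Suc k) - newton X n =
      (newton X (Suc (n + k)) - newton X (n + k)) + (newton X (n + k) - newton X n)" by simp
  then have "norm (newton X (n + Suc k) - newton X n) \<le>
      norm (newton X (Suc (n + k)) - newton X (n + k)) + norm (newton X (n + k) - newton X n)"
    by (metis norm_triangle_ineq)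
  also have "\<dots> \<le> newton_bound (n + Suc k) - newton_bound n"
    using Suc norm_newton_diff_Suc_le[OF assms, of "n + k"] by simp
  finally show ?case .
qed simp

lemma convergent_newton_bound: "convergent newton_bound"
proof (rule Bseq_mono_convergent)
  show "Bseq newton_bound"
    by (rule BseqI'[of _ 1]) (use newton_bound_range in auto)
  show "\<forall>m. \<forall>n\<ge>m. newton_bound m \<le> newton_bound n"
    using lift_Suc_mono_le[of newton_bound, OF newton_bound_mono] by blast
qed

definition newton_lim :: "('a::{real_inner,banach} \<Rightarrow>\<^sub>L 'a) \<Rightarrow> 'a \<Rightarrow>\<^sub>L 'a" where
  "newton_lim X = lim (newton X)"

lemma newton_tendsto:
  fixes X :: "'a::{real_inner,banach} \<Rightarrow>\<^sub>L 'a"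
  assumes "norm X \<le> 1"
  shows "newton X \<longlonglongrightarrow> newton_lim X"
proof -
  have "Cauchy (newton X)"
  proof (rule CauchyI')
    fix e :: real assume "e > 0"
    then obtain M where M: "\<And>m n. m \<ge> M \<Longrightarrow> n \<ge> M \<Longrightarrow> norm (newton_bound m - newton_bound n) < e"
      using CauchyD[OF convergent_Cauchy[OF convergent_newton_bound]] by metis
    have "dist (newton X m) (newton X n) < e" if mn: "m \<ge> M" "m < n" for m n
    proof -
      obtain k where n: "n = m + k" using mn(2) less_imp_add_positive by blast
      have "dist (newton X m) (newton X n) = norm (newton X (m + k) - newton X m)"
        by (simp add: n dist_norm norm_minus_commute)
      also have "\<dots> \<le> newton_bound n - newton_bound m"
        using norm_newton_diff_le[OF assms] n by simp
      also have "\<dots> < e" using M[of n m] mn by simp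
      finally show ?thesis .
    qed
    then show "\<exists>M. \<forall>m\<ge>M. \<forall>n>m. dist (newton X m) (newton X n) < e" by blast
  qed
  then show ?thesis
    unfolding newton_lim_def by (simp add: Cauchy_convergent convergent_LIMSEQ_iff[symmetric])
qed

lemma norm_newton_lim_diff_le:
  fixes X :: "'a::{real_inner,banach} \<Rightarrow>\<^sub>L 'a"
  assumes "norm X \<le> 1"
  shows "norm (newton_lim X - newton X n) \<le> lim newton_bound - newton_bound n"
proof (rule LIMSEQ_le)
  show "(\<lambda>k. norm (newton X (k + n) - newton X n)) \<longlonglongrightarrow> norm (newton_lim X - newton X n)"
    by (intro tendsto_norm tendsto_diff tendsto_const LIMSEQ_ignore_initial_segment newton_tendsto assms)
  show "(\<lambda>k. newton_bound (k + n) - newton_bound n) \<longlonglongrightarrow> lim newton_bound - newton_bound n"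
    by (intro tendsto_diff tendsto_const LIMSEQ_ignore_initial_segment)
      (use convergent_newton_bound convergent_LIMSEQ_iff in blast)
  show "\<exists>N. \<forall>k\<ge>N. norm (newton X (k + n) - newton X n) \<le> newton_bound (k + n) - newton_bound n"
    using norm_newton_diff_le[OF assms, of n] by (simp add: add.commute)
qed

lemma norm_newton_lim_le: "norm X \<le> 1 \<Longrightarrow> norm (newton_lim X) \<le> 1"
  for X :: "'a::{real_inner,banach} \<Rightarrow>\<^sub>L 'a"
  by (rule LIMSEQ_le_const2[OF tendsto_norm[OF newton_tendsto]])
    (use norm_newton_le newton_bound_range order_trans in blast)+

lemma newton_lim_fixed:
  fixes X :: "'a::{real_inner,banach} \<Rightarrow>\<^sub>L 'a"
  assumes "norm X \<le> 1"
  shows "newton_lim X = (1/2) *\<^sub>R (X + (newton_lim X o\<^sub>L newton_lim X))"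
proof (rule LIMSEQ_unique)
  show "(\<lambda>n. newton X (Suc n)) \<longlonglongrightarrow> newton_lim X"
    using newton_tendsto[OF assms] by (rule LIMSEQ_Suc)
  show "(\<lambda>n. newton X (Suc n)) \<longlonglongrightarrow> (1/2) *\<^sub>R (X + (newton_lim X o\<^sub>L newton_lim X))"
    unfolding newton.simps
    by (intro tendsto_scaleR tendsto_add tendsto_const newton_tendsto[OF assms]
        bounded_bilinear.tendsto[OF bounded_bilinear_blinfun_compose])
qed

lemma adj_newton: "adj X = X \<Longrightarrow> adj (newton X n) = newton X n"
  for X :: "'a::{real_inner,banach} \<Rightarrow>\<^sub>L 'a"
  by (induction n) (simp_all add: adj_scaleR adj_add adj_compose linear_0 bounded_linear.linear[OF bounded_linear_adj])

lemma adj_newton_lim: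
  fixes X :: "'a::{real_inner,banach} \<Rightarrow>\<^sub>L 'a"
  assumes "norm X \<le> 1" "adj X = X"
  shows "adj (newton_lim X) = newton_lim X"
proof (rule LIMSEQ_unique)
  show "newton X \<longlonglongrightarrow> newton_lim X" by (rule newton_tendsto[OF assms(1)])
  have "(\<lambda>n. adj (newton X n)) \<longlonglongrightarrow> adj (newton_lim X)"
    by (rule tendsto_adj) (rule newton_tendsto[OF assms(1)])
  then show "newton X \<longlonglongrightarrow> adj (newton_lim X)" using assms(2) by (simp add: adj_newton)
qed

lemma newton_commute:
  fixes U X :: "'a::real_normed_vector \<Rightarrow>\<^sub>L 'a"
  assumes "\<And>v. U (X v) = X (U v)"
  shows "blinfun_apply U (newton X n v) = newton X n (U v)"
proof (induction n arbitrary: v)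
  case (Suc n)
  then show ?case
    by (simp add: blinfun.add_left blinfun.add_right blinfun.scaleR_left blinfun.scaleR_right assms)
qed simp

lemma newton_lim_commute:
  fixes X U :: "'a::{real_inner,banach} \<Rightarrow>\<^sub>L 'a"
  assumes "norm X \<le> 1" "\<And>v. U (X v) = X (U v)"
  shows "blinfun_apply U (newton_lim X v) = newton_lim X (U v)"
proof (rule LIMSEQ_unique)
  have *: "(\<lambda>n. newton X n w) \<longlonglongrightarrow> newton_lim X w" for w
    by (intro blinfun.tendsto newton_tendsto[OF assms(1)] tendsto_const)
  show "(\<lambda>n. U (newton X n v)) \<longlonglongrightarrow> U (newton_lim X v)"
    by (intro blinfun.tendsto tendsto_const *)
  show "(\<lambda>n. U (newton X n v)) \<longlonglongrightarrow> newton_lim X (U v)"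
    using * by (simp add: newton_commute[OF assms(2)])
qed

text \<open>The error after \<open>n\<close> steps is bounded independently of \<open>X\<close> on
  the closed unit ball, so continuity passes from the polynomial iterates to the limit.\<close>

lemma tendsto_newton_lim:
  fixes X :: "'b \<Rightarrow> 'a::{real_inner,banach} \<Rightarrow>\<^sub>L 'a"
  assumes lim: "(X \<longlongrightarrow> X0) F" and "eventually (\<lambda>x. norm (X x) \<le> 1) F" "norm X0 \<le> 1"
  shows "((\<lambda>x. newton_lim (X x)) \<longlongrightarrow> newton_lim X0) F"
proof (rule tendstoI)
  fix e :: real assume e: "e > 0"
  have "newton_bound \<longlonglongrightarrow> lim newton_bound"
    using convergent_newton_bound convergent_LIMSEQ_iff by blast
  then obtain n where "norm (newton_bound n - lim newton_bound) < e / 3"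
    using LIMSEQ_D[of newton_bound _ "e/3"] e by auto
  then have n: "lim newton_bound - newton_bound n < e / 3" unfolding real_norm_def by linarith
  have "((\<lambda>x. newton (X x) n) \<longlongrightarrow> newton X0 n) F"
    by (induction n) (simp_all add: tendsto_add tendsto_scaleR lim
        bounded_bilinear.tendsto[OF bounded_bilinear_blinfun_compose])
  then have "eventually (\<lambda>x. dist (newton (X x) n) (newton X0 n) < e / 3) F"
    using e by (intro tendstoD) simp_all
  with assms(2) show "eventually (\<lambda>x. dist (newton_lim (X x)) (newton_lim X0) < e) F"
  proof eventually_elim
    case (elim x)
    have "dist (newton_lim (X x)) (newton (X x) n) < e / 3"
      using norm_newton_lim_diff_le[OF elim(1), of n] n by (simp add: dist_norm)
    moreover have "dist (newton X0 n) (newton_lim X0) < e / 3"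
      using norm_newton_lim_diff_le[OF assms(3), of n] n by (simp add: dist_norm norm_minus_commute)
    ultimately show ?case
      using elim(2) dist_triangle[of "newton_lim (X x)" "newton_lim X0" "newton (X x) n"]
        dist_triangle[of "newton (X x) n" "newton_lim X0" "newton X0 n"] by linarith
  qed
qed

text \<open>Positivity is tested at \<open>v - T v\<close>. Combined with the upper bound at
  \<open>T v\<close> it gives \<open>inner (T v) (T v) \<le> inner (T v) v\<close>.\<close>

lemma norm_le_1_of_between:
  fixes T :: "'a::{real_inner,complete_space} \<Rightarrow>\<^sub>L 'a"
  assumes sym: "adj T = T" and T: "\<And>v. 0 \<le> inner (T v) v" "\<And>v. inner (T v) v \<le> inner v v"
  shows "norm T \<le> 1"
proof (rule norm_blinfun_bound)
  fix v
  let ?w = "T v"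
  have "0 \<le> inner (T (v - ?w)) (v - ?w)" by (rule T)
  also have "\<dots> = inner ?w v - 2 * inner ?w ?w + inner (T ?w) ?w"
    using inner_symmetric[OF sym, of ?w v]
    by (simp add: blinfun.diff_right inner_diff_left inner_diff_right algebra_simps)
  also have "\<dots> \<le> inner ?w v - inner ?w ?w" using T(2)[of ?w] by simp
  finally have "inner ?w ?w \<le> norm ?w * norm v" using norm_cauchy_schwarz[of ?w v] by linarith
  then have "norm ?w * norm ?w \<le> norm v * norm ?w"
    by (simp add: power2_norm_eq_inner[symmetric] power2_eq_square mult.commute)
  then show "norm ?w \<le> 1 * norm v" using le_of_mult_self_le[of "norm ?w" "norm v"] by simp
qed simp

text \<open>Meant for symmetric \<open>S\<close> of norm at most 1: then \<open>1 - S^2\<close> lies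
  in the unit ball and the limit is 1 minus the positive square root of \<open>S^2\<close>.\<close>

definition abs_blinfun :: "('a::{real_inner,banach} \<Rightarrow>\<^sub>L 'a) \<Rightarrow> 'a \<Rightarrow>\<^sub>L 'a" where
  "abs_blinfun S = id_blinfun - newton_lim (id_blinfun - (S o\<^sub>L S))"

context
  fixes S :: "'a::{real_inner,banach} \<Rightarrow>\<^sub>L 'a"
  assumes S: "adj S = S" "norm S \<le> 1"
begin

lemma adj_one_minus_square: "adj (id_blinfun - (S o\<^sub>L S)) = id_blinfun - (S o\<^sub>L S)"
  using S(1) by (simp add: adj_diff adj_compose)

lemma norm_one_minus_square: "norm (id_blinfun - (S o\<^sub>L S)) \<le> 1"
proof (rule norm_le_1_of_between[OF adj_one_minus_square])
  have eq: "inner ((id_blinfun - (S o\<^sub>L S)) v) v = inner v v - inner (S v) (S v)" for v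
    using inner_symmetric[OF S(1), of "S v" v] by (simp add: blinfun.diff_left inner_diff_left)
  have "norm (S v) \<le> 1 * norm v" for v
    by (rule order_trans[OF norm_blinfun], rule mult_right_mono) (use S in auto)
  then have "inner (S v) (S v) \<le> inner v v" for v by (simp add: norm_le)
  then show "0 \<le> inner ((id_blinfun - (S o\<^sub>L S)) v) v" "inner ((id_blinfun - (S o\<^sub>L S)) v) v \<le> inner v v" for v
    by (simp_all add: eq)
qed

lemma adj_abs_blinfun: "adj (abs_blinfun S) = abs_blinfun S"
  by (simp add: abs_blinfun_def adj_diff adj_newton_lim[OF norm_one_minus_square adj_one_minus_square])

lemma abs_blinfun_nonneg: "0 \<le> inner (abs_blinfun S v) v"
proof -
  let ?Y = "newton_lim (id_blinfun - (S o\<^sub>L S))"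
  have "inner (?Y v) v \<le> norm (?Y v) * norm v" by (rule norm_cauchy_schwarz)
  also have "\<dots> \<le> (norm ?Y * norm v) * norm v" by (intro mult_right_mono norm_blinfun) simp
  also have "\<dots> \<le> (1 * norm v) * norm v"
    by (intro mult_right_mono norm_newton_lim_le norm_one_minus_square) simp_all
  finally show ?thesis
    by (simp add: abs_blinfun_def blinfun.diff_left inner_diff_left power2_norm_eq_inner[symmetric] power2_eq_square)
qed

lemma abs_blinfun_square: "abs_blinfun S (abs_blinfun S v) = S (S v)"
proof -
  let ?Y = "newton_lim (id_blinfun - (S o\<^sub>L S))"
  have "2 *\<^sub>R ?Y v = v - S (S v) + ?Y (?Y v)"
    using arg_cong[OF newton_lim_fixed[OF norm_one_minus_square], of "\<lambda>T. 2 *\<^sub>R T v"]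
    by (simp add: blinfun.add_left blinfun.diff_left blinfun.scaleR_left)
  then have "?Y (?Y v) = 2 *\<^sub>R ?Y v - v + S (S v)" by (simp add: algebra_simps)
  then show ?thesis
    by (simp add: abs_blinfun_def blinfun.diff_left blinfun.diff_right scaleR_2)
qed

lemma abs_blinfun_commute:
  fixes U :: "'a \<Rightarrow>\<^sub>L 'a"
  assumes "\<And>v. U (S v) = S (U v)"
  shows "blinfun_apply U (abs_blinfun S v) = abs_blinfun S (U v)"
  by (simp add: abs_blinfun_def blinfun.diff_left blinfun.diff_right
      newton_lim_commute[OF norm_one_minus_square] assms)

text \<open>\<open>|S|^2 = S^2\<close> and commutation put the range of \<open>|S| + S\<close> into
  the kernel of \<open>|S| - S\<close>. A vector orthogonal to that kernel is therefore killed by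
  the symmetric operator \<open>|S| + S\<close>. This splits the space into a part with
  \<open>S \<ge> 0\<close> and a part with \<open>S \<le> 0\<close> without a spectral
  measure.\<close>

lemma abs_blinfun_orthogonal:
  assumes "\<And>s. abs_blinfun S s = S s \<Longrightarrow> inner v s = 0"
  shows "abs_blinfun S v = - S v"
proof -
  have "inner z (abs_blinfun S v + S v) = inner z 0" for z
  proof -
    have "abs_blinfun S (abs_blinfun S z + S z) = S (abs_blinfun S z + S z)"
      using abs_blinfun_commute[of S z]
      by (simp add: blinfun.add_right abs_blinfun_square add.commute)
    then have "inner v (abs_blinfun S z + S z) = 0" by (rule assms)
    then show ?thesis
      using inner_symmetric[OF adj_abs_blinfun, of z v] inner_symmetric[OF S(1), of z v]
      by (simp add: inner_add_right inner_commute)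
  qed
  then have "abs_blinfun S v + S v = 0" by (rule inner_eqI)
  then show ?thesis by (simp add: eq_neg_iff_add_eq_0)
qed

end

lemma tendsto_abs_blinfun:
  fixes S :: "'b \<Rightarrow> 'a::{real_inner,banach} \<Rightarrow>\<^sub>L 'a"
  assumes "(S \<longlongrightarrow> S0) F" "eventually (\<lambda>x. adj (S x) = S x \<and> norm (S x) \<le> 1) F" "adj S0 = S0" "norm S0 \<le> 1"
  shows "((\<lambda>x. abs_blinfun (S x)) \<longlongrightarrow> abs_blinfun S0) F"
  unfolding abs_blinfun_def
proof (intro tendsto_diff tendsto_const tendsto_newton_lim)
  show "((\<lambda>x. S x o\<^sub>L S x) \<longlongrightarrow> S0 o\<^sub>L S0) F"
    by (intro bounded_bilinear.tendsto[OF bounded_bilinear_blinfun_compose] assms(1))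
  show "eventually (\<lambda>x. norm (id_blinfun - (S x o\<^sub>L S x)) \<le> 1) F"
    using assms(2) by eventually_elim (simp add: norm_one_minus_square)
  show "norm (id_blinfun - (S0 o\<^sub>L S0)) \<le> 1" using assms(3,4) by (rule norm_one_minus_square)
qed

section \<open>Complex Hilbert spaces\<close>

instance complex_hilbert \<subseteq> banach ..

lemma scaleC_i_i [simp]: "\<i> *\<^sub>C \<i> *\<^sub>C v = - (v :: 'a::complex_hilbert)"
  using scaleC_of_real[of "-1" v] by (simp add: scaleC_scaleC)

lemma scaleC_eq_Re_Im: "c *\<^sub>C v = Re c *\<^sub>R v + Im c *\<^sub>R \<i> *\<^sub>C (v :: 'a::complex_hilbert)"
proof -
  have "c = complex_of_real (Re c) + complex_of_real (Im c) * \<i>" by (simp add: complex_eq mult.commute)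
  then have "c *\<^sub>C v = (complex_of_real (Re c) + complex_of_real (Im c) * \<i>) *\<^sub>C v" by simp
  then show ?thesis by (simp only: scaleC_add_left scaleC_scaleC[symmetric] scaleC_of_real)
qed

lemma scaleC_diff_right: "c *\<^sub>C (x - y) = c *\<^sub>C x - c *\<^sub>C (y :: 'a::complex_hilbert)"
  by (rule complex_vector.scale_right_diff_distrib)

lemma scaleC_minus_right [simp]: "c *\<^sub>C (- x) = - (c *\<^sub>C (x :: 'a::complex_hilbert))"
  by (rule complex_vector.scale_minus_right)

lemma scaleC_scaleR: "c *\<^sub>C r *\<^sub>R x = r *\<^sub>R c *\<^sub>C (x :: 'a::complex_hilbert)"
  by (simp add: scaleC_of_real[symmetric] scaleC_scaleC mult.commute)

lemma cinner_scaleC_right: "cinner x (c *\<^sub>C y) = cnj c * cinner x (y :: 'a::complex_hilbert)"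
  by (metis cinner_commute cinner_scaleC_left complex_cnj_mult)

lemma cinner_add_right: "cinner x (y + z) = cinner x y + cinner x (z :: 'a::complex_hilbert)"
  by (metis cinner_commute cinner_add_left complex_cnj_add)

lemma cinner_diff_left: "cinner (x - y) z = cinner x z - cinner y (z :: 'a::complex_hilbert)"
  using cinner_add_left[of "x - y" y z] by simp

lemma cinner_diff_right: "cinner x (y - z) = cinner x y - cinner x (z :: 'a::complex_hilbert)"
  using cinner_add_right[of x "y - z" z] by simp

lemma cinner_eq: "cinner x y = Complex (inner x y) (inner x (\<i> *\<^sub>C y))"
  for x y :: "'a::complex_hilbert"
  by (simp add: complex_eq_iff Re_cinner[symmetric] cinner_scaleC_right)

lemma cinner_eq_0_iff: "cinner x y = 0 \<longleftrightarrow> inner x y = 0 \<and> inner x (\<i> *\<^sub>C y) = 0"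
  for x y :: "'a::complex_hilbert"
  by (simp add: cinner_eq complex_eq_iff)

lemma cinner_zero_left [simp]: "cinner 0 (y :: 'a::complex_hilbert) = 0"
  by (simp add: cinner_eq_0_iff)

lemma cinner_zero_right [simp]: "cinner (y :: 'a::complex_hilbert) 0 = 0"
  by (simp add: cinner_eq_0_iff)

lemma inner_i_i [simp]: "inner (\<i> *\<^sub>C x) (\<i> *\<^sub>C y) = inner x (y :: 'a::complex_hilbert)"
  by (simp add: Re_cinner[symmetric] cinner_scaleC_left cinner_scaleC_right)

lemma inner_i_left: "inner (\<i> *\<^sub>C x) y = - inner x (\<i> *\<^sub>C (y :: 'a::complex_hilbert))"
  by (simp add: Re_cinner[symmetric] cinner_scaleC_left cinner_scaleC_right)

lemma inner_i_self [simp]: "inner x (\<i> *\<^sub>C (x :: 'a::complex_hilbert)) = 0"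
  using inner_i_left[of x x] by (simp add: inner_commute)

lemma norm_scaleC [simp]: "norm (c *\<^sub>C x) = cmod c * norm (x :: 'a::complex_hilbert)"
proof -
  have "inner (c *\<^sub>C x) (c *\<^sub>C x) = ((Re c)\<^sup>2 + (Im c)\<^sup>2) * inner x x"
    by (simp add: scaleC_eq_Re_Im[of c] inner_add_left inner_add_right inner_i_left
        algebra_simps power2_eq_square)
  then have "inner (c *\<^sub>C x) (c *\<^sub>C x) = (cmod c)\<^sup>2 * inner x x" by (simp add: cmod_power2)
  then show ?thesis by (simp add: norm_eq_sqrt_inner real_sqrt_mult)
qed

section \<open>Complex linear bounded operators\<close>

lift_definition imul :: "'a::complex_hilbert \<Rightarrow>\<^sub>L 'a" is "\<lambda>v. \<i> *\<^sub>C v"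
  by (rule bounded_linear_intro[where K=1]) (simp_all add: scaleC_add_right scaleC_scaleR)

declare imul.rep_eq [simp]

lemma clinear_blinfun_iff: "clinear_blinfun T \<longleftrightarrow> (\<forall>v. T (\<i> *\<^sub>C v) = \<i> *\<^sub>C T v)"
proof
  assume *: "\<forall>v. T (\<i> *\<^sub>C v) = \<i> *\<^sub>C T v"
  have "T (c *\<^sub>C v) = c *\<^sub>C T v" for c v
    unfolding scaleC_eq_Re_Im[of c] by (simp add: blinfun.add_right blinfun.scaleR_right *)
  then show "clinear_blinfun T" by (simp add: clinear_blinfun_def)
qed (simp add: clinear_blinfun_def)

lemma clinear_blinfunD: "clinear_blinfun T \<Longrightarrow> T (c *\<^sub>C v) = c *\<^sub>C T v"
  by (simp add: clinear_blinfun_def)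

lemma clinear_blinfun_id [simp]: "clinear_blinfun id_blinfun"
  by (simp add: clinear_blinfun_def)

lemma clinear_blinfun_imul [simp]: "clinear_blinfun imul"
  by (simp add: clinear_blinfun_iff)

lemma clinear_blinfun_add: "clinear_blinfun S \<Longrightarrow> clinear_blinfun T \<Longrightarrow> clinear_blinfun (S + T)"
  by (simp add: clinear_blinfun_iff blinfun.add_left scaleC_add_right)

lemma clinear_blinfun_diff: "clinear_blinfun S \<Longrightarrow> clinear_blinfun T \<Longrightarrow> clinear_blinfun (S - T)"
  by (simp add: clinear_blinfun_iff blinfun.diff_left scaleC_diff_right)

lemma clinear_blinfun_scaleR: "clinear_blinfun T \<Longrightarrow> clinear_blinfun (r *\<^sub>R T)"
  by (simp add: clinear_blinfun_iff blinfun.scaleR_left scaleC_scaleR)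

lemma clinear_blinfun_compose: "clinear_blinfun S \<Longrightarrow> clinear_blinfun T \<Longrightarrow> clinear_blinfun (S o\<^sub>L T)"
  by (simp add: clinear_blinfun_iff)

lemma clinear_blinfun_adj:
  assumes "clinear_blinfun T"
  shows "clinear_blinfun (adj T)"
  unfolding clinear_blinfun_iff
proof
  fix v
  show "adj T (\<i> *\<^sub>C v) = \<i> *\<^sub>C adj T v"
  proof (rule inner_eqI)
    fix z
    have "inner z (\<i> *\<^sub>C adj T v) = - inner (\<i> *\<^sub>C z) (adj T v)" by (simp add: inner_i_left)
    also have "\<dots> = inner (T z) (\<i> *\<^sub>C v)"
      using assms by (simp only: inner_adj clinear_blinfun_iff) (simp add: inner_i_left)
    finally show "inner z (adj T (\<i> *\<^sub>C v)) = inner z (\<i> *\<^sub>C adj T v)" by (simp add: inner_adj)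
  qed
qed

lemma clinear_blinfun_inverse:
  assumes "invertible_blinfun T" "clinear_blinfun T"
  shows "clinear_blinfun (blinfun_inverse T)"
  unfolding clinear_blinfun_iff
proof
  fix v
  have "T (\<i> *\<^sub>C blinfun_inverse T v) = \<i> *\<^sub>C v"
    using assms by (simp add: clinear_blinfun_def blinfun_inverse_right)
  then show "blinfun_inverse T (\<i> *\<^sub>C v) = \<i> *\<^sub>C blinfun_inverse T v"
    using blinfun_inverse_left[OF assms(1), of "\<i> *\<^sub>C blinfun_inverse T v"] by simp
qed

text \<open>Complex linearity is commutation with \<open>imul\<close>, and \<open>|S|\<close>
  commutes with every bounded operator that commutes with \<open>S\<close>.\<close>

lemma clinear_abs_blinfun:
  assumes "adj S = S" "norm S \<le> 1" "clinear_blinfun S"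
  shows "clinear_blinfun (abs_blinfun S)"
  using abs_blinfun_commute[OF assms(1,2), of imul] assms(3) by (simp add: clinear_blinfun_iff)

section \<open>Complex subspaces as real subspaces\<close>

lemma csubspace_imp_subspace: "csubspace S \<Longrightarrow> subspace S"
  unfolding subspace_def complex_vector.subspace_def by (metis scaleC_of_real)

lemma csubspaceI_i:
  assumes "subspace S" "\<And>x. x \<in> S \<Longrightarrow> \<i> *\<^sub>C x \<in> S"
  shows "csubspace S"
proof -
  have "c *\<^sub>C x \<in> S" if "x \<in> S" for c x
    unfolding scaleC_eq_Re_Im[of c] using assms that by (simp add: subspace_def)
  then show ?thesis
    using assms(1) by (simp add: complex_vector.subspace_def subspace_def)
qed

lemma span_subset_cspan: "span S \<subseteq> cspan S"
  by (rule span_minimal[OF complex_vector.span_superset csubspace_imp_subspace[OF complex_vector.subspace_span]])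

lemma csubspace_cinner_kernel: "csubspace {x. cinner v x = 0}"
  by (simp add: complex_vector.subspace_def cinner_add_right cinner_scaleC_right)

lemma csubspace_range: "clinear_blinfun T \<Longrightarrow> csubspace (range T)"
  unfolding complex_vector.subspace_def
proof (intro conjI ballI allI)
  assume T: "clinear_blinfun T"
  show "0 \<in> range T" using blinfun.zero_right[of T] by (metis rangeI)
  show "x + y \<in> range T" if "x \<in> range T" "y \<in> range T" for x y
    using that by (auto simp: blinfun.add_right[symmetric])
  show "c *\<^sub>C x \<in> range T" if "x \<in> range T" for c x
    using that T by (auto simp: clinear_blinfunD[symmetric])
qed


subsection \<open>Orthogonal projections\<close>

context
  fixes S :: "'a::complex_hilbert set"
  assumes S: "csubspace S" "closed S"
begin

text \<open>The description in \<open>orth_proj\<close> asks for complex orthogonality. On a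
  subspace invariant under \<open>i\<close> this agrees with real orthogonality, so the real
  projection theorem shows that the description denotes.\<close>

lemma orth_proj_char:
  "orth_proj S v \<in> S \<and> (\<forall>s\<in>S. inner (v - orth_proj S v) s = 0)"
proof -
  have iS: "\<i> *\<^sub>C s \<in> S" if "s \<in> S" for s using S(1) that by (simp add: complex_vector.subspace_def)
  have rS: "subspace S" by (rule csubspace_imp_subspace[OF S(1)])
  have uniq: "w = w'"
    if "w \<in> S" "\<forall>s\<in>S. inner (v - w) s = 0" "w' \<in> S" "\<forall>s\<in>S. inner (v - w') s = 0" for v w w'
  proof -
    have "w - w' \<in> S" using that rS by (simp add: subspace_diff)
    then have "inner (v - w') (w - w') - inner (v - w) (w - w') = 0" using that by simp
    then have "inner (w - w') (w - w') = 0" by (simp add: inner_diff_left)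
    then show ?thesis by simp
  qed
  define f where "f v = (THE w. w \<in> S \<and> (\<forall>s\<in>S. cinner (v - w) s = 0))" for v
  have iff: "(\<forall>s\<in>S. cinner (v - w) s = 0) \<longleftrightarrow> (\<forall>s\<in>S. inner (v - w) s = 0)" for v w
    using iS by (auto simp: cinner_eq_0_iff)
  have f: "f v \<in> S \<and> (\<forall>s\<in>S. inner (v - f v) s = 0)" for v
  proof -
    obtain w where "w \<in> S" "\<And>s. s \<in> S \<Longrightarrow> inner (v - w) s = 0"
      using exists_orthogonal_projection[OF rS S(2), of v] by blast
    then have "\<exists>!w. w \<in> S \<and> (\<forall>s\<in>S. inner (v - w) s = 0)" using uniq by (intro ex_ex1I) blast+
    then show ?thesis unfolding f_def iff by (rule theI')
  qed
  have "bounded_linear f"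
  proof (rule bounded_linear_intro[where K=1])
    fix v w r
    have 1: "f v + f w \<in> S" using f rS by (simp add: subspace_add)
    have 2: "inner (v + w - (f v + f w)) s = 0" if "s \<in> S" for s
    proof -
      have "v + w - (f v + f w) = (v - f v) + (w - f w)" by simp
      then show ?thesis using f that by (simp only: inner_add_left)
    qed
    show "f (v + w) = f v + f w"
      by (rule uniq[where v="v + w"]) (use f 1 2 in auto)
    have 3: "r *\<^sub>R f v \<in> S" using f rS by (simp add: subspace_scale)
    have 4: "inner (r *\<^sub>R v - r *\<^sub>R f v) s = 0" if "s \<in> S" for s
      using f[of v] that by (simp add: real_vector.scale_right_diff_distrib[symmetric])
    show "f (r *\<^sub>R v) = r *\<^sub>R f v"
      by (rule uniq[where v="r *\<^sub>R v"]) (use f 3 4 in auto)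
    have "inner (v - f v) (f v) = 0" using f by blast
    then have "norm (f v) * norm (f v) = inner v (f v)"
      by (simp add: inner_diff_left power2_norm_eq_inner[symmetric] power2_eq_square)
    also have "\<dots> \<le> norm v * norm (f v)" by (rule norm_cauchy_schwarz)
    finally show "norm (f v) \<le> norm v * 1" by (simp add: le_of_mult_self_le[of "norm (f v)"])
  qed
  then have "blinfun_apply (orth_proj S) = f"
    unfolding orth_proj_def f_def by (rule bounded_linear_Blinfun_apply)
  then show ?thesis using f by simp
qed

lemma orth_proj_mem: "orth_proj S v \<in> S"
  using orth_proj_char by blast

lemma orth_proj_orthogonal: "s \<in> S \<Longrightarrow> inner (v - orth_proj S v) s = 0"
  using orth_proj_char by blast

lemma orth_proj_unique:
  assumes "w \<in> S" "\<And>s. s \<in> S \<Longrightarrow> inner (v - w) s = 0"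
  shows "orth_proj S v = w"
proof -
  have "orth_proj S v - w \<in> S"
    using assms(1) orth_proj_mem csubspace_imp_subspace[OF S(1)] by (simp add: subspace_diff)
  then have "inner (v - w) (orth_proj S v - w) - inner (v - orth_proj S v) (orth_proj S v - w) = 0"
    using assms(2) orth_proj_orthogonal by simp
  then have "inner (orth_proj S v - w) (orth_proj S v - w) = 0" by (simp add: inner_diff_left)
  then show ?thesis by simp
qed

lemma orth_proj_of_mem: "v \<in> S \<Longrightarrow> orth_proj S v = v"
  by (rule orth_proj_unique) simp_all

lemma orth_proj_of_orthogonal: "(\<And>s. s \<in> S \<Longrightarrow> inner v s = 0) \<Longrightarrow> orth_proj S v = 0"
  by (rule orth_proj_unique) (use csubspace_imp_subspace[OF S(1)] in \<open>simp_all add: subspace_0\<close>)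

lemma orth_proj_idem: "orth_proj S (orth_proj S v) = orth_proj S v"
  by (rule orth_proj_of_mem[OF orth_proj_mem])

lemma adj_orth_proj: "adj (orth_proj S) = orth_proj S"
proof (rule adjI)
  fix x y
  have "inner (orth_proj S x) y = inner (orth_proj S x) (orth_proj S y)"
    using orth_proj_orthogonal[OF orth_proj_mem, of y x]
    by (simp add: inner_diff_right inner_commute[of _ "orth_proj S x"])
  also have "\<dots> = inner x (orth_proj S y)"
    using orth_proj_orthogonal[OF orth_proj_mem, of x y] by (simp add: inner_diff_left)
  finally show "inner (orth_proj S x) y = inner x (orth_proj S y)" .
qed

lemma clinear_orth_proj: "clinear_blinfun (orth_proj S)"
  unfolding clinear_blinfun_iff
proof
  fix v
  have iS: "\<i> *\<^sub>C s \<in> S" if "s \<in> S" for s using S(1) that by (simp add: complex_vector.subspace_def)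
  show "orth_proj S (\<i> *\<^sub>C v) = \<i> *\<^sub>C orth_proj S v"
  proof (rule orth_proj_unique)
    show "inner (\<i> *\<^sub>C v - \<i> *\<^sub>C orth_proj S v) s = 0" if "s \<in> S" for s
      using orth_proj_orthogonal[OF iS[OF that]] by (simp add: scaleC_diff_right[symmetric] inner_i_left)
  qed (simp add: iS orth_proj_mem)
qed

lemma norm_orth_proj_Pythagoras:
  "(norm v)\<^sup>2 = (norm (orth_proj S v))\<^sup>2 + (norm (v - orth_proj S v))\<^sup>2"
  using orth_proj_orthogonal[OF orth_proj_mem, of v v]
  by (simp add: power2_norm_eq_inner inner_diff_left inner_diff_right inner_commute)

end


subsection \<open>Finite-dimensional subspaces\<close>

text \<open>Restricting to the kernel of one further functional \<open>inner _ b\<close> costs at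
  most one dimension, and a single \<open>v0\<close> outside that kernel restores it.\<close>

lemma finite_dim_of_orthogonal:
  fixes M :: "'a::real_inner set"
  assumes "finite B" "subspace M" "\<And>v. v \<in> M \<Longrightarrow> (\<And>b. b \<in> B \<Longrightarrow> inner v b = 0) \<Longrightarrow> v = 0"
  shows "\<exists>C. finite C \<and> M \<subseteq> span C"
  using assms
proof (induction B arbitrary: M rule: finite_induct)
  case empty
  then have "M \<subseteq> span {}" by auto
  then show ?case by blast
next
  case (insert b B)
  define M' where "M' = {v \<in> M. inner v b = 0}"
  have "subspace M'"
    using insert.prems(1) by (auto simp: M'_def subspace_def inner_add_left)
  then obtain C where C: "finite C" "M' \<subseteq> span C"
    using insert.IH[of M'] insert.prems(2) unfolding M'_def by blast
  show ?case
  proof (cases "M \<subseteq> M'")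
    case True
    then show ?thesis using C by blast
  next
    case False
    then obtain v0 where v0: "v0 \<in> M" "inner v0 b \<noteq> 0" by (auto simp: M'_def)
    have "v \<in> span (insert v0 C)" if "v \<in> M" for v
    proof -
      have "v - (inner v b / inner v0 b) *\<^sub>R v0 \<in> M'"
        using that v0 insert.prems(1) by (simp add: M'_def subspace_diff subspace_scale inner_diff_left)
      then show ?thesis using C(2) unfolding span_insert by blast
    qed
    then show ?thesis using C(1) by (intro exI[of _ "insert v0 C"]) auto
  qed
qed

lemma closed_span_Un_finite:
  fixes S :: "'a::{real_inner,complete_space} set"
  assumes "finite B" "subspace S" "closed S"
  shows "closed (span (S \<union> B))"
  using assms(1)
proof induction
  case empty
  then show ?case using assms by (simp add: span_eq_iff[THEN iffD2])
next
  case (insert b B)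
  let ?T = "span (S \<union> B)"
  obtain w where w: "w \<in> ?T" "\<And>s. s \<in> ?T \<Longrightarrow> inner (b - w) s = 0"
    using exists_orthogonal_projection[OF subspace_span insert.IH, of b] by blast
  \<comment> \<open>Replacing \<open>b\<close> by its component orthogonal to the closed span makes
    the coefficient of a vector a continuous function of it.\<close>
  define c where "c = b - w"
  have eq: "span (insert b (S \<union> B)) = {x. x - (inner x c / inner c c) *\<^sub>R c \<in> ?T}"
  proof (intro set_eqI iffI)
    fix x assume "x \<in> span (insert b (S \<union> B))"
    then obtain k where k: "x - k *\<^sub>R b \<in> ?T" unfolding span_insert by blast
    have "x - k *\<^sub>R c = (x - k *\<^sub>R b) + k *\<^sub>R w" by (simp add: c_def algebra_simps)
    then have kc: "x - k *\<^sub>R c \<in> ?T" by (simp only: span_add[OF k span_scale[OF w(1)]])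
    have "inner (x - k *\<^sub>R c) c = 0" using w(2)[OF kc] by (simp add: c_def inner_commute)
    then have "inner x c = k * inner c c" by (simp add: inner_diff_left)
    \<comment> \<open>If \<open>b\<close> already lies in the closed span then \<open>c = 0\<close>
      and both sides vanish, so the quotient by zero does no harm.\<close>
    then have "(inner x c / inner c c) *\<^sub>R c = k *\<^sub>R c" by (cases "c = 0") auto
    with kc show "x \<in> {x. x - (inner x c / inner c c) *\<^sub>R c \<in> ?T}" unfolding mem_Collect_eq by metis
  next
    fix x assume x: "x \<in> {x. x - (inner x c / inner c c) *\<^sub>R c \<in> ?T}"
    let ?k = "inner x c / inner c c"
    have "x - ?k *\<^sub>R b = (x - ?k *\<^sub>R c) - ?k *\<^sub>R w" by (simp add: c_def algebra_simps)
    then have "x - ?k *\<^sub>R b \<in> ?T" by (simp only: span_diff[OF x[unfolded mem_Collect_eq] span_scale[OF w(1)]])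
    then show "x \<in> span (insert b (S \<union> B))" unfolding span_insert by blast
  qed
  have "continuous_on UNIV (\<lambda>x. x - (inner x c / inner c c) *\<^sub>R c)"
    by (cases "c = 0") (auto intro!: continuous_intros)
  then have "closed {x. x - (inner x c / inner c c) *\<^sub>R c \<in> ?T}"
    using insert.IH continuous_closed_vimage[of ?T "\<lambda>x. x - (inner x c / inner c c) *\<^sub>R c"]
    by (simp add: vimage_def continuous_on_eq_continuous_at)
  then show ?case using eq by simp
qed

lemma closed_span_finite: "finite B \<Longrightarrow> closed (span (B :: 'a::{real_inner,complete_space} set))"
  using closed_span_Un_finite[of B "{0}"] by simp


subsection \<open>Unitaries in the Fredholm class\<close>

text \<open>The upper semi-Fredholm property with a constant: a lower bound off finitely many
  directions. The constant can be compared between operators and followed under perturbation. For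
  \<open>T = u + 1\<close> with \<open>u\<close> unitary the property for some \<open>e > 0\<close>
  is equivalent to being Fredholm.\<close>

definition essentially_bounded_below :: "real \<Rightarrow> ('a::real_inner \<Rightarrow>\<^sub>L 'b::real_normed_vector) \<Rightarrow> bool" where
  "essentially_bounded_below e T \<longleftrightarrow>
     (\<exists>B. finite B \<and> (\<forall>v. (\<forall>b\<in>B. inner v b = 0) \<longrightarrow> e * norm v \<le> norm (T v)))"

lemma unitary_onto_UNIV_iff:
  "unitary_onto UNIV u \<longleftrightarrow> clinear_blinfun u \<and> adj u o\<^sub>L u = id_blinfun \<and> u o\<^sub>L adj u = id_blinfun"
  for u :: "'a::complex_hilbert \<Rightarrow>\<^sub>L 'b::complex_hilbert"
proof -
  have "surj u \<longleftrightarrow> u o\<^sub>L adj u = id_blinfun" if *: "adj u o\<^sub>L u = id_blinfun"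
  proof
    assume "surj u"
    show "u o\<^sub>L adj u = id_blinfun"
    proof (rule blinfun_eqI)
      fix w
      obtain v where "w = u v" using \<open>surj u\<close> by blast
      then show "(u o\<^sub>L adj u) w = id_blinfun w"
        using * blinfun_apply_blinfun_compose[of "adj u" u v] by simp
    qed
  next
    assume "u o\<^sub>L adj u = id_blinfun"
    then have "u (adj u w) = w" for w using blinfun_apply_blinfun_compose[of u "adj u" w] by simp
    then show "surj u" by (metis surjI)
  qed
  then show ?thesis unfolding unitary_onto_def isometry_adj by blast
qed

context
  fixes u :: "'a::complex_hilbert \<Rightarrow>\<^sub>L 'b::complex_hilbert"
  assumes u: "unitary_onto UNIV u"
begin

lemma unitary_adj_left: "adj u (u v) = v"
  using u blinfun_apply_blinfun_compose[of "adj u" u v] by (simp add: unitary_onto_UNIV_iff)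

lemma unitary_adj_right: "u (adj u w) = w"
  using u blinfun_apply_blinfun_compose[of u "adj u" w] by (simp add: unitary_onto_UNIV_iff)

lemma unitary_norm: "norm (u v) = norm v"
  using u by (simp add: unitary_onto_def)

lemma unitary_clinear: "clinear_blinfun u"
  using u by (simp add: unitary_onto_def)

lemma unitary_inner: "inner (u v) (u w) = inner v w"
  by (rule isometry_inner) (rule unitary_norm)

lemma unitary_adj: "unitary_onto UNIV (adj u)"
  using u by (simp add: unitary_onto_UNIV_iff clinear_blinfun_adj)

end

text \<open>\<open>u\<close> times the adjoint of \<open>u + 1\<close> is \<open>u + 1\<close>
  again. This is how the cokernel is controlled by the kernel.\<close>

lemma unitary_kernel_adj:
  assumes "unitary_onto UNIV u" "adj (u + id_blinfun) k = 0"
  shows "(u + id_blinfun) k = (0 :: 'a::complex_hilbert)"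
proof -
  have "adj u k + k = 0" using assms(2) by (simp add: adj_add blinfun.add_left)
  then have "u (adj u k) + u k = 0" by (metis blinfun.add_right blinfun.zero_right)
  then show ?thesis by (simp add: unitary_adj_right[OF assms(1)] blinfun.add_left add.commute)
qed

text \<open>The range is the closed image of the complement of \<open>B\<close> plus a
  finite-dimensional space, hence closed. Its orthogonal complement is killed by the adjoint, so it
  lies in the kernel of \<open>u + 1\<close>, which meets the complement of \<open>B\<close>
  trivially.\<close>

lemma Fredholm_blinfun_of_essentially_bounded_below:
  fixes u :: "'a::complex_hilbert \<Rightarrow>\<^sub>L 'a"
  assumes u: "unitary_onto UNIV u" and e: "0 < e" "essentially_bounded_below e (u + id_blinfun)"
  shows "Fredholm_blinfun (u + id_blinfun)"
proof -
  let ?T = "u + id_blinfun"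
  have lin: "linear ?T" by (rule bounded_linear.linear[OF blinfun.bounded_linear_right])
  obtain B where B: "finite B" "\<And>v. (\<And>b. b \<in> B \<Longrightarrow> inner v b = 0) \<Longrightarrow> e * norm v \<le> norm (?T v)"
    using e(2) unfolding essentially_bounded_below_def by blast
  have "subspace {v. ?T v = 0}" by (simp add: subspace_def blinfun.add_right blinfun.scaleR_right)
  moreover have "v = 0" if "?T v = 0" "\<And>b. b \<in> B \<Longrightarrow> inner v b = 0" for v
    using B(2)[OF that(2)] that(1) e(1) by (simp add: mult_le_0_iff)
  ultimately obtain C where C: "finite C" "{v. ?T v = 0} \<subseteq> span C"
    using finite_dim_of_orthogonal[OF B(1), of "{v. ?T v = 0}"] by blast
  then have kerC: "{v. ?T v = 0} \<subseteq> cspan C" using span_subset_cspan by blast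
  define M where "M = {v. \<forall>b\<in>B. inner v b = 0}"
  have M: "subspace M" by (simp add: M_def subspace_def inner_add_left)
  have "M = (\<Inter>b\<in>B. {v. inner v b = 0})" by (auto simp: M_def)
  then have "closed M" by (auto intro!: closed_Collect_eq continuous_intros)
  then have "closed (?T ` M)"
    by (rule closed_range_bounded_below[OF e(1) M]) (use B(2) in \<open>auto simp: M_def\<close>)
  then have "closed (span (?T ` M \<union> ?T ` B))"
    by (intro closed_span_Un_finite) (use B(1) in \<open>auto intro!: linear_subspace_image lin M\<close>)
  moreover have "span (?T ` M \<union> ?T ` B) = range ?T"
  proof
    show "span (?T ` M \<union> ?T ` B) \<subseteq> range ?T"
      by (rule span_minimal) (auto intro!: linear_subspace_image lin)
    show "range ?T \<subseteq> span (?T ` M \<union> ?T ` B)"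
    proof
      fix y assume "y \<in> range ?T"
      then obtain v where y: "y = ?T v" by blast
      obtain w where w: "w \<in> span B" "\<And>s. s \<in> span B \<Longrightarrow> inner (v - w) s = 0"
        using exists_orthogonal_projection[OF subspace_span closed_span_finite[OF B(1)], of v] by blast
      then have "v - w \<in> M" by (auto simp: M_def span_base)
      then have "?T (v - w) \<in> span (?T ` M \<union> ?T ` B)" by (intro span_base) blast
      moreover have "?T w \<in> span (?T ` M \<union> ?T ` B)"
      proof -
        have "?T w \<in> span (?T ` B)" using w(1) linear_span_image[OF lin, of B] by blast
        then show ?thesis using span_mono[of "?T ` B" "?T ` M \<union> ?T ` B"] by blast
      qed
      ultimately show "y \<in> span (?T ` M \<union> ?T ` B)"
        using span_add[of "?T (v - w)" "?T ` M \<union> ?T ` B" "?T w"] by (simp add: y blinfun.diff_right)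
    qed
  qed
  ultimately have closed: "closed (range ?T)" by simp
  have "cspan (range ?T \<union> C) = UNIV"
  proof -
    have "v \<in> cspan (range ?T \<union> C)" for v
    proof -
      obtain w where w: "w \<in> range ?T" "\<And>s. s \<in> range ?T \<Longrightarrow> inner (v - w) s = 0"
        using exists_orthogonal_projection[OF linear_subspace_image[OF lin subspace_UNIV] closed, of v] by blast
      have "inner z (adj ?T (v - w)) = inner z 0" for z
        using w(2)[of "?T z"] by (simp add: inner_adj inner_commute del: blinfun.add_left)
      then have "adj ?T (v - w) = 0" by (rule inner_eqI)
      then have "?T (v - w) = 0" by (rule unitary_kernel_adj[OF u])
      then have "v - w \<in> cspan C" using kerC by blast
      then have "v - w \<in> cspan (range ?T \<union> C)" using complex_vector.span_mono[of C "range ?T \<union> C"] by blast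
      moreover have "w \<in> cspan (range ?T \<union> C)" using w(1) by (intro complex_vector.span_base) blast
      ultimately show ?thesis using complex_vector.span_add by fastforce
    qed
    then show ?thesis by auto
  qed
  then show ?thesis
    unfolding Fredholm_blinfun_def finite_cdim_def finite_ccodim_in_def
    using closed kerC C(1) by blast
qed

text \<open>Let \<open>T = u + 1\<close>. Every \<open>y\<close> is the sum of some
  \<open>adj T z\<close> and a vector of the kernel, so \<open>inner y\<close> is bounded on the
  vectors \<open>v\<close> orthogonal to the kernel with \<open>norm (T v) \<le> 1\<close>. Uniform
  boundedness then bounds these \<open>v\<close> in norm, which is a lower bound for
  \<open>T\<close>.\<close>

lemma essentially_bounded_below_of_Fredholm_blinfun:
  fixes u :: "'a::complex_hilbert \<Rightarrow>\<^sub>L 'a"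
  assumes u: "unitary_onto UNIV u" and F: "Fredholm_blinfun (u + id_blinfun)"
  shows "\<exists>e>0. essentially_bounded_below e (u + id_blinfun)"
proof -
  let ?T = "u + id_blinfun"
  obtain C where C: "finite C" "{v. ?T v = 0} \<subseteq> cspan C"
    using F unfolding Fredholm_blinfun_def finite_cdim_def by blast
  have closed: "closed (range (adj ?T))"
  proof -
    \<comment> \<open>Closedness passes from the range of \<open>?T\<close> to that of its adjoint
      because \<open>u\<close> composed with the adjoint is \<open>?T\<close>.\<close>
    have "range (adj ?T) = u -` range ?T"
    proof (intro set_eqI iffI)
      fix x assume "x \<in> range (adj ?T)"
      then obtain z where "x = adj u z + z" by (auto simp: adj_add blinfun.add_left)
      then have "u x = ?T z" by (simp add: blinfun.add_right blinfun.add_left unitary_adj_right[OF u] add.commute)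
      then show "x \<in> u -` range ?T" by simp
    next
      fix x assume "x \<in> u -` range ?T"
      then obtain z where "u x = u z + z" by (auto simp: blinfun.add_left)
      then have "adj u (u x) = adj u (u z) + adj u z" by (simp add: blinfun.add_right)
      then have "x = adj ?T z" by (simp add: unitary_adj_left[OF u] adj_add blinfun.add_left add.commute)
      then show "x \<in> range (adj ?T)" by blast
    qed
    moreover have "closed (u -` range ?T)"
      using F unfolding Fredholm_blinfun_def by (intro continuous_closed_vimage) (auto intro!: continuous_intros)
    ultimately show ?thesis by simp
  qed
  define S where "S = {v. (\<forall>k. ?T k = 0 \<longrightarrow> inner k v = 0) \<and> norm (?T v) \<le> 1}"
  have "bounded S"
  proof (rule weakly_bounded_imp_bounded)
    fix y
    obtain w where w: "w \<in> range (adj ?T)" "\<And>s. s \<in> range (adj ?T) \<Longrightarrow> inner (y - w) s = 0"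
      using exists_orthogonal_projection[OF linear_subspace_image[OF bounded_linear.linear[OF
              blinfun.bounded_linear_right] subspace_UNIV] closed, of y] by blast
    obtain z where z: "w = adj ?T z" using w(1) by blast
    have "inner x (?T (y - w)) = inner x 0" for x
      using w(2)[of "adj ?T x"] by (simp add: inner_adj del: blinfun.add_left)
        (simp add: inner_commute)
    then have k: "?T (y - w) = 0" by (rule inner_eqI)
    have "\<bar>inner y v\<bar> \<le> norm z" if v: "v \<in> S" for v
    proof -
      have "inner (y - w) v = 0" using v k unfolding S_def by blast
      then have "inner y v = inner z (?T v)" by (simp add: inner_diff_left z inner_adj_left)
      also have "\<bar>\<dots>\<bar> \<le> norm z * norm (?T v)" by (rule Cauchy_Schwarz_ineq2)
      also have "\<dots> \<le> norm z * 1" using v by (intro mult_left_mono) (auto simp: S_def)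
      finally show ?thesis by simp
    qed
    then show "\<exists>C. \<forall>v\<in>S. \<bar>inner y v\<bar> \<le> C" by blast
  qed
  then obtain D where D: "D > 0" "\<And>v. v \<in> S \<Longrightarrow> norm v \<le> D" unfolding bounded_pos by blast
  \<comment> \<open>The orthogonality to \<open>?B\<close> is real. Adding the multiples by
    \<open>i\<close> makes it complex, hence orthogonality to the complex span, which contains the
    kernel.\<close>
  let ?B = "C \<union> (\<lambda>x. \<i> *\<^sub>C x) ` C"
  have "1 / D * norm v \<le> norm (?T v)" if v: "\<And>b. b \<in> ?B \<Longrightarrow> inner v b = 0" for v
  proof (cases "v = 0")
    case False
    have "C \<subseteq> {x. cinner v x = 0}" using v by (auto simp: cinner_eq_0_iff)
    then have "cspan C \<subseteq> {x. cinner v x = 0}"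
      by (rule complex_vector.span_minimal[OF _ csubspace_cinner_kernel])
    then have orth: "inner k v = 0" if "?T k = 0" for k
      using that C(2) by (auto simp: cinner_eq_0_iff inner_commute)
    have nz: "norm (?T v) > 0"
      using False orth[of v] by auto
    have "(1 / norm (?T v)) *\<^sub>R v \<in> S"
      using orth nz by (simp add: S_def blinfun.scaleR_right del: blinfun.add_left)
    then have "norm ((1 / norm (?T v)) *\<^sub>R v) \<le> D" by (rule D(2))
    then show ?thesis using nz D(1) by (simp add: field_simps)
  qed simp
  then show ?thesis
    unfolding essentially_bounded_below_def using C(1) D(1)
    by (intro exI[of _ "1 / D"] conjI exI[of _ ?B]) auto
qed

lemma UF_iff: "u \<in> UF \<longleftrightarrow> unitary_onto UNIV u \<and> (\<exists>e>0. essentially_bounded_below e (u + id_blinfun))"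
  unfolding UF_def
  using Fredholm_blinfun_of_essentially_bounded_below essentially_bounded_below_of_Fredholm_blinfun
  by blast

section \<open>Deforming the Fredholm class to finite rank perturbations of the identity\<close>

lemmas tendsto_blinfun_compose [tendsto_intros] = bounded_bilinear.tendsto[OF bounded_bilinear_blinfun_compose]

section \<open>Stability of essential lower bounds\<close>

lemma essentially_bounded_below_mono:
  assumes "essentially_bounded_below e T" "e' \<le> e"
  shows "essentially_bounded_below e' T"
proof -
  have "e' * norm v \<le> e * norm v" for v :: 'a using assms(2) by (intro mult_right_mono) auto
  then show ?thesis using assms(1) unfolding essentially_bounded_below_def by (meson order_trans)
qed

lemma essentially_bounded_below_perturb:
  assumes "essentially_bounded_below e T"
  shows "essentially_bounded_below (e - norm (T - T')) T'"
proof -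
  obtain B where B: "finite B" "\<And>v. (\<forall>b\<in>B. inner v b = 0) \<Longrightarrow> e * norm v \<le> norm (T v)"
    using assms unfolding essentially_bounded_below_def by blast
  have "(e - norm (T - T')) * norm v \<le> norm (T' v)" if "\<forall>b\<in>B. inner v b = 0" for v
  proof -
    have "norm (T v) \<le> norm (T' v) + norm ((T - T') v)"
      using norm_triangle_ineq[of "T' v" "(T - T') v"] by (simp add: blinfun.diff_left)
    then show ?thesis using B(2)[OF that] norm_blinfun[of "T - T'" v] by (simp add: left_diff_distrib)
  qed
  then show ?thesis unfolding essentially_bounded_below_def using B(1) by blast
qed

lemma essentially_bounded_below_compose:
  fixes T :: "'b::{real_inner,complete_space} \<Rightarrow>\<^sub>L 'c::real_normed_vector"
    and R :: "'a::{real_inner,complete_space} \<Rightarrow>\<^sub>L 'b" and S :: "'a \<Rightarrow>\<^sub>L 'd::real_normed_vector"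
  assumes T: "essentially_bounded_below e T" "0 \<le> e" and R: "\<And>v. m * norm v \<le> norm (R v)"
    and S: "\<And>v. norm (T (R v)) \<le> norm (S v)"
  shows "essentially_bounded_below (e * m) S"
proof -
  obtain B where B: "finite B" "\<And>v. (\<forall>b\<in>B. inner v b = 0) \<Longrightarrow> e * norm v \<le> norm (T v)"
    using T unfolding essentially_bounded_below_def by blast
  have "e * m * norm v \<le> norm (S v)" if "\<forall>b\<in>adj R ` B. inner v b = 0" for v
  proof -
    have "\<forall>b\<in>B. inner (R v) b = 0" using that by (simp add: inner_adj)
    then have "e * norm (R v) \<le> norm (T (R v))" by (rule B(2))
    then show ?thesis using mult_left_mono[OF R T(2), of v] S[of v] by (simp add: mult_ac)
  qed
  then show ?thesis unfolding essentially_bounded_below_def using B(1) by blast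
qed

lemma norm_add_scaleR_square:
  "(norm (x + a *\<^sub>R y))\<^sup>2 = (norm x)\<^sup>2 + 2 * a * inner x y + a\<^sup>2 * (norm y)\<^sup>2"
  unfolding power2_norm_eq_inner
  by (simp add: inner_add_left inner_add_right inner_commute power2_eq_square algebra_simps)

text \<open>The common criterion for the cut-off and the shear below: in both, \<open>w + 1\<close>
  composed with an invertible \<open>N\<close> dominates \<open>u + 1\<close>. The lower bound is
  carried over by the inverse of \<open>N\<close>, which is bounded below because \<open>N\<close>
  is bounded.\<close>

lemma UF_of_compose:
  fixes u w :: "'a::complex_hilbert \<Rightarrow>\<^sub>L 'a"
  assumes e: "0 < e" "essentially_bounded_below e (u + id_blinfun)"
    and w: "unitary_onto UNIV w" and inv: "invertible_blinfun N"
    and le: "\<And>v. norm ((u + id_blinfun) v) \<le> norm ((w + id_blinfun) (N v))"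
  shows "w \<in> UF"
proof -
  define m where "m = norm N + 1"
  have m: "0 < m" using norm_ge_zero[of N] unfolding m_def by linarith
  have "essentially_bounded_below (e * (1 / m)) (w + id_blinfun)"
  proof (rule essentially_bounded_below_compose[where R="blinfun_inverse N"])
    show "essentially_bounded_below e (u + id_blinfun)" "0 \<le> e" using e by auto
    show "1 / m * norm v \<le> norm (blinfun_inverse N v)" for v
    proof -
      have "norm v \<le> norm N * norm (blinfun_inverse N v)"
        using norm_blinfun[of N "blinfun_inverse N v"] by (simp add: blinfun_inverse_right[OF inv])
      also have "\<dots> \<le> m * norm (blinfun_inverse N v)" by (intro mult_right_mono) (simp_all add: m_def)
      finally show ?thesis using m by (simp add: field_simps)
    qed
    show "norm ((u + id_blinfun) (blinfun_inverse N v)) \<le> norm ((w + id_blinfun) v)" for v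
      using le[of "blinfun_inverse N v"] by (simp only: blinfun_inverse_right[OF inv])
  qed
  then show ?thesis
    unfolding UF_iff using w e(1) m by (meson divide_pos_pos mult_pos_pos zero_less_one)
qed

text \<open>For unitary \<open>u\<close>, the distance of -1 from the essential spectrum, capped at
  1. The cap keeps the set bounded even where every \<open>e\<close> qualifies, as in finite
  dimension; 0 always belongs to it.\<close>

definition fredholm_margin :: "('a::complex_hilbert \<Rightarrow>\<^sub>L 'a) \<Rightarrow> real" where
  "fredholm_margin u = Sup {e. 0 \<le> e \<and> e \<le> 1 \<and> essentially_bounded_below e (u + id_blinfun)}"

lemma
  shows margin_set_nonempty: "{e. 0 \<le> e \<and> e \<le> 1 \<and> essentially_bounded_below e (u + id_blinfun)} \<noteq> {}"
    and margin_set_bdd: "bdd_above {e. 0 \<le> e \<and> e \<le> 1 \<and> essentially_bounded_below e (u + id_blinfun)}"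
proof -
  have "essentially_bounded_below 0 (u + id_blinfun)"
    unfolding essentially_bounded_below_def by (intro exI[of _ "{}"]) simp
  then show "{e. 0 \<le> e \<and> e \<le> 1 \<and> essentially_bounded_below e (u + id_blinfun)} \<noteq> {}"
    by (intro CollectI ex_in_conv[THEN iffD1] exI[of _ 0]) simp
  show "bdd_above {e. 0 \<le> e \<and> e \<le> 1 \<and> essentially_bounded_below e (u + id_blinfun)}"
    by (rule bdd_aboveI[of _ 1]) simp
qed

lemma fredholm_margin_le_1: "fredholm_margin u \<le> 1"
  unfolding fredholm_margin_def using margin_set_nonempty by (rule cSup_least) simp

lemma fredholm_margin_pos: "u \<in> UF \<Longrightarrow> 0 < fredholm_margin u"
proof -
  assume "u \<in> UF"
  then obtain e where e: "0 < e" "essentially_bounded_below e (u + id_blinfun)"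
    unfolding UF_iff by blast
  then have "min e 1 \<le> fredholm_margin u"
    unfolding fredholm_margin_def
    by (intro cSup_upper margin_set_bdd) (auto intro: essentially_bounded_below_mono)
  then show ?thesis using e(1) by linarith
qed

lemma fredholm_margin_less:
  assumes "e < fredholm_margin u"
  shows "\<exists>e'>e. essentially_bounded_below e' (u + id_blinfun)"
  using less_cSupD[OF margin_set_nonempty assms[unfolded fredholm_margin_def]] by blast

text \<open>A perturbation of norm \<open>r\<close> lowers an essential lower bound by at most
  \<open>r\<close>. The cut-off level can therefore vary continuously with \<open>u\<close>, in
  place of a uniform gap over the parameter space.\<close>

lemma fredholm_margin_Lipschitz: "fredholm_margin u - norm (u - v) \<le> fredholm_margin v"
proof -
  have "fredholm_margin u \<le> fredholm_margin v + norm (u - v)"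
    unfolding fredholm_margin_def[of u] using margin_set_nonempty
  proof (rule cSup_least)
    fix e assume e: "e \<in> {e. 0 \<le> e \<and> e \<le> 1 \<and> essentially_bounded_below e (u + id_blinfun)}"
    show "e \<le> fredholm_margin v + norm (u - v)"
    proof (cases "e \<le> norm (u - v)")
      case True
      have "0 \<le> fredholm_margin v"
        unfolding fredholm_margin_def
        by (rule cSup_upper2[of 0])
          (auto intro: margin_set_bdd simp: essentially_bounded_below_def)
      then show ?thesis using True by linarith
    next
      case False
      have "essentially_bounded_below (e - norm (u - v)) (v + id_blinfun)"
        using essentially_bounded_below_perturb[of e "u + id_blinfun" "v + id_blinfun"] e by simp
      moreover have "e - norm (u - v) \<le> 1" using e norm_ge_zero[of "u - v"] unfolding mem_Collect_eq by linarith
      ultimately have "e - norm (u - v) \<le> fredholm_margin v"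
        unfolding fredholm_margin_def using False by (intro cSup_upper margin_set_bdd) auto
      then show ?thesis by linarith
    qed
  qed
  then show ?thesis by linarith
qed

lemma tendsto_fredholm_margin:
  assumes "(u \<longlongrightarrow> u0) F"
  shows "((\<lambda>x. fredholm_margin (u x)) \<longlongrightarrow> fredholm_margin u0) F"
proof (rule tendstoI)
  fix e :: real assume "e > 0"
  with assms have "eventually (\<lambda>x. dist (u x) u0 < e) F" by (rule tendstoD)
  then show "eventually (\<lambda>x. dist (fredholm_margin (u x)) (fredholm_margin u0) < e) F"
  proof eventually_elim
    case (elim x)
    then show ?case
      using fredholm_margin_Lipschitz[of "u x" u0] fredholm_margin_Lipschitz[of u0 "u x"]
      by (simp add: dist_norm norm_minus_commute abs_less_iff)
  qed
qed

section \<open>Cutting off the spectrum of a unitary near -1\<close>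

definition abs_sq :: "('a::complex_hilbert \<Rightarrow>\<^sub>L 'a) \<Rightarrow> 'a \<Rightarrow>\<^sub>L 'a" where
  "abs_sq u = (1/4) *\<^sub>R (2 *\<^sub>R id_blinfun + u + adj u)"

text \<open>The minimum of \<open>d^2\<close> and \<open>q\<close> is half of
  \<open>d^2 + q - |d^2 - q|\<close>. The factor 1/2 here keeps the norm at most 1, the range in
  which \<open>abs_blinfun\<close> is the absolute value.\<close>

definition cut_diff :: "('a::complex_hilbert \<Rightarrow>\<^sub>L 'a) \<Rightarrow> real \<Rightarrow> 'a \<Rightarrow>\<^sub>L 'a" where
  "cut_diff u d = (1/2) *\<^sub>R (d\<^sup>2 *\<^sub>R id_blinfun - abs_sq u)"

text \<open>On spectral values, \<^const>\<open>abs_sq\<close> is \<open>q = \<bar>1 + u\<bar>\<^sup>2 / 4\<close> and the cut-off below is \<open>min 1 (q / d\<^sup>2)\<close>.\<close>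

definition cut_off :: "('a::complex_hilbert \<Rightarrow>\<^sub>L 'a) \<Rightarrow> real \<Rightarrow> 'a \<Rightarrow>\<^sub>L 'a" where
  "cut_off u d = (1 / (2 * d\<^sup>2)) *\<^sub>R (d\<^sup>2 *\<^sub>R id_blinfun + abs_sq u - 2 *\<^sub>R abs_blinfun (cut_diff u d))"

definition cut_denominator :: "('a::complex_hilbert \<Rightarrow>\<^sub>L 'a) \<Rightarrow> real \<Rightarrow> real \<Rightarrow> 'a \<Rightarrow>\<^sub>L 'a" where
  "cut_denominator u d t = id_blinfun + t *\<^sub>R (cut_off u d o\<^sub>L u)"

text \<open>The function \<open>z \<mapsto> (z + t e) / (1 + t e z)\<close> preserves the unit circle for real \<open>e\<close>, is the identity for
  \<open>t = 0\<close>, and for \<open>t = 1\<close> it is constantly \<open>1\<close> where the cut-off \<open>e\<close> equals \<open>1\<close>.\<close>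

definition contract_unitary :: "('a::complex_hilbert \<Rightarrow>\<^sub>L 'a) \<Rightarrow> real \<Rightarrow> real \<Rightarrow> 'a \<Rightarrow>\<^sub>L 'a" where
  "contract_unitary u d t = (u + t *\<^sub>R cut_off u d) o\<^sub>L blinfun_inverse (cut_denominator u d t)"

lemma tendsto_abs_sq [tendsto_intros]:
  "(u \<longlongrightarrow> u0) F \<Longrightarrow> ((\<lambda>x. abs_sq (u x)) \<longlongrightarrow> abs_sq u0) F"
  unfolding abs_sq_def by (intro tendsto_intros)

lemma tendsto_cut_diff [tendsto_intros]:
  "(u \<longlongrightarrow> u0) F \<Longrightarrow> (d \<longlongrightarrow> d0) F \<Longrightarrow> ((\<lambda>x. cut_diff (u x) (d x)) \<longlongrightarrow> cut_diff u0 d0) F"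
  unfolding cut_diff_def by (intro tendsto_intros)

context
  fixes u :: "'a::complex_hilbert \<Rightarrow>\<^sub>L 'a" and d :: real
  assumes u: "unitary_onto UNIV u" and d: "0 < d" "d \<le> 1"
begin

lemma adj_abs_sq: "adj (abs_sq u) = abs_sq u"
  by (simp add: abs_sq_def adj_add adj_scaleR add_ac)

lemma abs_sq_apply: "abs_sq u v = (1/4) *\<^sub>R (2 *\<^sub>R v + u v + adj u v)"
  by (simp add: abs_sq_def blinfun.add_left blinfun.scaleR_left)

lemma inner_abs_sq_eq: "inner (abs_sq u v) v = (inner v v + inner (u v) v) / 2"
  using inner_commute[of v "u v"]
  by (simp add: abs_sq_apply inner_add_left inner_adj_left)

lemma inner_abs_sq: "inner (abs_sq u v) v = (norm (v + u v))\<^sup>2 / 4"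
proof -
  have "(norm (v + u v))\<^sup>2 = 2 * inner v v + 2 * inner (u v) v"
    by (simp add: power2_norm_eq_inner inner_add_left inner_add_right unitary_inner[OF u] inner_commute)
  then show ?thesis by (simp add: inner_abs_sq_eq)
qed

lemma inner_unitary_abs_sq: "inner (u v) v = 2 * inner (abs_sq u v) v - inner v v"
  by (simp add: inner_abs_sq_eq field_simps)

lemma abs_sq_commute: "u (abs_sq u v) = abs_sq u (u v)"
  by (simp add: abs_sq_apply blinfun.add_right blinfun.scaleR_right
      unitary_adj_left[OF u] unitary_adj_right[OF u])

lemma abs_sq_commute_adj: "adj u (abs_sq u v) = abs_sq u (adj u v)"
  by (simp add: abs_sq_apply blinfun.add_right blinfun.scaleR_right
      unitary_adj_left[OF u] unitary_adj_right[OF u])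

lemma adj_cut_diff: "adj (cut_diff u d) = cut_diff u d"
  by (simp add: cut_diff_def adj_scaleR adj_diff adj_abs_sq)

lemma norm_cut_diff: "norm (cut_diff u d) \<le> 1"
proof -
  have nu: "norm u \<le> 1" by (rule norm_blinfun_bound) (simp_all add: unitary_norm[OF u])
  have "norm (abs_sq u) \<le> 1"
  proof -
    have "norm (2 *\<^sub>R id_blinfun + u + adj u) \<le> norm (2 *\<^sub>R (id_blinfun :: 'a \<Rightarrow>\<^sub>L 'a)) + norm u + norm (adj u)"
      by (intro order_trans[OF norm_triangle_ineq] add_right_mono norm_triangle_ineq)
    also have "\<dots> \<le> 2 * 1 + 1 + 1"
      using nu norm_adj_le[of u] norm_blinfun_id_le[where 'a='a] by simp
    finally show ?thesis by (simp add: abs_sq_def)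
  qed
  moreover have "norm (d\<^sup>2 *\<^sub>R (id_blinfun :: 'a \<Rightarrow>\<^sub>L 'a)) \<le> 1 * 1"
    unfolding norm_scaleR using d by (intro mult_mono norm_blinfun_id_le) (auto simp: power_le_one)
  moreover have "norm (cut_diff u d) \<le> (norm (d\<^sup>2 *\<^sub>R (id_blinfun :: 'a \<Rightarrow>\<^sub>L 'a)) + norm (abs_sq u)) / 2"
    unfolding cut_diff_def using norm_triangle_ineq4[of "d\<^sup>2 *\<^sub>R id_blinfun" "abs_sq u"] by simp
  ultimately show ?thesis by (simp only: mult_1) argo
qed

lemmas abs_cut = adj_abs_blinfun[OF adj_cut_diff norm_cut_diff]
  abs_blinfun_nonneg[OF adj_cut_diff norm_cut_diff]
  abs_blinfun_commute[OF adj_cut_diff norm_cut_diff]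
  abs_blinfun_orthogonal[OF adj_cut_diff norm_cut_diff]

lemma cut_diff_apply: "cut_diff u d v = (1/2) *\<^sub>R (d\<^sup>2 *\<^sub>R v - abs_sq u v)"
  by (simp add: cut_diff_def blinfun.diff_left blinfun.scaleR_left)

lemma cut_off_apply:
  "cut_off u d v = (1 / (2 * d\<^sup>2)) *\<^sub>R (d\<^sup>2 *\<^sub>R v + abs_sq u v - 2 *\<^sub>R abs_blinfun (cut_diff u d) v)"
  by (simp add: cut_off_def blinfun.diff_left blinfun.scaleR_left blinfun.add_left)

lemma cut_off_commute: "u (cut_off u d v) = cut_off u d (u v)"
proof -
  have "u (abs_blinfun (cut_diff u d) v) = abs_blinfun (cut_diff u d) (u v)"
    by (rule abs_cut(3)) (simp add: cut_diff_apply blinfun.diff_right blinfun.scaleR_right abs_sq_commute)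
  then show ?thesis
    by (simp add: cut_off_apply blinfun.diff_right blinfun.scaleR_right blinfun.add_right abs_sq_commute)
qed

lemma adj_cut_off: "adj (cut_off u d) = cut_off u d"
  by (simp add: cut_off_def adj_scaleR adj_diff adj_add adj_abs_sq abs_cut(1))

lemma cut_denominator_apply: "cut_denominator u d t v = v + t *\<^sub>R cut_off u d (u v)"
  by (simp add: cut_denominator_def blinfun.add_left blinfun.scaleR_left)

lemma adj_cut_denominator_apply: "adj (cut_denominator u d t) v = v + t *\<^sub>R adj u (cut_off u d v)"
  by (simp add: cut_denominator_def adj_add adj_scaleR adj_compose adj_cut_off blinfun.add_left blinfun.scaleR_left)

text \<open>The spectral subspace of \<open>u\<close> where \<open>q\<close> is at most
  \<open>d^2\<close>; on its orthogonal complement \<open>q\<close> is at least \<open>d^2\<close>.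
  Both reduce \<open>u\<close>, so the estimates below are made on each of them separately.\<close>

definition low_part :: "'a set" where
  "low_part = {v. abs_blinfun (cut_diff u d) v = cut_diff u d v}"

lemma low_part_subspace: "subspace low_part" "closed low_part"
proof -
  show "subspace low_part"
    by (simp add: low_part_def subspace_def blinfun.add_right blinfun.scaleR_right)
  show "closed low_part"
    unfolding low_part_def by (intro closed_Collect_eq) (auto intro!: continuous_intros)
qed

lemma low_part_decomposition:
  obtains v1 v2 where "v = v1 + v2" "v1 \<in> low_part" "\<And>s. s \<in> low_part \<Longrightarrow> inner v2 s = 0"
proof -
  obtain w where w: "w \<in> low_part" "\<And>s. s \<in> low_part \<Longrightarrow> inner (v - w) s = 0"
    using exists_orthogonal_projection[OF low_part_subspace] by blast
  then show ?thesis using that[of w "v - w"] by simp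
qed

lemma cut_off_low:
  assumes "v \<in> low_part"
  shows "cut_off u d v = (1 / d\<^sup>2) *\<^sub>R abs_sq u v" "inner (abs_sq u v) v \<le> d\<^sup>2 * inner v v"
proof -
  show "cut_off u d v = (1 / d\<^sup>2) *\<^sub>R abs_sq u v"
    using assms d by (simp add: low_part_def cut_off_apply cut_diff_apply scaleR_2[symmetric])
  show "inner (abs_sq u v) v \<le> d\<^sup>2 * inner v v"
    using abs_cut(2)[of v] assms by (simp add: low_part_def cut_diff_apply inner_diff_left)
qed

lemma cut_off_high:
  assumes "\<And>s. s \<in> low_part \<Longrightarrow> inner v s = 0"
  shows "cut_off u d v = v" "d\<^sup>2 * inner v v \<le> inner (abs_sq u v) v"
proof -
  have *: "abs_blinfun (cut_diff u d) v = - cut_diff u d v"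
    by (rule abs_cut(4)) (use assms in \<open>simp add: low_part_def\<close>)
  have "d\<^sup>2 *\<^sub>R v + abs_sq u v - 2 *\<^sub>R abs_blinfun (cut_diff u d) v = (2 * d\<^sup>2) *\<^sub>R v"
    unfolding * by (simp add: cut_diff_apply) (simp add: scaleR_2 flip: scaleR_scaleR)
  then show "cut_off u d v = v"
    using d by (simp add: cut_off_apply)
  show "d\<^sup>2 * inner v v \<le> inner (abs_sq u v) v"
    using abs_cut(2)[of v] by (simp add: * cut_diff_apply inner_diff_left)
qed

lemma unitary_low: "v \<in> low_part \<Longrightarrow> u v \<in> low_part"
  using abs_cut(3)[of u v]
  by (simp add: low_part_def cut_diff_apply blinfun.diff_right blinfun.scaleR_right abs_sq_commute)

lemma adj_unitary_low: "v \<in> low_part \<Longrightarrow> adj u v \<in> low_part"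
proof -
  assume v: "v \<in> low_part"
  have c: "adj u (cut_diff u d w) = cut_diff u d (adj u w)" for w
    by (simp add: cut_diff_apply blinfun.diff_right blinfun.scaleR_right abs_sq_commute_adj)
  show ?thesis using v abs_cut(3)[of "adj u" v, OF c] c[of v] by (simp add: low_part_def)
qed

lemma unitary_high:
  "(\<And>s. s \<in> low_part \<Longrightarrow> inner v s = 0) \<Longrightarrow> s \<in> low_part \<Longrightarrow> inner (u v) s = 0"
  using adj_unitary_low by (simp add: inner_adj[symmetric])

lemma abs_sq_low: "v \<in> low_part \<Longrightarrow> abs_sq u v \<in> low_part"
  unfolding abs_sq_apply
  by (intro subspace_scale subspace_add low_part_subspace) (auto intro: unitary_low adj_unitary_low)

lemma inner_cut_off_nonneg: "0 \<le> inner (cut_off u d v) v"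
proof -
  obtain v1 v2 where v: "v = v1 + v2" "v1 \<in> low_part" "\<And>s. s \<in> low_part \<Longrightarrow> inner v2 s = 0"
    using low_part_decomposition by blast
  have "cut_off u d v = (1 / d\<^sup>2) *\<^sub>R abs_sq u v1 + v2"
    by (simp add: v(1) blinfun.add_right cut_off_low[OF v(2)] cut_off_high[OF v(3)])
  then have "inner (cut_off u d v) v = inner (abs_sq u v1) v1 / d\<^sup>2 + inner v2 v2"
    using v(3)[OF v(2)] v(3)[OF abs_sq_low[OF v(2)]]
    by (simp add: v(1) inner_add_left inner_add_right inner_commute)
  then show ?thesis by (simp add: inner_abs_sq)
qed

text \<open>Here the cut-off is \<open>Q / d^2\<close> with \<open>Q = abs_sq u\<close>. From
  \<open>u + adj u = 4 Q - 2\<close> the squared norm of the image is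
  \<open>norm (v - a Q v)^2 + 4 a norm (Q v)^2\<close> with \<open>a = t / d^2\<close>. If
  \<open>a * norm (Q v)\<close> is at most \<open>norm v / 2\<close> the first term suffices,
  otherwise the second does.\<close>

lemma norm_cut_denominator_low:
  assumes v: "v \<in> low_part" and t: "0 \<le> t" "t \<le> 1"
  shows "(d / 2)\<^sup>2 * (norm v)\<^sup>2 \<le> (norm (cut_denominator u d t v))\<^sup>2"
proof -
  define a where "a = t / d\<^sup>2"
  define q where "q = norm (abs_sq u v)"
  have a0: "0 \<le> a" "a * d\<^sup>2 = t" using t d by (simp_all add: a_def)
  have N: "cut_denominator u d t v = v + a *\<^sub>R abs_sq u (u v)"
    by (simp add: cut_denominator_apply cut_off_low[OF unitary_low[OF v]] a_def)
  have nq: "norm (abs_sq u (u v)) = q"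
    by (simp add: q_def abs_sq_commute[symmetric] unitary_norm[OF u])
  have "inner (abs_sq u (u v)) v = inner (u v) (abs_sq u v)"
    using inner_symmetric[OF adj_abs_sq] by blast
  moreover have "inner (abs_sq u (u v)) v = inner (abs_sq u v) (adj u v)"
    by (simp add: abs_sq_commute[symmetric] inner_adj)
  moreover have "inner (abs_sq u v) (4 *\<^sub>R abs_sq u v) = 2 * inner (abs_sq u v) v + inner (abs_sq u v) (u v) + inner (abs_sq u v) (adj u v)"
    by (subst (2) abs_sq_apply) (simp add: inner_add_right)
  ultimately have h: "inner v (abs_sq u (u v)) = 2 * q\<^sup>2 - inner v (abs_sq u v)"
    by (simp add: q_def power2_norm_eq_inner inner_commute)
  have eq: "(norm (cut_denominator u d t v))\<^sup>2 = (norm (v - a *\<^sub>R abs_sq u v))\<^sup>2 + 4 * a * q\<^sup>2"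
    using norm_add_scaleR_square[of v a "abs_sq u (u v)"] norm_add_scaleR_square[of v "- a" "abs_sq u v"]
    unfolding N nq h q_def[symmetric] by (simp add: algebra_simps)
  show ?thesis
  proof (cases "a * q \<le> norm v / 2")
    case True
    have "norm v / 2 \<le> norm (v - a *\<^sub>R abs_sq u v)"
      using norm_triangle_ineq2[of v "a *\<^sub>R abs_sq u v"] True a0(1) by (simp add: q_def)
    then have "(norm v / 2)\<^sup>2 \<le> (norm (v - a *\<^sub>R abs_sq u v))\<^sup>2" by (rule power_mono) simp
    moreover have "(d / 2)\<^sup>2 * (norm v)\<^sup>2 \<le> (norm v / 2)\<^sup>2"
    proof -
      have "d\<^sup>2 * (norm v)\<^sup>2 \<le> 1 * (norm v)\<^sup>2" using d by (intro mult_right_mono) (auto simp: power_le_one)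
      then show ?thesis by (simp add: power_divide)
    qed
    moreover have "0 \<le> 4 * a * q\<^sup>2" using a0(1) by simp
    ultimately show ?thesis using eq by linarith
  next
    case False
    then have apos: "0 < a" using a0(1) norm_ge_zero[of v] by (cases "a = 0") auto
    have "(norm v / 2)\<^sup>2 \<le> (a * q)\<^sup>2" using False by (intro power_mono) auto
    then have "d\<^sup>2 * (norm v)\<^sup>2 \<le> d\<^sup>2 * (4 * (a * q)\<^sup>2)" by (intro mult_left_mono) (simp_all add: power_divide)
    also have "\<dots> = t * (4 * a * q\<^sup>2)" using a0(2) by (simp add: power2_eq_square mult_ac flip: a0(2))
    also have "\<dots> \<le> 1 * (4 * a * q\<^sup>2)" using t apos by (intro mult_right_mono) auto
    finally have "d\<^sup>2 * (norm v)\<^sup>2 \<le> (norm (cut_denominator u d t v))\<^sup>2"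
      using eq zero_le_power2[of "norm (v - a *\<^sub>R abs_sq u v)"] by linarith
    moreover have "(d / 2)\<^sup>2 * (norm v)\<^sup>2 \<le> d\<^sup>2 * (norm v)\<^sup>2" by (simp add: power_divide)
    ultimately show ?thesis by linarith
  qed
qed

text \<open>Here the cut-off is 1. The squared norm is
  \<open>(1 - t)^2 norm v^2 + 4 t inner (Q v) v\<close> with \<open>Q = abs_sq u\<close>, which is
  at least \<open>d^2 (1 + t)^2 norm v^2\<close>.\<close>

lemma norm_cut_denominator_high:
  assumes v: "\<And>s. s \<in> low_part \<Longrightarrow> inner v s = 0" and t: "0 \<le> t" "t \<le> 1"
  shows "(d / 2)\<^sup>2 * (norm v)\<^sup>2 \<le> (norm (cut_denominator u d t v))\<^sup>2"
proof -
  have N: "cut_denominator u d t v = v + t *\<^sub>R u v"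
    using cut_off_high(1)[of "u v"] unitary_high[OF v] by (simp add: cut_denominator_apply)
  have "(norm (v + t *\<^sub>R u v))\<^sup>2 = inner v v * (1 + t\<^sup>2) + 2 * t * inner (u v) v"
    unfolding norm_add_scaleR_square unitary_norm[OF u]
    by (simp add: power2_norm_eq_inner inner_commute algebra_simps)
  also have "\<dots> = inner v v * (1 - t)\<^sup>2 + 4 * t * inner (abs_sq u v) v"
    unfolding inner_unitary_abs_sq by (simp add: power2_eq_square algebra_simps)
  finally have eq: "(norm (cut_denominator u d t v))\<^sup>2 = inner v v * (1 - t)\<^sup>2 + 4 * t * inner (abs_sq u v) v"
    using N by simp
  have "d\<^sup>2 * inner v v * ((1 - t)\<^sup>2 + 4 * t) \<le> inner v v * (1 - t)\<^sup>2 + 4 * t * inner (abs_sq u v) v"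
  proof -
    have "4 * t * (d\<^sup>2 * inner v v) \<le> 4 * t * inner (abs_sq u v) v"
      using cut_off_high(2)[OF v] t by (intro mult_left_mono) auto
    moreover have "d\<^sup>2 * (inner v v * (1 - t)\<^sup>2) \<le> 1 * (inner v v * (1 - t)\<^sup>2)"
      using d by (intro mult_right_mono) (auto simp: power_le_one)
    ultimately show ?thesis by (simp add: algebra_simps)
  qed
  moreover have "d\<^sup>2 * inner v v * 1 \<le> d\<^sup>2 * inner v v * ((1 - t)\<^sup>2 + 4 * t)"
  proof (rule mult_left_mono)
    have "(1 - t)\<^sup>2 + 4 * t = 1 + (2 * t + t * t)" by (simp add: power2_eq_square algebra_simps)
    moreover have "0 \<le> 2 * t + t * t" using t(1) by simp
    ultimately show "1 \<le> (1 - t)\<^sup>2 + 4 * t" by linarith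
  qed simp
  moreover have "(d / 2)\<^sup>2 * (norm v)\<^sup>2 \<le> d\<^sup>2 * inner v v"
    by (simp add: power_divide power2_norm_eq_inner[symmetric])
  ultimately show ?thesis using eq by linarith
qed

lemma norm_cut_denominator:
  assumes t: "0 \<le> t" "t \<le> 1"
  shows "d / 2 * norm v \<le> norm (cut_denominator u d t v)"
proof -
  let ?N = "cut_denominator u d t"
  obtain v1 v2 where v: "v = v1 + v2" "v1 \<in> low_part" "\<And>s. s \<in> low_part \<Longrightarrow> inner v2 s = 0"
    using low_part_decomposition by blast
  have N1: "?N v1 \<in> low_part"
    unfolding cut_denominator_apply cut_off_low(1)[OF unitary_low[OF v(2)]]
    by (intro subspace_scale subspace_add low_part_subspace v(2) abs_sq_low unitary_low)
  have "?N v2 = v2 + t *\<^sub>R u v2"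
    using cut_off_high(1)[of "u v2"] unitary_high[OF v(3)] by (simp add: cut_denominator_apply)
  then have "inner (?N v2) (?N v1) = 0"
    using N1 v(3) unitary_high[OF v(3)] by (simp add: inner_add_left)
  then have "(norm (?N v))\<^sup>2 = (norm (?N v1))\<^sup>2 + (norm (?N v2))\<^sup>2"
    by (simp add: v(1) blinfun.add_right power2_norm_eq_inner inner_add_left inner_add_right inner_commute)
  moreover have "(norm v)\<^sup>2 = (norm v1)\<^sup>2 + (norm v2)\<^sup>2"
    using v(3)[OF v(2)] by (simp add: v(1) power2_norm_eq_inner inner_add_left inner_add_right inner_commute)
  ultimately have "(d / 2)\<^sup>2 * (norm v)\<^sup>2 \<le> (norm (?N v))\<^sup>2"
    using norm_cut_denominator_low[OF v(2) t] norm_cut_denominator_high[OF v(3) t]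
    by (simp add: distrib_left)
  then have "(d / 2 * norm v)\<^sup>2 \<le> (norm (?N v))\<^sup>2" by (simp only: power_mult_distrib)
  then show ?thesis by (rule power2_le_imp_le) simp
qed

text \<open>The denominator is a function of \<open>u\<close>, hence normal.\<close>

lemma norm_adj_cut_denominator: "norm (adj (cut_denominator u d t) v) = norm (cut_denominator u d t v)"
proof -
  let ?N = "cut_denominator u d t"
  have c: "adj u (cut_off u d w) = cut_off u d (adj u w)" for w
    using cut_off_commute[of "adj u w"] by (metis unitary_adj_left[OF u] unitary_adj_right[OF u])
  have "adj ?N (?N v) = ?N (adj ?N v)"
    by (simp add: cut_denominator_apply adj_cut_denominator_apply blinfun.add_right blinfun.scaleR_right
        c cut_off_commute unitary_adj_left[OF u] unitary_adj_right[OF u] scaleR_add_right add_ac)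
  then have "inner (adj ?N v) (adj ?N v) = inner (?N v) (?N v)"
    by (metis inner_adj inner_commute)
  then show ?thesis by (simp add: norm_eq)
qed

lemma invertible_cut_denominator:
  assumes t: "0 \<le> t" "t \<le> 1"
  shows "invertible_blinfun (cut_denominator u d t)"
proof (rule invertible_blinfunI)
  show "0 < d / 2" using d by simp
  show "d / 2 * norm v \<le> norm (cut_denominator u d t v)" for v by (rule norm_cut_denominator[OF t])
  show "v = 0" if "adj (cut_denominator u d t) v = 0" for v
    using norm_cut_denominator[OF t, of v] norm_adj_cut_denominator[of t v] that d
    by (simp add: mult_le_0_iff)
qed

text \<open>With \<open>e\<close> the cut-off and \<open>N\<close> the denominator,
  \<open>u + t e = u (adj N)\<close>. So the contraction is \<open>u (adj N)\<close> times the
  inverse of \<open>N\<close>, which is unitary because \<open>N\<close> is normal.\<close>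

lemma contract_unitary_apply:
  assumes t: "0 \<le> t" "t \<le> 1"
  shows "contract_unitary u d t (cut_denominator u d t v) = u (adj (cut_denominator u d t) v)"
  by (simp add: contract_unitary_def blinfun.add_left blinfun.scaleR_left blinfun.add_right blinfun.scaleR_right
      blinfun_inverse_left[OF invertible_cut_denominator[OF t]] adj_cut_denominator_apply unitary_adj_right[OF u])

lemma clinear_cut_off: "clinear_blinfun (cut_off u d)"
proof -
  have "clinear_blinfun (abs_sq u)"
    unfolding abs_sq_def
    by (intro clinear_blinfun_scaleR clinear_blinfun_add clinear_blinfun_adj unitary_clinear[OF u] clinear_blinfun_id)
  then show ?thesis
    unfolding cut_off_def
    by (intro clinear_blinfun_scaleR clinear_blinfun_add clinear_blinfun_diff
        clinear_abs_blinfun adj_cut_diff norm_cut_diff clinear_blinfun_id)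
      (simp_all add: cut_diff_def clinear_blinfun_scaleR clinear_blinfun_diff)
qed

lemma unitary_contract_unitary:
  assumes t: "0 \<le> t" "t \<le> 1"
  shows "unitary_onto UNIV (contract_unitary u d t)"
proof -
  let ?N = "cut_denominator u d t" and ?G = "contract_unitary u d t"
  note inv = invertible_cut_denominator[OF t]
  have "clinear_blinfun ?N"
    unfolding cut_denominator_def
    by (intro clinear_blinfun_add clinear_blinfun_scaleR clinear_blinfun_compose clinear_cut_off
        unitary_clinear[OF u] clinear_blinfun_id)
  then have "clinear_blinfun ?G"
    unfolding contract_unitary_def
    by (intro clinear_blinfun_add clinear_blinfun_scaleR clinear_blinfun_compose clinear_cut_off
        unitary_clinear[OF u] clinear_blinfun_inverse inv)
  moreover have "norm (?G v) = norm v" for v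
  proof -
    have "norm (?G (?N (blinfun_inverse ?N v))) = norm (?N (blinfun_inverse ?N v))"
      unfolding contract_unitary_apply[OF t] by (simp add: unitary_norm[OF u] norm_adj_cut_denominator)
    then show ?thesis by (simp add: blinfun_inverse_right[OF inv])
  qed
  moreover have "y \<in> range ?G" for y
  proof -
    let ?w = "adj (blinfun_inverse ?N) (adj u y)"
    have "inner z (adj ?N ?w) = inner z (adj u y)" for z
      by (simp add: inner_adj blinfun_inverse_left[OF inv])
    then have "adj ?N ?w = adj u y" by (rule inner_eqI)
    then have "?G (?N ?w) = y" by (simp add: contract_unitary_apply[OF t] unitary_adj_right[OF u])
    then show ?thesis by (metis rangeI)
  qed
  ultimately show ?thesis unfolding unitary_onto_def by auto
qed

text \<open>With \<open>G\<close> the contraction, \<open>N\<close> the denominator and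
  \<open>E\<close> the cut-off, \<open>(G + 1) N = (1 + t E) (1 + u)\<close>. Since \<open>E\<close>
  is nonnegative, \<open>1 + t E\<close> does not decrease norms.\<close>

lemma contract_unitary_in_UF:
  assumes t: "0 \<le> t" "t \<le> 1" and e: "0 < e" "essentially_bounded_below e (u + id_blinfun)"
  shows "contract_unitary u d t \<in> UF"
proof (rule UF_of_compose[OF e unitary_contract_unitary[OF t] invertible_cut_denominator[OF t]])
  fix w
  let ?x = "(u + id_blinfun) w"
  have "(contract_unitary u d t + id_blinfun) (cut_denominator u d t w) = ?x + t *\<^sub>R cut_off u d ?x"
    unfolding blinfun.add_left contract_unitary_apply[OF t]
    by (simp add: cut_denominator_apply adj_cut_denominator_apply blinfun.add_right blinfun.scaleR_right
        unitary_adj_right[OF u] scaleR_add_right)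
  moreover have "(norm ?x)\<^sup>2 \<le> (norm (?x + t *\<^sub>R cut_off u d ?x))\<^sup>2"
    using inner_cut_off_nonneg[of ?x] t(1) norm_add_scaleR_square[of ?x t "cut_off u d ?x"]
    by (simp add: inner_commute del: blinfun.add_left)
  ultimately show "norm ?x \<le> norm ((contract_unitary u d t + id_blinfun) (cut_denominator u d t w))"
    by (metis norm_ge_zero power2_le_imp_le)
qed

lemma contract_unitary_0: "contract_unitary u d 0 = u"
proof (rule blinfun_eqI)
  fix v
  show "contract_unitary u d 0 v = u v"
    using contract_unitary_apply[of 0 v]
    by (simp add: cut_denominator_apply adj_cut_denominator_apply)
qed

text \<open>On \<open>low_part\<close> the normalization \<open>q = |1 + u|^2 / 4\<close> gives
  \<open>norm ((u + 1) v) \<le> 2 * d * norm v\<close>. With \<open>2 * d < e\<close> this excludes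
  nonzero vectors orthogonal to \<open>B\<close>, so \<open>low_part\<close> is finite-dimensional.
  On its complement the cut-off is 1 and the contraction at \<open>t = 1\<close> is the
  identity.\<close>

lemma contract_unitary_1_finite:
  assumes e: "2 * d < e" "essentially_bounded_below e (u + id_blinfun)"
  shows "\<exists>C. finite C \<and> (\<forall>v. (\<forall>c\<in>C. inner v c = 0) \<longrightarrow> contract_unitary u d 1 v = v)"
proof -
  let ?N = "cut_denominator u d 1"
  have inv: "invertible_blinfun ?N" by (rule invertible_cut_denominator) simp_all
  obtain B where B: "finite B" "\<And>v. (\<forall>b\<in>B. inner v b = 0) \<Longrightarrow> e * norm v \<le> norm ((u + id_blinfun) v)"
    using e(2) unfolding essentially_bounded_below_def by blast
  have "v = 0" if v: "v \<in> low_part" "\<And>b. b \<in> B \<Longrightarrow> inner v b = 0" for v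
  proof (rule ccontr)
    assume "v \<noteq> 0"
    have "(norm (v + u v))\<^sup>2 \<le> (2 * d * norm v)\<^sup>2"
      using cut_off_low(2)[OF v(1)] unfolding inner_abs_sq
      by (simp add: power_mult_distrib power2_norm_eq_inner[symmetric])
    then have "norm (v + u v) \<le> 2 * d * norm v" by (rule power2_le_imp_le) (use d in simp)
    moreover have "2 * d * norm v < e * norm v" using e(1) \<open>v \<noteq> 0\<close> by (intro mult_strict_right_mono) auto
    moreover have "e * norm v \<le> norm (v + u v)" using B(2)[of v] v(2) by (simp add: blinfun.add_left add.commute)
    ultimately show False by linarith
  qed
  then obtain C where C: "finite C" "low_part \<subseteq> span C"
    using finite_dim_of_orthogonal[OF B(1) low_part_subspace(1)] by blast
  have "contract_unitary u d 1 v = v" if v: "\<forall>c\<in>C. inner v c = 0" for v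
  proof -
    have "span C \<subseteq> {x. inner v x = 0}"
      by (rule span_minimal) (use v in \<open>auto simp: subspace_def inner_add_right\<close>)
    then have orth: "inner v s = 0" if "s \<in> low_part" for s using that C(2) by blast
    define w where "w = blinfun_inverse ?N v"
    have Nw: "?N w = v" by (simp add: w_def blinfun_inverse_right[OF inv])
    obtain w1 w2 where w: "w = w1 + w2" "w1 \<in> low_part" "\<And>s. s \<in> low_part \<Longrightarrow> inner w2 s = 0"
      using low_part_decomposition by blast
    have N1: "?N w1 \<in> low_part"
      unfolding cut_denominator_apply cut_off_low(1)[OF unitary_low[OF w(2)]]
      by (intro subspace_scale subspace_add low_part_subspace w(2) abs_sq_low unitary_low)
    have N2: "?N w2 = w2 + u w2"
      using cut_off_high(1)[of "u w2"] unitary_high[OF w(3)] by (simp add: cut_denominator_apply)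
    have "?N w1 = v - (w2 + u w2)" using Nw by (simp add: w(1) blinfun.add_right N2 algebra_simps)
    then have "inner (?N w1) (?N w1) = inner (v - (w2 + u w2)) (?N w1)" by simp
    also have "\<dots> = 0" using orth[OF N1] w(3)[OF N1] unitary_high[OF w(3) N1]
      by (simp add: inner_diff_left inner_add_left)
    finally have "?N w1 = 0" by simp
    then have "w1 = 0" using blinfun_inverse_left[OF inv, of w1] by simp
    then have w2: "w = w2" using w(1) by simp
    have "contract_unitary u d 1 (?N w) = u w2 + w2"
      by (simp add: contract_unitary_apply adj_cut_denominator_apply w2 cut_off_high(1)[OF w(3)]
          blinfun.add_right unitary_adj_right[OF u])
    then show ?thesis using N2 Nw w2 by (simp add: add.commute)
  qed
  then show ?thesis using C(1) by blast
qed

end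

lemma tendsto_contract_unitary:
  assumes lim: "(u \<longlongrightarrow> u0) F" "(d \<longlongrightarrow> d0) F" "(t \<longlongrightarrow> t0) F"
    and ev: "eventually (\<lambda>x. unitary_onto UNIV (u x) \<and> 0 < d x \<and> d x \<le> 1 \<and> 0 \<le> t x \<and> t x \<le> 1) F"
    and u0: "unitary_onto UNIV u0" "0 < d0" "d0 \<le> 1" "0 \<le> t0" "t0 \<le> 1"
  shows "((\<lambda>x. contract_unitary (u x) (d x) (t x)) \<longlongrightarrow> contract_unitary u0 d0 t0) F"
proof -
  have abs: "((\<lambda>x. abs_blinfun (cut_diff (u x) (d x))) \<longlongrightarrow> abs_blinfun (cut_diff u0 d0)) F"
    by (rule tendsto_abs_blinfun)
      (use ev in \<open>auto intro!: tendsto_cut_diff lim adj_cut_diff norm_cut_diff u0 elim!: eventually_mono\<close>)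
  have off: "((\<lambda>x. cut_off (u x) (d x)) \<longlongrightarrow> cut_off u0 d0) F"
    unfolding cut_off_def
    by (rule tendsto_scaleR[OF tendsto_divide]; (intro tendsto_intros lim abs)?) (use u0 in auto)
  have den: "((\<lambda>x. cut_denominator (u x) (d x) (t x)) \<longlongrightarrow> cut_denominator u0 d0 t0) F"
    unfolding cut_denominator_def by (intro tendsto_add tendsto_const tendsto_scaleR tendsto_blinfun_compose lim off)
  have "((\<lambda>x. blinfun_inverse (cut_denominator (u x) (d x) (t x))) \<longlongrightarrow> blinfun_inverse (cut_denominator u0 d0 t0)) F"
    by (rule tendsto_blinfun_inverse[OF den])
      (use ev in \<open>auto intro!: invertible_cut_denominator u0 elim!: eventually_mono\<close>)
  then show ?thesis
    unfolding contract_unitary_def by (intro tendsto_blinfun_compose tendsto_add tendsto_scaleR lim off)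
qed

section \<open>Conjugation by isometries\<close>

definition isometry :: "('a::complex_hilbert \<Rightarrow>\<^sub>L 'b::complex_hilbert) \<Rightarrow> bool" where
  "isometry j \<longleftrightarrow> clinear_blinfun j \<and> (\<forall>v. norm (j v) = norm v)"

lemma isometry_norm: "isometry j \<Longrightarrow> norm (j v) = norm v"
  by (simp add: isometry_def)

lemma isometry_clinear: "isometry j \<Longrightarrow> clinear_blinfun j"
  by (simp add: isometry_def)

lemma isometry_adj_cancel: "isometry j \<Longrightarrow> adj j (j v) = v"
  by (simp add: isometry_def isometry_adj_apply)

lemma isometry_compose: "isometry j \<Longrightarrow> isometry k \<Longrightarrow> isometry (j o\<^sub>L k)"
  by (simp add: isometry_def clinear_blinfun_compose)

lemma isometry_of_unitary: "unitary_onto S u \<Longrightarrow> isometry u"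
  by (simp add: isometry_def unitary_onto_def)

text \<open>\<open>j G j\<^sup>* + (1 - j j\<^sup>*)\<close>: the operator \<open>G\<close> transported to the range of \<open>j\<close> and stabilized there.\<close>

definition conj_iso :: "('a::complex_hilbert \<Rightarrow>\<^sub>L 'b::complex_hilbert) \<Rightarrow> ('a \<Rightarrow>\<^sub>L 'a) \<Rightarrow> 'b \<Rightarrow>\<^sub>L 'b" where
  "conj_iso j G = id_blinfun + (j o\<^sub>L (G - id_blinfun) o\<^sub>L adj j)"

lemma conj_iso_apply: "conj_iso j G v = v - j (adj j v) + j (G (adj j v))"
  by (simp add: conj_iso_def blinfun.add_left blinfun.diff_left blinfun.diff_right)

lemma conj_iso_id [simp]: "conj_iso id_blinfun G = G"
  by (rule blinfun_eqI) (simp add: conj_iso_apply)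

lemma conj_iso_1 [simp]: "conj_iso j id_blinfun = id_blinfun"
  by (rule blinfun_eqI) (simp add: conj_iso_apply)

lemma conj_iso_compose: "isometry j \<Longrightarrow> conj_iso j (conj_iso k G) = conj_iso (j o\<^sub>L k) G"
  by (rule blinfun_eqI)
    (simp add: conj_iso_apply adj_compose blinfun.add_right blinfun.diff_right)

lemma conj_iso_mult: "isometry j \<Longrightarrow> conj_iso j G o\<^sub>L conj_iso j H = conj_iso j (G o\<^sub>L H)"
  by (rule blinfun_eqI)
    (simp add: conj_iso_apply blinfun.add_right blinfun.diff_right isometry_adj_cancel)

lemma adj_conj_iso: "adj (conj_iso j G) = conj_iso j (adj G)"
  by (rule blinfun_eqI) (simp add: conj_iso_def adj_add adj_diff adj_compose blinfun.add_left blinfun.diff_left)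

lemma tendsto_conj_iso [tendsto_intros]:
  "(j \<longlongrightarrow> j0) F \<Longrightarrow> (G \<longlongrightarrow> G0) F \<Longrightarrow> ((\<lambda>x. conj_iso (j x) (G x)) \<longlongrightarrow> conj_iso j0 G0) F"
  unfolding conj_iso_def by (intro tendsto_intros)

lemma unitary_conj_iso:
  assumes "isometry j" "unitary_onto UNIV u"
  shows "unitary_onto UNIV (conj_iso j u)"
proof -
  have "clinear_blinfun (conj_iso j u)"
    unfolding conj_iso_def
    by (intro clinear_blinfun_add clinear_blinfun_compose clinear_blinfun_diff clinear_blinfun_adj
        isometry_clinear assms unitary_clinear clinear_blinfun_id)
  then show ?thesis
    using assms by (simp add: unitary_onto_UNIV_iff adj_conj_iso conj_iso_mult)
qed

text \<open>Adding 1 gives \<open>u + 1\<close> on the range of \<open>j\<close> and 2 on its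
  complement, whence the constant \<open>min e 2\<close>.\<close>

lemma conj_iso_in_UF:
  assumes j: "isometry j" and u: "u \<in> UF"
  shows "conj_iso j u \<in> UF"
proof -
  obtain e B where e: "0 < e" "finite B"
    and B: "\<And>v. (\<forall>b\<in>B. inner v b = 0) \<Longrightarrow> e * norm v \<le> norm ((u + id_blinfun) v)"
    using u unfolding UF_iff essentially_bounded_below_def by blast
  have "min e 2 * norm v \<le> norm ((conj_iso j u + id_blinfun) v)" if v: "\<forall>b\<in>j ` B. inner v b = 0" for v
  proof -
    define a where "a = adj j v"
    define b where "b = v - j a"
    have orth: "inner b (j x) = 0" for x
      by (simp add: b_def a_def inner_diff_left isometry_inner[OF isometry_norm[OF j]] inner_adj_left)
    have "\<forall>b\<in>B. inner a b = 0" using v by (simp add: a_def inner_adj_left)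
    then have "e * norm a \<le> norm ((u + id_blinfun) a)" by (rule B)
    then have "min e 2 * norm a \<le> norm ((u + id_blinfun) a)"
      by (meson min.cobounded1 mult_right_mono norm_ge_zero order_trans)
    then have 1: "(min e 2 * norm a)\<^sup>2 \<le> (norm ((u + id_blinfun) a))\<^sup>2"
      using e(1) by (intro power_mono) auto
    have "(conj_iso j u + id_blinfun) v = 2 *\<^sub>R b + j ((u + id_blinfun) a)"
      by (simp add: conj_iso_apply blinfun.add_left blinfun.add_right b_def a_def scaleR_2)
    then have 2: "(norm ((conj_iso j u + id_blinfun) v))\<^sup>2 = (2 * norm b)\<^sup>2 + (norm ((u + id_blinfun) a))\<^sup>2"
      using orth[of "(u + id_blinfun) a"] isometry_norm[OF j, of "(u + id_blinfun) a"]
      by (simp add: power2_norm_eq_inner[symmetric] norm_add_scaleR_square[of _ 1, simplified] power_mult_distrib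
          del: blinfun.add_left)
    have "v = b + j a" by (simp add: b_def)
    then have 3: "(norm v)\<^sup>2 = (norm b)\<^sup>2 + (norm a)\<^sup>2"
      using norm_add_scaleR_square[of b 1 "j a"] orth[of a] isometry_norm[OF j, of a] by simp
    have "(min e 2 * norm b)\<^sup>2 \<le> (2 * norm b)\<^sup>2"
      using e(1) by (intro power_mono mult_right_mono) auto
    then have "(min e 2 * norm v)\<^sup>2 \<le> (norm ((conj_iso j u + id_blinfun) v))\<^sup>2"
      using 1 2 3 by (simp add: power_mult_distrib distrib_left)
    then show ?thesis by (rule power2_le_imp_le) simp
  qed
  then have "essentially_bounded_below (min e 2) (conj_iso j u + id_blinfun)"
    unfolding essentially_bounded_below_def using e(2) by blast
  moreover have "0 < min e 2" using e(1) by simp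
  ultimately show ?thesis using unitary_conj_iso[OF j] u unfolding UF_iff by blast
qed


section \<open>Homotopies in the Fredholm class\<close>

abbreviation UF_homotopic ::
    "'x topology \<Rightarrow> ('x \<Rightarrow> 'a::complex_hilbert \<Rightarrow>\<^sub>L 'a) \<Rightarrow> ('x \<Rightarrow> 'a \<Rightarrow>\<^sub>L 'a) \<Rightarrow> bool" where
  "UF_homotopic X \<equiv> homotopic_with (\<lambda>_. True) X (top_of_set UF)"

abbreviation cylinder :: "'x topology \<Rightarrow> (real \<times> 'x) topology" where
  "cylinder X \<equiv> prod_topology (top_of_set {0..1}) X"

lemma continuous_map_tendsto:
  "continuous_map X euclidean f \<Longrightarrow> x \<in> topspace X \<Longrightarrow> (f \<longlongrightarrow> f x) (atin X x)"
  by (simp add: continuous_map_atin)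

lemma eventually_atin_topspace: "eventually (\<lambda>x. x \<in> topspace X) (atin X a)"
  unfolding eventually_atin by (intro disjCI exI[of _ "topspace X"]) auto

lemma continuous_map_UF_iff:
  "continuous_map X (top_of_set UF) f \<longleftrightarrow> continuous_map X euclidean f \<and> (\<forall>x\<in>topspace X. f x \<in> UF)"
  by (auto simp: continuous_map_in_subtopology)

lemma cylinder_tendsto:
  assumes "p \<in> topspace (cylinder X)"
  shows "(fst \<longlongrightarrow> fst p) (atin (cylinder X) p)"
    and "continuous_map X euclidean f \<Longrightarrow> ((\<lambda>q. f (snd q)) \<longlongrightarrow> f (snd p)) (atin (cylinder X) p)"
    and "continuous_on {0..1} g \<Longrightarrow> ((\<lambda>q. g (fst q)) \<longlongrightarrow> g (fst p)) (atin (cylinder X) p)"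
proof -
  have 1: "continuous_map (cylinder X) (top_of_set {0..1}) fst" by (rule continuous_map_fst)
  then have "continuous_map (cylinder X) euclidean fst" by (simp add: continuous_map_in_subtopology)
  then show "(fst \<longlongrightarrow> fst p) (atin (cylinder X) p)" using assms by (rule continuous_map_tendsto)
  show "((\<lambda>q. f (snd q)) \<longlongrightarrow> f (snd p)) (atin (cylinder X) p)" if "continuous_map X euclidean f"
    using continuous_map_tendsto[OF continuous_map_compose[OF continuous_map_snd that] assms]
    by (simp add: comp_def)
  show "((\<lambda>q. g (fst q)) \<longlongrightarrow> g (fst p)) (atin (cylinder X) p)" if "continuous_on {0..1} g"
    using continuous_map_tendsto[OF continuous_map_compose[OF 1, of euclidean g] assms] that
    by (simp add: comp_def)
qed

lemma eventually_cylinder: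
  "eventually (\<lambda>q. 0 \<le> fst q \<and> fst q \<le> 1 \<and> snd q \<in> topspace X) (atin (cylinder X) p)"
  by (rule eventually_mono[OF eventually_atin_topspace]) auto

text \<open>Continuity on the cylinder is reduced to limits at its points, so that the limit rules
  for operators apply over any \<open>X\<close>.\<close>

lemma UF_homotopicI:
  assumes UF: "\<And>t x. 0 \<le> t \<Longrightarrow> t \<le> 1 \<Longrightarrow> x \<in> topspace X \<Longrightarrow> h t x \<in> UF"
    and lim: "\<And>p. p \<in> topspace (cylinder X) \<Longrightarrow>
      ((\<lambda>q. h (fst q) (snd q)) \<longlongrightarrow> h (fst p) (snd p)) (atin (cylinder X) p)"
    and ends: "\<And>x. x \<in> topspace X \<Longrightarrow> h 0 x = f x" "\<And>x. x \<in> topspace X \<Longrightarrow> h 1 x = g x"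
  shows "UF_homotopic X f g"
proof (subst homotopic_with)
  have "continuous_map (cylinder X) (top_of_set UF) (\<lambda>q. h (fst q) (snd q))"
    unfolding continuous_map_UF_iff using UF lim by (auto simp: continuous_map_atin)
  then show "\<exists>h. continuous_map (cylinder X) (top_of_set UF) h \<and>
      (\<forall>x\<in>topspace X. h (0, x) = f x) \<and> (\<forall>x\<in>topspace X. h (1, x) = g x) \<and> (\<forall>t\<in>{0..1}. True)"
    using ends by (intro exI[of _ "\<lambda>q. h (fst q) (snd q)"]) auto
qed simp

lemma UF_homotopic_conj_iso:
  assumes j: "isometry j" and "UF_homotopic X f g"
  shows "UF_homotopic X (\<lambda>x. conj_iso j (f x)) (\<lambda>x. conj_iso j (g x))"
proof -
  have "continuous_on UF (conj_iso j)"
    unfolding continuous_on_def by (intro ballI tendsto_conj_iso tendsto_const tendsto_ident_at)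
  then have "continuous_map (top_of_set UF) (top_of_set UF) (conj_iso j)"
    using conj_iso_in_UF[OF j] by (auto simp: continuous_map_in_subtopology)
  from homotopic_with_compose_continuous_map_left[OF assms(2) this, of "\<lambda>_. True"]
  show ?thesis by (simp add: comp_def)
qed

text \<open>Finite rank holds at the end of the deformation, and the finite set \<open>C\<close>
  depends on \<open>x\<close> without any continuity. This is enough because later limits use it at
  the limit point only.\<close>

lemma finite_rank_deformation:
  assumes F: "continuous_map X (top_of_set UF) F"
  obtains G where "UF_homotopic X F G"
    "\<And>x. x \<in> topspace X \<Longrightarrow> \<exists>C. finite C \<and> (\<forall>v. (\<forall>c\<in>C. inner v c = 0) \<longrightarrow> G x v = v)"
proof -
  \<comment> \<open>A quarter of the margin makes \<open>2 * d x\<close> half of it, strictly below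
    the margin, so some essential lower bound exceeds \<open>2 * d x\<close>.\<close>
  define d where "d x = fredholm_margin (F x) / 4" for x
  have Fc: "continuous_map X euclidean F" and FU: "\<And>x. x \<in> topspace X \<Longrightarrow> F x \<in> UF"
    using F by (auto simp: continuous_map_UF_iff)
  have unit: "unitary_onto UNIV (F x)" if "x \<in> topspace X" for x using FU[OF that] by (simp add: UF_iff)
  have d: "0 < d x" "d x \<le> 1" if "x \<in> topspace X" for x
    using fredholm_margin_pos[OF FU[OF that]] fredholm_margin_le_1[of "F x"] by (auto simp: d_def)
  have dc: "continuous_map X euclidean d"
    unfolding continuous_map_atin limitin_canonical_iff d_def
    by (intro ballI tendsto_divide tendsto_const tendsto_fredholm_margin continuous_map_tendsto[OF Fc]) simp_all
  have ebb: "\<exists>e>2 * d x. essentially_bounded_below e (F x + id_blinfun)" if "x \<in> topspace X" for x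
    using fredholm_margin_less[of "2 * d x" "F x"] d(1)[OF that] by (simp add: d_def)
  define G where "G x = contract_unitary (F x) (d x) 1" for x
  have "UF_homotopic X F G"
  proof (rule UF_homotopicI)
    fix t x assume t: "0 \<le> t" "t \<le> (1::real)" and x: "x \<in> topspace X"
    obtain e where "e > 2 * d x" "essentially_bounded_below e (F x + id_blinfun)" using ebb[OF x] by blast
    then show "contract_unitary (F x) (d x) t \<in> UF"
      using d[OF x] by (intro contract_unitary_in_UF[of _ _ t e] unit x t) auto
  next
    fix p :: "real \<times> 'a" assume p: "p \<in> topspace (cylinder X)"
    show "((\<lambda>q. contract_unitary (F (snd q)) (d (snd q)) (fst q)) \<longlongrightarrow>
        contract_unitary (F (snd p)) (d (snd p)) (fst p)) (atin (cylinder X) p)"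
    proof (rule tendsto_contract_unitary)
      show "eventually (\<lambda>q. unitary_onto UNIV (F (snd q)) \<and> 0 < d (snd q) \<and> d (snd q) \<le> 1 \<and>
          0 \<le> fst q \<and> fst q \<le> 1) (atin (cylinder X) p)"
        using eventually_cylinder by (rule eventually_mono) (auto intro: unit d)
    qed (use p in \<open>auto intro!: cylinder_tendsto Fc dc unit d\<close>)
  next
    fix x assume x: "x \<in> topspace X"
    show "contract_unitary (F x) (d x) 0 = F x" by (rule contract_unitary_0[OF unit[OF x] d[OF x]])
  qed (simp add: G_def)
  moreover have "\<exists>C. finite C \<and> (\<forall>v. (\<forall>c\<in>C. inner v c = 0) \<longrightarrow> G x v = v)" if x: "x \<in> topspace X" for x
    using ebb[OF x] contract_unitary_1_finite[OF unit[OF x] d[OF x]] unfolding G_def by blast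
  ultimately show ?thesis by (rule that)
qed

text \<open>\<open>D\<close> has finite rank, so strong convergence on the finitely many vectors
  \<open>D b\<close> controls the operator norm.\<close>

lemma tendsto_compose_finite_rank:
  fixes S :: "'x \<Rightarrow> 'a::real_inner \<Rightarrow>\<^sub>L 'b::real_normed_vector" and S0 :: "'a \<Rightarrow>\<^sub>L 'b" and D :: "'c::real_inner \<Rightarrow>\<^sub>L 'a"
  assumes lim: "\<And>v. ((\<lambda>x. S x v) \<longlongrightarrow> S0 v) F"
    and C: "finite C" "\<And>v. (\<forall>c\<in>C. inner v c = 0) \<Longrightarrow> D v = 0"
  shows "((\<lambda>x. S x o\<^sub>L D) \<longlongrightarrow> S0 o\<^sub>L D) F"
proof -
  \<comment> \<open>\<open>B\<close> is orthogonal but not normalized and may contain 0; the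
    coefficients are therefore quotients, equal to 0 for \<open>b = 0\<close>.\<close>
  obtain B where B: "finite B" "span B = span C" "pairwise orthogonal B"
    using basis_orthogonal[OF C(1)] by blast
  have D: "D v = (\<Sum>b\<in>B. (inner v b / inner b b) *\<^sub>R D b)" for v
  proof -
    define w where "w = v - (\<Sum>b\<in>B. (inner v b / inner b b) *\<^sub>R b)"
    have wB: "inner w b = 0" if b: "b \<in> B" for b
    proof -
      have "(\<Sum>c\<in>B. (inner v c / inner c c) * inner c b) = (\<Sum>c\<in>{b}. (inner v c / inner c c) * inner c b)"
        using B(1,3) b by (intro sum.mono_neutral_right) (auto simp: pairwise_def orthogonal_def)
      then show ?thesis by (cases "b = 0") (simp_all add: w_def inner_diff_left inner_sum_left)
    qed
    have "span B \<subseteq> {x. inner w x = 0}"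
      by (rule span_minimal) (use wB in \<open>auto simp: subspace_def inner_add_right\<close>)
    then have "\<forall>c\<in>C. inner w c = 0" using B(2) span_base by blast
    then have "D w = 0" by (rule C(2))
    then show ?thesis by (simp add: w_def blinfun.diff_right blinfun.sum_right blinfun.scaleR_right)
  qed
  define m where "m x = (\<Sum>b\<in>B. norm (S x (D b) - S0 (D b)) / norm b)" for x
  have "(m \<longlongrightarrow> (\<Sum>b\<in>B. norm (S0 (D b) - S0 (D b)) / norm b)) F"
    unfolding m_def divide_inverse by (intro tendsto_sum tendsto_mult tendsto_norm tendsto_diff tendsto_const lim)
  then have m0: "(m \<longlongrightarrow> 0) F" by simp
  have bound: "norm ((S x o\<^sub>L D) - (S0 o\<^sub>L D)) \<le> m x" for x
  proof (rule norm_blinfun_bound)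
    show "0 \<le> m x" by (auto simp: m_def intro!: sum_nonneg)
    fix v
    have "((S x o\<^sub>L D) - (S0 o\<^sub>L D)) v = (\<Sum>b\<in>B. (inner v b / inner b b) *\<^sub>R (S x (D b) - S0 (D b)))"
      by (simp add: blinfun.diff_left, subst (1 2) D)
        (simp add: blinfun.sum_right blinfun.scaleR_right sum_subtractf real_vector.scale_right_diff_distrib)
    also have "norm \<dots> \<le> (\<Sum>b\<in>B. norm (S x (D b) - S0 (D b)) / norm b * norm v)"
    proof (rule sum_norm_le)
      fix b
      have "\<bar>inner v b / inner b b\<bar> \<le> norm v / norm b"
      proof (cases "b = 0")
        case False
        have "\<bar>inner v b\<bar> \<le> norm v * norm b" by (rule Cauchy_Schwarz_ineq2)
        then show ?thesis
          using False by (simp add: power2_norm_eq_inner[symmetric] power2_eq_square field_simps)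
      qed simp
      then have "\<bar>inner v b / inner b b\<bar> * norm (S x (D b) - S0 (D b)) \<le> norm v / norm b * norm (S x (D b) - S0 (D b))"
        by (rule mult_right_mono) simp
      then show "norm ((inner v b / inner b b) *\<^sub>R (S x (D b) - S0 (D b))) \<le> norm (S x (D b) - S0 (D b)) / norm b * norm v"
        by (simp add: mult.commute)
    qed
    finally show "norm (((S x o\<^sub>L D) - (S0 o\<^sub>L D)) v) \<le> m x * norm v"
      by (simp add: m_def sum_distrib_right)
  qed
  have "((\<lambda>x. (S x o\<^sub>L D) - (S0 o\<^sub>L D)) \<longlongrightarrow> 0) F"
    by (rule Lim_null_comparison[OF _ m0]) (simp add: bound)
  then show ?thesis by (rule LIM_zero_cancel)
qed

lemma norm_isometry_le: "isometry s \<Longrightarrow> norm s \<le> 1"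
  by (rule norm_blinfun_bound) (simp_all add: isometry_norm)

lemma norm_compose_isometry_left: "isometry s \<Longrightarrow> norm (s o\<^sub>L T) \<le> norm T"
  using norm_blinfun_compose[of s T] mult_right_mono[OF norm_isometry_le, of s "norm T"] by simp

lemma norm_compose_isometry_adj: "isometry s \<Longrightarrow> norm (T o\<^sub>L adj s) \<le> norm T"
  using norm_blinfun_compose[of T "adj s"] mult_left_mono[of "norm (adj s)" 1 "norm T"]
    norm_adj_le[of s] norm_isometry_le[of s] by simp

text \<open>With \<open>D = G0 - id_blinfun\<close> the difference splits into the change of
  \<open>G\<close>, the change of \<open>s\<close> and the change of its adjoint. Strong convergence
  does not pass to adjoints, so the last term is written as the adjoint of the change of
  \<open>s x o\<^sub>L adj D\<close>, where \<open>adj D\<close> has finite rank as well.\<close>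

lemma tendsto_conj_iso_strong:
  fixes G :: "'x \<Rightarrow> 'a::complex_hilbert \<Rightarrow>\<^sub>L 'a" and s :: "'x \<Rightarrow> 'a \<Rightarrow>\<^sub>L 'b::complex_hilbert"
    and s0 :: "'a \<Rightarrow>\<^sub>L 'b"
  assumes s: "eventually (\<lambda>x. isometry (s x)) F" "isometry s0"
    and strong: "\<And>v. ((\<lambda>x. s x v) \<longlongrightarrow> s0 v) F"
    and G: "(G \<longlongrightarrow> G0) F" and G0: "unitary_onto UNIV G0"
    and C: "finite C" "\<And>v. (\<forall>c\<in>C. inner v c = 0) \<Longrightarrow> G0 v = v"
  shows "((\<lambda>x. conj_iso (s x) (G x)) \<longlongrightarrow> conj_iso s0 G0) F"
proof -
  define D where "D = G0 - id_blinfun"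
  have D: "D v = 0" "adj D v = 0" if "\<forall>c\<in>C. inner v c = 0" for v
    using C(2)[OF that] unitary_adj_left[OF G0, of v] by (simp_all add: D_def adj_diff blinfun.diff_left)
  have l1: "((\<lambda>x. s x o\<^sub>L D) \<longlongrightarrow> s0 o\<^sub>L D) F" by (rule tendsto_compose_finite_rank[OF strong C(1) D(1)])
  have l2: "((\<lambda>x. s x o\<^sub>L adj D) \<longlongrightarrow> s0 o\<^sub>L adj D) F" by (rule tendsto_compose_finite_rank[OF strong C(1) D(2)])
  define m where "m x = norm (G x - G0) + norm ((s x o\<^sub>L D) - (s0 o\<^sub>L D)) + norm ((s x o\<^sub>L adj D) - (s0 o\<^sub>L adj D))" for x
  have "(m \<longlongrightarrow> norm (G0 - G0) + norm ((s0 o\<^sub>L D) - (s0 o\<^sub>L D)) + norm ((s0 o\<^sub>L adj D) - (s0 o\<^sub>L adj D))) F"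
    unfolding m_def by (intro tendsto_add tendsto_norm tendsto_diff tendsto_const G l1 l2)
  then have m0: "(m \<longlongrightarrow> 0) F" by simp
  have "eventually (\<lambda>x. norm (conj_iso (s x) (G x) - conj_iso s0 G0) \<le> m x) F"
    using s(1)
  proof eventually_elim
    case (elim x)
    have eq: "conj_iso (s x) (G x) - conj_iso s0 G0 = (s x o\<^sub>L ((G x - G0) o\<^sub>L adj (s x))) +
        (((s x o\<^sub>L D) - (s0 o\<^sub>L D)) o\<^sub>L adj (s x)) + (s0 o\<^sub>L adj ((s x o\<^sub>L adj D) - (s0 o\<^sub>L adj D)))"
      by (rule blinfun_eqI)
        (simp add: conj_iso_apply D_def adj_diff adj_compose blinfun.add_left blinfun.diff_left
          blinfun.diff_right blinfun.add_right)
    have "norm (s x o\<^sub>L ((G x - G0) o\<^sub>L adj (s x))) \<le> norm (G x - G0)"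
      by (rule order_trans[OF norm_compose_isometry_left[OF elim] norm_compose_isometry_adj[OF elim]])
    moreover have "norm (((s x o\<^sub>L D) - (s0 o\<^sub>L D)) o\<^sub>L adj (s x)) \<le> norm ((s x o\<^sub>L D) - (s0 o\<^sub>L D))"
      by (rule norm_compose_isometry_adj[OF elim])
    moreover have "norm (s0 o\<^sub>L adj ((s x o\<^sub>L adj D) - (s0 o\<^sub>L adj D))) \<le> norm ((s x o\<^sub>L adj D) - (s0 o\<^sub>L adj D))"
      by (rule order_trans[OF norm_compose_isometry_left[OF s(2)] norm_adj_le])
    ultimately show ?case
      unfolding eq m_def by (meson add_mono norm_triangle_ineq order_trans)
  qed
  then have "((\<lambda>x. conj_iso (s x) (G x) - conj_iso s0 G0) \<longlongrightarrow> 0) F"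
    by (rule Lim_null_comparison[OF _ m0])
  then show ?thesis by (rule LIM_zero_cancel)
qed

text \<open>The path of isometries is only strongly continuous. Conjugation with it is norm continuous on
  the finite rank perturbations of the identity, which is why the family is deformed first.\<close>

lemma UF_homotopic_strong_path:
  fixes s :: "real \<Rightarrow> 'a::complex_hilbert \<Rightarrow>\<^sub>L 'a"
  assumes s: "\<And>t. 0 \<le> t \<Longrightarrow> t \<le> 1 \<Longrightarrow> isometry (s t)" "s 0 = id_blinfun"
    and strong: "\<And>v. continuous_on {0..1} (\<lambda>t. s t v)"
    and F: "continuous_map X (top_of_set UF) F"
  shows "UF_homotopic X F (\<lambda>x. conj_iso (s 1) (F x))"
proof -
  obtain G where G: "UF_homotopic X F G"
    "\<And>x. x \<in> topspace X \<Longrightarrow> \<exists>C. finite C \<and> (\<forall>v. (\<forall>c\<in>C. inner v c = 0) \<longrightarrow> G x v = v)"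
    using finite_rank_deformation[OF F] by blast
  have "continuous_map X (top_of_set UF) G" using G(1) homotopic_with_imp_continuous_maps by blast
  then have Gc: "continuous_map X euclidean G" and GU: "\<And>x. x \<in> topspace X \<Longrightarrow> G x \<in> UF"
    by (auto simp: continuous_map_UF_iff)
  have "UF_homotopic X G (\<lambda>x. conj_iso (s 1) (G x))"
  proof (rule UF_homotopicI[where h="\<lambda>t x. conj_iso (s t) (G x)"])
    show "conj_iso (s t) (G x) \<in> UF" if "0 \<le> t" "t \<le> 1" "x \<in> topspace X" for t x
      using that by (intro conj_iso_in_UF s GU)
    show "conj_iso (s 0) (G x) = G x" for x by (simp add: s)
    fix p :: "real \<times> 'b" assume p: "p \<in> topspace (cylinder X)"
    then have p': "0 \<le> fst p" "fst p \<le> 1" "snd p \<in> topspace X" by auto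
    obtain C where C: "finite C" "\<forall>v. (\<forall>c\<in>C. inner v c = 0) \<longrightarrow> G (snd p) v = v" using G(2)[OF p'(3)] by blast
    show "((\<lambda>q. conj_iso (s (fst q)) (G (snd q))) \<longlongrightarrow> conj_iso (s (fst p)) (G (snd p))) (atin (cylinder X) p)"
    proof (rule tendsto_conj_iso_strong)
      show "eventually (\<lambda>q. isometry (s (fst q))) (atin (cylinder X) p)"
        using eventually_cylinder by (rule eventually_mono) (auto intro: s)
      show "unitary_onto UNIV (G (snd p))" using GU[OF p'(3)] by (simp add: UF_iff)
      show "finite C" "\<And>v. (\<forall>c\<in>C. inner v c = 0) \<Longrightarrow> G (snd p) v = v" using C by auto
      show "((\<lambda>q. s (fst q) v) \<longlongrightarrow> s (fst p) v) (atin (cylinder X) p)" for v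
        by (rule cylinder_tendsto(3)[OF p strong])
    qed (use p p' in \<open>auto intro!: cylinder_tendsto(2) Gc s\<close>)
  qed simp
  moreover have "UF_homotopic X (\<lambda>x. conj_iso (s 1) (G x)) (\<lambda>x. conj_iso (s 1) (F x))"
    by (rule UF_homotopic_conj_iso[OF _ homotopic_with_symD[OF G(1)]]) (simp add: s)
  ultimately show ?thesis using G(1) homotopic_with_trans by blast
qed

lemma UF_homotopic_norm_path:
  assumes F: "continuous_map X (top_of_set UF) F"
    and j: "\<And>t x. 0 \<le> t \<Longrightarrow> t \<le> 1 \<Longrightarrow> x \<in> topspace X \<Longrightarrow> isometry (j t x)"
    and lim: "\<And>p. p \<in> topspace (cylinder X) \<Longrightarrow>
      ((\<lambda>q. j (fst q) (snd q)) \<longlongrightarrow> j (fst p) (snd p)) (atin (cylinder X) p)"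
  shows "UF_homotopic X (\<lambda>x. conj_iso (j 0 x) (F x)) (\<lambda>x. conj_iso (j 1 x) (F x))"
proof (rule UF_homotopicI[where h="\<lambda>t x. conj_iso (j t x) (F x)"])
  have Fc: "continuous_map X euclidean F" and FU: "\<And>x. x \<in> topspace X \<Longrightarrow> F x \<in> UF"
    using F by (auto simp: continuous_map_UF_iff)
  show "conj_iso (j t x) (F x) \<in> UF" if "0 \<le> t" "t \<le> 1" "x \<in> topspace X" for t x
    using that by (intro conj_iso_in_UF j FU)
  show "((\<lambda>q. conj_iso (j (fst q) (snd q)) (F (snd q))) \<longlongrightarrow> conj_iso (j (fst p) (snd p)) (F (snd p)))
      (atin (cylinder X) p)" if p: "p \<in> topspace (cylinder X)" for p
    by (intro tendsto_conj_iso lim cylinder_tendsto(2) p Fc)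
qed simp_all

text \<open>Two isometries with orthogonal ranges are joined by the norm continuous path
  \<open>cos \<theta> j + sin \<theta> r\<close>, so conjugation with \<open>s g\<inverse>\<close> can be moved to conjugation with \<open>r\<close> and back to \<open>s\<close>.\<close>

lemma UF_homotopic_orthogonal_isometries:
  fixes F :: "'x \<Rightarrow> 'a::complex_hilbert \<Rightarrow>\<^sub>L 'a" and r :: "'a \<Rightarrow>\<^sub>L 'b::complex_hilbert" and j :: "'x \<Rightarrow> 'a \<Rightarrow>\<^sub>L 'b"
  assumes F: "continuous_map X (top_of_set UF) F"
    and j: "continuous_map X euclidean j" "\<And>x. x \<in> topspace X \<Longrightarrow> isometry (j x)"
    and r: "isometry r" and orth: "\<And>x v w. x \<in> topspace X \<Longrightarrow> inner (j x v) (r w) = 0"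
  shows "UF_homotopic X (\<lambda>x. conj_iso (j x) (F x)) (\<lambda>x. conj_iso r (F x))"
proof -
  define k where "k t x = cos (pi / 2 * t) *\<^sub>R j x + sin (pi / 2 * t) *\<^sub>R r" for t x
  have "UF_homotopic X (\<lambda>x. conj_iso (k 0 x) (F x)) (\<lambda>x. conj_iso (k 1 x) (F x))"
  proof (rule UF_homotopic_norm_path[OF F])
    fix t :: real and x assume x: "x \<in> topspace X"
    have "(norm (k t x v))\<^sup>2 = (norm v)\<^sup>2" for v
    proof -
      have "(norm (k t x v))\<^sup>2 = (cos (pi / 2 * t))\<^sup>2 * (norm v)\<^sup>2 + (sin (pi / 2 * t))\<^sup>2 * (norm v)\<^sup>2"
        using norm_add_scaleR_square[of "cos (pi / 2 * t) *\<^sub>R j x v" "sin (pi / 2 * t)" "r v"]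
          orth[OF x, of v v] isometry_norm[OF r, of v] isometry_norm[OF j(2)[OF x], of v]
        by (simp add: k_def blinfun.add_left blinfun.scaleR_left power_mult_distrib)
      then show ?thesis by (simp add: distrib_right[symmetric])
    qed
    moreover have "clinear_blinfun (k t x)"
      unfolding k_def by (intro clinear_blinfun_add clinear_blinfun_scaleR isometry_clinear j x r)
    ultimately show "isometry (k t x)" by (simp add: isometry_def)
  next
    fix p :: "real \<times> 'x" assume p: "p \<in> topspace (cylinder X)"
    show "((\<lambda>q. k (fst q) (snd q)) \<longlongrightarrow> k (fst p) (snd p)) (atin (cylinder X) p)"
    proof -
      have "continuous_on {0..1} (\<lambda>t. cos (pi / 2 * t))" "continuous_on {0..1} (\<lambda>t. sin (pi / 2 * t))"
        by (intro continuous_intros)+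
      then show ?thesis
        unfolding k_def
        by (intro tendsto_add tendsto_scaleR tendsto_const cylinder_tendsto(2)[OF p j(1)]
            cylinder_tendsto(3)[OF p, where g="\<lambda>t. cos (pi / 2 * t)"]
            cylinder_tendsto(3)[OF p, where g="\<lambda>t. sin (pi / 2 * t)"])
    qed
  qed
  then show ?thesis by (simp add: k_def)
qed

section \<open>Orthonormal bases and isometries\<close>

definition orthonormal :: "(nat \<Rightarrow> 'a::complex_hilbert) \<Rightarrow> bool" where
  "orthonormal b \<longleftrightarrow> (\<forall>m n. cinner (b m) (b n) = (if m = n then 1 else 0))"

definition orthonormal_basis :: "(nat \<Rightarrow> 'a::complex_hilbert) \<Rightarrow> bool" where
  "orthonormal_basis e \<longleftrightarrow> orthonormal e \<and> (\<forall>v. (\<forall>n. cinner v (e n) = 0) \<longrightarrow> v = 0)"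

lemma cinner_self: "cinner v v = complex_of_real ((norm v)\<^sup>2)" for v :: "'a::complex_hilbert"
  by (simp add: cinner_eq complex_eq_iff power2_norm_eq_inner)

lemma cinner_sum_left: "cinner (\<Sum>i\<in>A. f i) y = (\<Sum>i\<in>A. cinner (f i) (y :: 'a::complex_hilbert))"
  by (induction A rule: infinite_finite_induct) (simp_all add: cinner_add_left)

lemma cinner_sum_right: "cinner y (\<Sum>i\<in>A. f i) = (\<Sum>i\<in>A. cinner (y :: 'a::complex_hilbert) (f i))"
  by (induction A rule: infinite_finite_induct) (simp_all add: cinner_add_right)

text \<open>A maximal orthonormal set is infinite, as otherwise it would span. It is countable
  because distinct members are at distance \<open>sqrt 2\<close> and so cannot both be within 1/2 of
  one point of a countable dense set.\<close>

lemma exists_orthonormal_basis: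
  assumes sep: "separable_space (euclidean :: 'h::complex_hilbert topology)"
    and inf: "\<not> finite_cdim (UNIV :: 'h::complex_hilbert set)"
  obtains e :: "nat \<Rightarrow> 'h::complex_hilbert" where "orthonormal_basis e"
proof -
  define A where "A = {B :: 'h set. \<forall>x\<in>B. \<forall>y\<in>B. cinner x y = (if x = y then 1 else 0)}"
  have "\<exists>M\<in>A. \<forall>X\<in>A. M \<subseteq> X \<longrightarrow> X = M"
  proof (rule subset_Zorn')
    fix C assume C: "subset.chain A C"
    show "\<Union>C \<in> A"
      unfolding A_def
    proof (intro CollectI ballI)
      fix x y assume "x \<in> \<Union>C" "y \<in> \<Union>C"
      then obtain P Q where PQ: "x \<in> P" "P \<in> C" "y \<in> Q" "Q \<in> C" by blast
      then have "P \<subseteq> Q \<or> Q \<subseteq> P" using C unfolding subset.chain_def by blast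
      moreover have "P \<in> A" "Q \<in> A" using C PQ unfolding subset.chain_def by blast+
      ultimately show "cinner x y = (if x = y then 1 else 0)" using PQ unfolding A_def by blast
    qed
  qed
  then obtain B where B: "B \<in> A" "\<And>X. X \<in> A \<Longrightarrow> B \<subseteq> X \<Longrightarrow> X = B" by blast
  have on: "cinner x y = (if x = y then 1 else 0)" if "x \<in> B" "y \<in> B" for x y
    using B(1) that unfolding A_def by blast
  have total: "v = 0" if v: "\<And>b. b \<in> B \<Longrightarrow> cinner v b = 0" for v
  proof (rule ccontr)
    assume "v \<noteq> 0"
    define w where "w = complex_of_real (1 / norm v) *\<^sub>C v"
    have "norm w = 1" using \<open>v \<noteq> 0\<close> by (simp add: w_def norm_divide)
    then have w1: "cinner w w = 1" by (simp add: cinner_self)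
    have wb: "cinner w b = 0" if "b \<in> B" for b using v[OF that] by (simp add: w_def cinner_scaleC_left)
    have bw: "cinner b w = 0" if "b \<in> B" for b using wb[OF that] cinner_commute[of b w] by simp
    have "w \<notin> B" using wb w1 by fastforce
    moreover have "insert w B \<in> A"
      unfolding A_def using on w1 wb bw \<open>w \<notin> B\<close> by auto
    ultimately show False using B(2)[of "insert w B"] by blast
  qed
  have "infinite B"
  proof
    assume "finite B"
    have "v \<in> cspan B" for v
    proof -
      let ?w = "\<Sum>b\<in>B. cinner v b *\<^sub>C b"
      have "cinner (v - ?w) b = 0" if "b \<in> B" for b
      proof -
        have "(\<Sum>x\<in>B. cinner v x * cinner x b) = (\<Sum>x\<in>B. if x = b then cinner v b else 0)"
          using on that by (intro sum.cong) auto
        then show ?thesis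
          using that \<open>finite B\<close> by (simp add: cinner_diff_left cinner_sum_left cinner_scaleC_left)
      qed
      then have "v = ?w" using total[of "v - ?w"] by simp
      moreover have "?w \<in> cspan B"
        by (intro complex_vector.span_sum complex_vector.span_scale complex_vector.span_base)
      ultimately show ?thesis by simp
    qed
    then show False using inf \<open>finite B\<close> unfolding finite_cdim_def by blast
  qed
  have "countable B"
  proof -
    obtain U :: "'h set" where U: "countable U" "closure U = UNIV"
      using sep unfolding separable_space_def by auto
    have "\<exists>c\<in>U. dist c b < 1/2" for b
      using U(2) closure_approachable[of b U] by (metis UNIV_I half_gt_zero zero_less_one)
    then obtain c where c: "\<And>b. c b \<in> U \<and> dist (c b) b < 1/2" by metis
    have "inj_on c B"
    proof (rule inj_onI)
      fix x y assume xy: "x \<in> B" "y \<in> B" "c x = c y"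
      show "x = y"
      proof (rule ccontr)
        assume "x \<noteq> y"
        then have "cinner x y = 0" "cinner x x = 1" "cinner y y = 1" using on xy by auto
        then have "inner x y = 0" "inner x x = 1" "inner y y = 1" by (simp_all add: Re_cinner[symmetric])
        then have "(norm (x - y))\<^sup>2 = 2"
          by (simp add: power2_norm_eq_inner inner_diff_left inner_diff_right inner_commute)
        moreover have "norm (x - y) < 1"
          using c[of x] c[of y] xy(3) dist_triangle_half_r[of "c x" x 1 y] by (simp add: dist_norm)
        then have "(norm (x - y))\<^sup>2 < 1\<^sup>2" by (intro power_strict_mono) auto
        ultimately show False by simp
      qed
    qed
    moreover have "countable (c ` B)" using c by (intro countable_subset[OF _ U(1)]) auto
    ultimately show ?thesis by (metis countable_image_inj_on)
  qed
  define e where "e = from_nat_into B"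
  have bij: "bij_betw e UNIV B"
    unfolding e_def by (rule bij_betw_from_nat_into) (use \<open>countable B\<close> \<open>infinite B\<close> in auto)
  have eB: "e n \<in> B" for n using bij by (auto simp: bij_betw_def)
  have inj: "e m = e n \<longleftrightarrow> m = n" for m n using bij by (auto simp: bij_betw_def inj_eq)
  have surj: "\<exists>n. b = e n" if "b \<in> B" for b using bij that by (auto simp: bij_betw_def)
  have "orthonormal_basis e"
    unfolding orthonormal_basis_def orthonormal_def
    using on[OF eB eB] inj total surj by metis
  then show ?thesis by (rule that)
qed

section \<open>Fourier expansions and operators given on a basis\<close>

lemma orthonormal_cinner: "orthonormal b \<Longrightarrow> cinner (b m) (b n) = (if m = n then 1 else 0)"
  by (simp add: orthonormal_def)

lemma orthonormal_sum_norm: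
  assumes "orthonormal b" "finite A"
  shows "(norm (\<Sum>k\<in>A. c k *\<^sub>C b k))\<^sup>2 = (\<Sum>k\<in>A. (cmod (c k))\<^sup>2)"
proof -
  have "cinner (\<Sum>k\<in>A. c k *\<^sub>C b k) (\<Sum>k\<in>A. c k *\<^sub>C b k) = (\<Sum>k\<in>A. c k * cnj (c k))"
    using assms
    by (simp add: cinner_sum_left cinner_sum_right cinner_scaleC_left cinner_scaleC_right
        orthonormal_cinner if_distrib mult.commute cong: sum.cong if_cong)
  then have "complex_of_real ((norm (\<Sum>k\<in>A. c k *\<^sub>C b k))\<^sup>2) = complex_of_real (\<Sum>k\<in>A. (cmod (c k))\<^sup>2)"
    by (simp only: cinner_self of_real_sum complex_norm_square)
  then show ?thesis by (simp only: of_real_eq_iff)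
qed

lemma closed_csubspace_eq_UNIV:
  assumes e: "orthonormal_basis e" and S: "csubspace S" "closed S" "range e \<subseteq> S"
  shows "S = UNIV"
proof (rule closed_subspace_eq_UNIV[OF csubspace_imp_subspace[OF S(1)] S(2)])
  fix v assume v: "\<And>s. s \<in> S \<Longrightarrow> inner v s = 0"
  have "cinner v (e n) = 0" for n
  proof -
    have "e n \<in> S" using S(3) by blast
    moreover have "\<i> *\<^sub>C e n \<in> S" using \<open>e n \<in> S\<close> S(1) by (simp add: complex_vector.subspace_def)
    ultimately show ?thesis by (simp add: cinner_eq_0_iff v)
  qed
  then show "v = 0" using e unfolding orthonormal_basis_def by blast
qed

lemma csubspace_closure:
  assumes "csubspace S"
  shows "csubspace (closure S)"
proof (rule csubspaceI_i)
  have S: "subspace S" by (rule csubspace_imp_subspace[OF assms])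
  show "subspace (closure S)"
    unfolding subspace_def
  proof (intro conjI ballI allI)
    show "0 \<in> closure S" using S closure_subset subspace_0 by blast
    fix x y r assume "x \<in> closure S" "y \<in> closure S"
    then obtain f g where f: "\<And>n. f n \<in> S" "f \<longlonglongrightarrow> x" and g: "\<And>n. g n \<in> S" "g \<longlonglongrightarrow> y"
      unfolding closure_sequential by blast
    show "x + y \<in> closure S"
      unfolding closure_sequential
      by (intro exI[of _ "\<lambda>n. f n + g n"] conjI allI subspace_add S f g tendsto_add)
    show "r *\<^sub>R x \<in> closure S"
      unfolding closure_sequential
      by (intro exI[of _ "\<lambda>n. r *\<^sub>R f n"] conjI allI subspace_scale S f tendsto_scaleR tendsto_const)
  qed
  have "imul ` closure S \<subseteq> closure (imul ` S)"
    by (rule closure_bounded_linear_image_subset[OF blinfun.bounded_linear_right])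
  also have "imul ` S \<subseteq> S" using assms by (auto simp: complex_vector.subspace_def)
  then have "closure (imul ` S) \<subseteq> closure S" by (rule closure_mono)
  finally show "\<i> *\<^sub>C x \<in> closure S" if "x \<in> closure S" for x using that by auto
qed

context
  fixes e :: "nat \<Rightarrow> 'a::complex_hilbert"
  assumes e: "orthonormal_basis e"
begin

lemma basis_orthonormal: "orthonormal e"
  using e by (simp add: orthonormal_basis_def)

lemma Bessel: "(\<Sum>k<n. (cmod (cinner h (e k)))\<^sup>2) \<le> (norm h)\<^sup>2"
proof -
  let ?w = "\<Sum>k<n. cinner h (e k) *\<^sub>C e k"
  have "cinner h ?w = (\<Sum>k<n. complex_of_real ((cmod (cinner h (e k)))\<^sup>2))"
    by (simp only: cinner_sum_right cinner_scaleC_right complex_norm_square mult.commute)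
  then have "Re (cinner h ?w) = (\<Sum>k<n. (cmod (cinner h (e k)))\<^sup>2)" by simp
  then have hw: "inner h ?w = (\<Sum>k<n. (cmod (cinner h (e k)))\<^sup>2)" by (simp only: Re_cinner)
  have "0 \<le> (norm (h - ?w))\<^sup>2" by simp
  also have "(norm (h - ?w))\<^sup>2 = (norm h)\<^sup>2 - 2 * inner h ?w + (norm ?w)\<^sup>2"
    using norm_add_scaleR_square[of h "-1" ?w] by simp
  also have "\<dots> = (norm h)\<^sup>2 - (\<Sum>k<n. (cmod (cinner h (e k)))\<^sup>2)"
    unfolding hw orthonormal_sum_norm[OF basis_orthonormal finite_lessThan] by simp
  finally show ?thesis by simp
qed

lemma summable_coefficients: "summable (\<lambda>k. (cmod (cinner h (e k)))\<^sup>2)"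
  by (rule summableI_nonneg_bounded[OF _ Bessel]) simp

lemma summable_expansion:
  fixes b :: "nat \<Rightarrow> 'b::complex_hilbert"
  assumes b: "orthonormal b"
  shows "summable (\<lambda>k. cinner h (e k) *\<^sub>C b k)"
  unfolding summable_Cauchy
proof (intro allI impI)
  fix d :: real assume d: "0 < d"
  then have "0 < d\<^sup>2" by simp
  then obtain N where N: "\<And>m n. m \<ge> N \<Longrightarrow> norm (\<Sum>k=m..<n. (cmod (cinner h (e k)))\<^sup>2) < d\<^sup>2"
    using summable_coefficients[of h, unfolded summable_Cauchy] by blast
  have "norm (\<Sum>k=m..<n. cinner h (e k) *\<^sub>C b k) < d" if "m \<ge> N" for m n
  proof -
    have "(norm (\<Sum>k=m..<n. cinner h (e k) *\<^sub>C b k))\<^sup>2 < d\<^sup>2"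
      using N[OF that, of n] by (simp add: orthonormal_sum_norm[OF b] abs_of_nonneg sum_nonneg)
    then show ?thesis by (rule power_less_imp_less_base) (use d in simp)
  qed
  then show "\<exists>N. \<forall>m\<ge>N. \<forall>n. norm (\<Sum>k=m..<n. cinner h (e k) *\<^sub>C b k) < d" by blast
qed

lemma expansion_norm:
  fixes b :: "nat \<Rightarrow> 'b::complex_hilbert"
  assumes b: "orthonormal b"
  shows "(norm (\<Sum>k. cinner h (e k) *\<^sub>C b k))\<^sup>2 = (\<Sum>k. (cmod (cinner h (e k)))\<^sup>2)"
proof (rule LIMSEQ_unique)
  show "(\<lambda>n. (norm (\<Sum>k<n. cinner h (e k) *\<^sub>C b k))\<^sup>2) \<longlonglongrightarrow> (norm (\<Sum>k. cinner h (e k) *\<^sub>C b k))\<^sup>2"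
    by (intro tendsto_power tendsto_norm summable_LIMSEQ summable_expansion b)
  show "(\<lambda>n. (norm (\<Sum>k<n. cinner h (e k) *\<^sub>C b k))\<^sup>2) \<longlonglongrightarrow> (\<Sum>k. (cmod (cinner h (e k)))\<^sup>2)"
    unfolding orthonormal_sum_norm[OF b finite_lessThan]
    by (intro summable_LIMSEQ summable_coefficients)
qed

lemma expansion_self: "(\<Sum>k. cinner h (e k) *\<^sub>C e k) = h"
proof -
  let ?w = "\<Sum>k. cinner h (e k) *\<^sub>C e k"
  have lim: "(\<lambda>n. \<Sum>k<n. cinner h (e k) *\<^sub>C e k) \<longlonglongrightarrow> ?w"
    by (intro summable_LIMSEQ summable_expansion basis_orthonormal)
  have in_lim: "(\<lambda>n. inner (\<Sum>k<n. cinner h (e k) *\<^sub>C e k) y) \<longlonglongrightarrow> inner ?w y" for y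
    by (intro tendsto_inner lim tendsto_const)
  have coeff: "cinner (\<Sum>k<n. cinner h (e k) *\<^sub>C e k) (e j) = cinner h (e j)" if "n > j" for n j
    using that by (simp add: cinner_sum_left cinner_scaleC_left orthonormal_cinner[OF basis_orthonormal]
        if_distrib cong: if_cong)
  have "cinner (?w - h) (e j) = 0" for j
  proof -
    have ev: "inner (\<Sum>k<n. cinner h (e k) *\<^sub>C e k) (c *\<^sub>C e j) = inner h (c *\<^sub>C e j)" if "n > j" for n c
      unfolding Re_cinner[symmetric] cinner_scaleC_right coeff[OF that] ..
    have "inner ?w (c *\<^sub>C e j) = inner h (c *\<^sub>C e j)" for c
    proof (rule LIMSEQ_unique[OF in_lim])
      show "(\<lambda>n. inner (\<Sum>k<n. cinner h (e k) *\<^sub>C e k) (c *\<^sub>C e j)) \<longlonglongrightarrow> inner h (c *\<^sub>C e j)"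
        by (rule tendsto_eventually, rule eventually_sequentiallyI[of "Suc j"]) (simp add: ev)
    qed
    from this[of 1] this[of \<i>] show ?thesis by (simp add: cinner_eq_0_iff inner_diff_left)
  qed
  then have "?w - h = 0" using e unfolding orthonormal_basis_def by blast
  then show ?thesis by simp
qed

text \<open>The coefficients of \<open>h\<close> are reused in the new system. Both series have the
  same sum of squared coefficients as squared norm, and the series in the basis itself sums to
  \<open>h\<close>.\<close>

lemma exists_isometry_of_basis:
  fixes b :: "nat \<Rightarrow> 'b::complex_hilbert"
  assumes b: "orthonormal b"
  shows "\<exists>T. isometry T \<and> (\<forall>k. T (e k) = b k)"
proof -
  define f where "f h = (\<Sum>k. cinner h (e k) *\<^sub>C b k)" for h
  have add: "f (x + y) = f x + f y" for x y
    unfolding f_def by (simp add: suminf_add[OF summable_expansion[OF b] summable_expansion[OF b]]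
        cinner_add_left scaleC_add_left)
  have scaleC: "f (c *\<^sub>C x) = c *\<^sub>C f x" for c x
  proof -
    have bl: "bounded_linear (\<lambda>v :: 'b. c *\<^sub>C v)"
      by (rule bounded_linear_intro[where K="cmod c"])
        (simp_all add: scaleC_add_right scaleC_scaleR mult.commute)
    show ?thesis
      unfolding f_def bounded_linear.suminf[OF bl summable_expansion[OF b]] cinner_scaleC_left scaleC_scaleC ..
  qed
  have norm: "norm (f h) = norm h" for h
  proof -
    have "(norm (f h))\<^sup>2 = (norm (\<Sum>k. cinner h (e k) *\<^sub>C e k))\<^sup>2"
      unfolding f_def expansion_norm[OF b] expansion_norm[OF basis_orthonormal] ..
    then show ?thesis by (simp add: expansion_self)
  qed
  have bl: "bounded_linear f"
  proof (rule bounded_linear_intro[where K=1])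
    show "f (r *\<^sub>R x) = r *\<^sub>R f x" for r x using scaleC[of "complex_of_real r" x] by (simp add: scaleC_of_real)
  qed (simp_all add: add norm)
  have fe: "f (e j) = b j" for j
  proof -
    have "(\<lambda>k. cinner (e j) (e k) *\<^sub>C b k) = (\<lambda>k. if k = j then b k else 0)"
      using scaleC_of_real[of 1] scaleC_of_real[of 0]
      by (auto simp: orthonormal_cinner[OF basis_orthonormal])
    then show ?thesis unfolding f_def using sums_unique[OF sums_single[of j b]] by simp
  qed
  have "blinfun_apply (Blinfun f) = f" by (rule bounded_linear_Blinfun_apply[OF bl])
  then show ?thesis
    by (intro exI[of _ "Blinfun f"]) (simp add: isometry_def clinear_blinfun_def scaleC norm fe)
qed

lemma clinear_eq_on_basis:
  assumes "clinear_blinfun S" "clinear_blinfun T" "\<And>k. S (e k) = T (e k)"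
  shows "S = T"
proof -
  have "{v. S v = T v} = UNIV"
  proof (rule closed_csubspace_eq_UNIV[OF e])
    show "csubspace {v. S v = T v}"
      using assms by (simp add: complex_vector.subspace_def clinear_blinfun_def blinfun.add_right)
    show "closed {v. S v = T v}" by (intro closed_Collect_eq) (auto intro!: continuous_intros)
    show "range e \<subseteq> {v. S v = T v}" using assms(3) by auto
  qed
  then show ?thesis by (intro blinfun_eqI) blast
qed

lemma closed_cinner_kernel:
  fixes S :: "'a \<Rightarrow>\<^sub>L 'b::complex_hilbert"
  assumes "clinear_blinfun S"
  shows "csubspace {v. cinner (S v) y = 0}" "closed {v. cinner (S v) y = 0}"
proof -
  show "csubspace {v. cinner (S v) y = 0}"
    using assms by (simp add: complex_vector.subspace_def clinear_blinfun_def blinfun.add_right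
        cinner_add_left cinner_scaleC_left)
  show "closed {v. cinner (S v) y = 0}"
    unfolding cinner_eq_0_iff
    by (intro closed_Collect_conj closed_Collect_eq) (auto intro!: continuous_intros)
qed

lemma orthogonal_ranges:
  fixes S T :: "'a \<Rightarrow>\<^sub>L 'b::complex_hilbert"
  assumes ST: "clinear_blinfun S" "clinear_blinfun T" and orth: "\<And>j k. cinner (S (e j)) (T (e k)) = 0"
  shows "inner (S v) (T w) = 0"
proof -
  have 1: "{v. cinner (S v) (T (e k)) = 0} = UNIV" for k
    by (rule closed_csubspace_eq_UNIV[OF e closed_cinner_kernel[OF ST(1)]]) (use orth in auto)
  have "cinner (T (e k)) (S v) = 0" for k
    using 1[of k] cinner_commute[of "T (e k)" "S v"] by auto
  then have "{w. cinner (T w) (S v) = 0} = UNIV"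
    by (intro closed_csubspace_eq_UNIV[OF e closed_cinner_kernel[OF ST(2)]]) auto
  then have "cinner (T w) (S v) = 0" by blast
  then show ?thesis by (simp add: cinner_eq_0_iff inner_commute)
qed

text \<open>For \<open>t\<close> decreasing to \<open>0\<close>, the basis vectors are rotated back one after the other, the vector
  \<open>e\<^sub>k\<close> while \<open>t\<close> runs through \<open>[1/(k+2), 1/(k+1)]\<close>. Then \<open>e\<^sub>2\<^sub>k\<^sub>+\<^sub>1\<close> is free when \<open>e\<^sub>k\<close> turns into it.\<close>

definition path_angle :: "nat \<Rightarrow> real \<Rightarrow> real" where
  "path_angle k t = pi / 2 * max 0 (min 1 (real (Suc k) * (real (k + 2) * t - 1)))"

definition path_basis :: "real \<Rightarrow> nat \<Rightarrow> 'a" where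
  "path_basis t k = cos (path_angle k t) *\<^sub>R e k + sin (path_angle k t) *\<^sub>R e (2 * k + 1)"

text \<open>The vector with index \<open>k\<close> is away from its initial position only for
  \<open>t > 1 / (k + 2)\<close>. Then \<open>(2 * k + 2) * t \<ge> 1\<close>, so the vector with
  index \<open>2 * k + 1\<close> has completed its quarter turn and left the direction
  \<open>e (2 * k + 1)\<close> free.\<close>

lemma path_angle_disjoint: "sin (path_angle k t) = 0 \<or> cos (path_angle (2 * k + 1) t) = 0"
proof (cases "real (k + 2) * t \<le> 1")
  case True
  then have "real (Suc k) * (real (k + 2) * t - 1) \<le> 0" by (intro mult_nonneg_nonpos) auto
  then have "path_angle k t = 0" by (simp add: path_angle_def max_def min_def)
  then show ?thesis by simp
next
  case False
  then have t: "1 < real (k + 2) * t" by simp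
  then have t0: "0 < t" using zero_less_mult_pos[of "real (k + 2)" t] by simp
  have "real (k + 2) * t \<le> real (2 * k + 2) * t" using t0 by (intro mult_right_mono) auto
  then have "1 \<le> real (2 * k + 2) * t" using t by linarith
  then have "real (2 * k + 3) * 1 \<le> real (2 * k + 3) * (real (2 * k + 2) * t)" by (intro mult_left_mono) auto
  then have "1 \<le> real (Suc (2 * k + 1)) * (real (2 * k + 1 + 2) * t - 1)" by (simp add: algebra_simps)
  then have "path_angle (2 * k + 1) t = pi / 2" by (simp only: path_angle_def min_absorb1 max_absorb2 zero_le_one)
  then show ?thesis by (simp only: cos_pi_half simp_thms)
qed

text \<open>Different vectors can overlap only for indices \<open>k\<close> and
  \<open>2 * k + 1\<close>, and the overlap is the product of a sine and a cosine that the timing of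
  the angles makes zero.\<close>

lemma orthonormal_path_basis: "orthonormal (path_basis t)"
  unfolding orthonormal_def
proof (intro allI)
  fix k l
  let ?c = "\<lambda>k. complex_of_real (cos (path_angle k t))" and ?s = "\<lambda>k. complex_of_real (sin (path_angle k t))"
  have sc: "?s k * ?c (2 * k + 1) = 0" for k using path_angle_disjoint[of k t] by auto
  have "cinner (path_basis t k) (path_basis t l) =
      ?c k * ?c l * (if k = l then 1 else 0) + ?c k * ?s l * (if k = 2 * l + 1 then 1 else 0) +
      ?s k * ?c l * (if 2 * k + 1 = l then 1 else 0) + ?s k * ?s l * (if k = l then 1 else 0)"
    unfolding path_basis_def
    by (simp add: scaleC_of_real[symmetric] cinner_add_left cinner_add_right cinner_scaleC_left
        cinner_scaleC_right orthonormal_cinner[OF basis_orthonormal] algebra_simps)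
  also have "\<dots> = (if k = l then 1 else 0)"
  proof (cases "k = l")
    case True
    then show ?thesis
      by (simp add: power2_eq_square[symmetric] of_real_power[symmetric] of_real_add[symmetric]
          del: of_real_power of_real_add)
  next
    case False
    then show ?thesis using sc[of k] sc[of l] by (auto simp: mult.commute)
  qed
  finally show "cinner (path_basis t k) (path_basis t l) = (if k = l then 1 else 0)" .
qed

text \<open>On a basis vector the path is continuous by its formula. The vectors with continuous
  orbit form a closed set, because isometries turn convergence of vectors into convergence uniform
  in \<open>t\<close>. At \<open>t = 1\<close> only odd indices are hit, which leaves infinitely
  many dimensions free.\<close>

lemma strong_path_exists:
  "\<exists>s :: real \<Rightarrow> 'a \<Rightarrow>\<^sub>L 'a. (\<forall>t. isometry (s t)) \<and> s 0 = id_blinfun \<and>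
     (\<forall>k. s 1 (e k) = e (2 * k + 1)) \<and> (\<forall>v. continuous_on {0..1} (\<lambda>t. s t v))"
proof -
  obtain s where s: "\<And>t. isometry (s t)" "\<And>t k. s t (e k) = path_basis t k"
    using exists_isometry_of_basis[OF orthonormal_path_basis] by metis
  have "path_basis 0 k = e k" for k by (simp add: path_basis_def path_angle_def max_def)
  then have s0: "s 0 = id_blinfun"
    by (intro clinear_eq_on_basis) (simp_all add: s isometry_clinear)
  have "cos (path_angle k 1) = 0 \<and> sin (path_angle k 1) = 1" for k
  proof -
    have "1 * 1 \<le> real (Suc k) * (real (k + 2) * 1 - 1)" by (intro mult_mono) auto
    then have "path_angle k 1 = pi / 2" by (simp only: path_angle_def min_absorb1 max_absorb2 zero_le_one)
    then show ?thesis by (simp only: cos_pi_half sin_pi_half simp_thms)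
  qed
  then have s1: "s 1 (e k) = e (2 * k + 1)" for k unfolding s path_basis_def by simp
  have sdiff: "norm (s t v - s t w) = norm (v - w)" for t v w
    using isometry_norm[OF s(1), of t "v - w"] by (simp add: blinfun.diff_right)
  let ?S = "{v. continuous_on {0..1} (\<lambda>t. s t v)}"
  have "?S = UNIV"
  proof (rule closed_csubspace_eq_UNIV[OF e])
    have "continuous_on {0..1} (\<lambda>t. imul (s t v))" if "continuous_on {0..1} (\<lambda>t. s t v)" for v
      by (rule bounded_linear.continuous_on[OF blinfun.bounded_linear_right that])
    then show "csubspace ?S"
      using clinear_blinfunD[OF isometry_clinear[OF s(1)]]
      by (intro csubspaceI_i)
        (auto simp: subspace_def blinfun.add_right blinfun.scaleR_right intro!: continuous_intros)
    show "closed ?S"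
      unfolding closed_sequential_limits
    proof (intro allI impI CollectI, elim conjE)
      fix x l assume x: "\<forall>n. x n \<in> ?S" and l: "x \<longlonglongrightarrow> l"
      have "uniform_limit {0..1} (\<lambda>n t. s t (x n)) (\<lambda>t. s t l) sequentially"
        using l unfolding uniform_limit_iff by (auto simp: dist_norm sdiff tendsto_iff)
      then show "continuous_on {0..1} (\<lambda>t. s t l)"
        by (rule uniform_limit_theorem[rotated]) (use x in auto)
    qed
    show "range e \<subseteq> ?S"
    proof -
      have "continuous_on {0..1} (\<lambda>t. s t (e k))" for k
        unfolding s(2) path_basis_def path_angle_def by (intro continuous_intros)
      then show ?thesis by auto
    qed
  qed
  then show ?thesis using s(1) s0 s1 by blast
qed

end

section \<open>Independence of the trivialization\<close>

definition inl_blinfun :: "'a::real_normed_vector \<Rightarrow>\<^sub>L ('a \<times> 'b::real_normed_vector)" where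
  "inl_blinfun = Blinfun (\<lambda>x. (x, 0))"

definition inr_blinfun :: "'b::real_normed_vector \<Rightarrow>\<^sub>L ('a::real_normed_vector \<times> 'b)" where
  "inr_blinfun = Blinfun (\<lambda>x. (0, x))"

lemma inl_blinfun_apply [simp]: "inl_blinfun x = (x, 0)"
  and inr_blinfun_apply [simp]: "inr_blinfun y = (0, y)"
  unfolding inl_blinfun_def inr_blinfun_def
  by (simp_all add: bounded_linear_Blinfun_apply bounded_linear_Pair bounded_linear_ident bounded_linear_zero)

lemma fst_scaleC [simp]: "fst (c *\<^sub>C p) = c *\<^sub>C fst p"
  and snd_scaleC [simp]: "snd (c *\<^sub>C p) = c *\<^sub>C snd p"
  by (simp_all add: scaleC_prod_def)

lemma scaleC_Pair: "c *\<^sub>C (x, y) = (c *\<^sub>C x, c *\<^sub>C y)"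
  by (simp add: scaleC_prod_def)

definition pair_blinfun ::
    "('a::complex_hilbert \<Rightarrow>\<^sub>L 'c::complex_hilbert) \<Rightarrow> ('b::complex_hilbert \<Rightarrow>\<^sub>L 'c) \<Rightarrow> ('a \<times> 'b) \<Rightarrow>\<^sub>L 'c" where
  "pair_blinfun S R = (S o\<^sub>L fst_blinfun) + (R o\<^sub>L snd_blinfun)"

lemma pair_blinfun_apply: "pair_blinfun S R p = S (fst p) + R (snd p)"
  by (simp add: pair_blinfun_def blinfun.add_left)

lemma adj_pair_blinfun: "adj (pair_blinfun S R) v = (adj S v, adj R v)"
proof (rule inner_eqI)
  fix z
  show "inner z (adj (pair_blinfun S R) v) = inner z (adj S v, adj R v)"
    unfolding inner_adj pair_blinfun_apply inner_prod_def[of z] by (simp add: inner_add_left inner_adj)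
qed

lemma unitary_pair_blinfun:
  assumes e: "orthonormal_basis e" and S: "isometry S" and R: "isometry R"
    and orth: "\<And>v w. inner (S v) (R w) = 0" and range: "\<And>k. e k \<in> range S \<union> range R"
  shows "unitary_onto UNIV (pair_blinfun S R)"
proof -
  let ?W = "pair_blinfun S R"
  have cl: "clinear_blinfun ?W"
    using isometry_clinear[OF S] isometry_clinear[OF R]
    by (simp add: clinear_blinfun_def pair_blinfun_apply scaleC_add_right)
  have norm: "norm (?W p) = norm p" for p
  proof -
    have "(norm (?W p))\<^sup>2 = (norm (fst p))\<^sup>2 + (norm (snd p))\<^sup>2"
      using norm_add_scaleR_square[of "S (fst p)" 1 "R (snd p)"] orth[of "fst p" "snd p"]
      by (simp add: pair_blinfun_apply isometry_norm[OF S] isometry_norm[OF R])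
    then show ?thesis by (simp add: norm_prod_def real_sqrt_unique)
  qed
  have "range ?W = UNIV"
  proof (rule closed_csubspace_eq_UNIV[OF e csubspace_range[OF cl]])
    show "closed (range ?W)"
      using closed_range_bounded_below[of 1 UNIV ?W] norm by simp
    have "S v \<in> range ?W" for v by (rule range_eqI[of _ _ "(v, 0)"]) (simp add: pair_blinfun_apply)
    moreover have "R v \<in> range ?W" for v by (rule range_eqI[of _ _ "(0, v)"]) (simp add: pair_blinfun_apply)
    ultimately have "e k \<in> range ?W" for k using range[of k] by auto
    then show "range e \<subseteq> range ?W" by blast
  qed
  then show ?thesis unfolding unitary_onto_def using cl norm by blast
qed

lemma isometry_of_subsequence:
  assumes e: "orthonormal_basis e" and "inj \<phi>"
  obtains T where "isometry T" "\<And>k. T (e k) = e (\<phi> k)"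
proof -
  have "orthonormal (\<lambda>k. e (\<phi> k))"
    using basis_orthonormal[OF e] assms(2) by (simp add: orthonormal_def inj_eq)
  then show ?thesis using exists_isometry_of_basis[OF e] that by blast
qed

text \<open>\<open>s 1\<close> maps to the span of the odd basis vectors, \<open>r\<close> to that
  of the even ones. The chain runs from \<open>F\<close> through its conjugates by
  \<open>s 1\<close>, \<open>r\<close> and \<open>s 1 o\<^sub>L j x\<close> to that by
  \<open>j x\<close>; its outer links are strong paths, its inner ones rotations between orthogonal
  ranges.\<close>

lemma UF_homotopic_conjugate:
  fixes F :: "'x \<Rightarrow> 'a::complex_hilbert \<Rightarrow>\<^sub>L 'a" and e :: "nat \<Rightarrow> 'a"
  assumes e: "orthonormal_basis e" and F: "continuous_map X (top_of_set UF) F"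
    and j: "continuous_map X euclidean j" "\<And>x. x \<in> topspace X \<Longrightarrow> unitary_onto UNIV (j x)"
  shows "UF_homotopic X F (\<lambda>x. conj_iso (j x) (F x))"
proof -
  obtain s :: "real \<Rightarrow> 'a \<Rightarrow>\<^sub>L 'a" where s: "\<And>t. isometry (s t)" "s 0 = id_blinfun" "\<And>k. s 1 (e k) = e (2 * k + 1)"
    "\<And>v. continuous_on {0..1} (\<lambda>t. s t v)"
    using strong_path_exists[OF e] by blast
  obtain r where r: "isometry r" "\<And>k. r (e k) = e (2 * k)"
  proof -
    have "inj (\<lambda>k :: nat. 2 * k)" by (simp add: inj_def)
    then show thesis by (rule isometry_of_subsequence[OF e]) (rule that)
  qed
  have orth: "inner (s 1 v) (r w) = 0" for v w
  proof (rule orthogonal_ranges[OF e])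
    fix j k
    have "2 * j + 1 \<noteq> 2 * k" for j k :: nat by presburger
    then show "cinner (s 1 (e j)) (r (e k)) = 0"
      by (simp only: s r orthonormal_cinner[OF basis_orthonormal[OF e]] if_False)
  qed (simp_all add: isometry_clinear s r)
  have jiso: "isometry (j x)" if "x \<in> topspace X" for x using j(2)[OF that] by (rule isometry_of_unitary)
  let ?F' = "\<lambda>x. conj_iso (j x) (F x)"
  have Fc: "continuous_map X euclidean F" and FU: "\<And>x. x \<in> topspace X \<Longrightarrow> F x \<in> UF"
    using F by (auto simp: continuous_map_UF_iff)
  have "continuous_map X euclidean ?F'"
    unfolding continuous_map_atin limitin_canonical_iff
    by (intro ballI tendsto_conj_iso continuous_map_tendsto Fc j(1))
  then have F': "continuous_map X (top_of_set UF) ?F'"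
    unfolding continuous_map_UF_iff using conj_iso_in_UF[OF jiso FU] by blast
  have 1: "UF_homotopic X ?F' (\<lambda>x. conj_iso (s 1 o\<^sub>L j x) (F x))"
    using UF_homotopic_strong_path[of s, OF s(1,2,4) F'] by (simp add: conj_iso_compose s(1))
  have 2: "UF_homotopic X (\<lambda>x. conj_iso (s 1 o\<^sub>L j x) (F x)) (\<lambda>x. conj_iso r (F x))"
  proof (rule UF_homotopic_orthogonal_isometries[OF F _ _ r(1)])
    show "continuous_map X euclidean (\<lambda>x. s 1 o\<^sub>L j x)"
      unfolding continuous_map_atin limitin_canonical_iff
      by (intro ballI tendsto_blinfun_compose tendsto_const continuous_map_tendsto j(1))
  qed (simp_all add: isometry_compose s(1) jiso orth)
  have 3: "UF_homotopic X (\<lambda>x. conj_iso (s 1) (F x)) (\<lambda>x. conj_iso r (F x))"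
    by (rule UF_homotopic_orthogonal_isometries[OF F _ _ r(1)]) (simp_all add: s(1) orth)
  have 4: "UF_homotopic X F (\<lambda>x. conj_iso (s 1) (F x))"
    by (rule UF_homotopic_strong_path[of s, OF s(1,2,4) F])
  show ?thesis
    using 1 2 3 4 homotopic_with_trans homotopic_with_symD by blast
qed

section \<open>Evaluation of the index classes\<close>

lemma K1_class_eqI: "UF_homotopic X f g \<Longrightarrow> K1_class X f = K1_class X g"
  unfolding K1_class_def K1_rel_def
  by (auto intro: homotopic_with_trans homotopic_with_symD)

lemma UF_homotopic_eq:
  assumes "continuous_map X (top_of_set UF) f" "\<And>x. x \<in> topspace X \<Longrightarrow> f x = g x"
  shows "UF_homotopic X f g"
  by (rule homotopic_with_equal) (use assms in auto)

text \<open>\<open>inv\<close> is a choice of preimage, reliable on the range of the injective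
  \<open>V\<close>. The intertwining relation keeps the argument in that range, although
  \<open>V\<close> may miss part of the ambient space.\<close>

lemma stab_transport_eqI:
  fixes V :: "'h::complex_hilbert \<Rightarrow>\<^sub>L ('w::complex_hilbert \<times> 'h)" and u :: "'h \<Rightarrow>\<^sub>L 'h"
  assumes "unitary_onto S V" "\<And>h. V (u h) = map_prod f id (V h)"
  shows "stab_transport V f = u"
proof -
  have "inj V"
  proof (rule injI)
    fix x y assume "V x = V y"
    then have "norm (V (x - y)) = 0" by (simp add: blinfun.diff_right)
    then have "norm (x - y) = 0" using assms(1) unfolding unitary_onto_def by metis
    then show "x = y" by simp
  qed
  then have "inv V (map_prod f id (V h)) = u h" for h
    using assms(2)[of h] by (metis inv_f_f)
  then show ?thesis unfolding stab_transport_def by (simp add: blinfun_apply_inverse)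
qed

text \<open>Two trivializations have equal ranges at each point, so
  \<open>adj (V x) o\<^sub>L V0 x\<close> is a norm continuous family of unitaries of one fixed
  space, and the one transported family is the other conjugated by it.\<close>

lemma K1_class_trivialization_independent:
  fixes V V0 :: "'x \<Rightarrow> 'h::complex_hilbert \<Rightarrow>\<^sub>L ('w::complex_hilbert \<times> 'h)" and e :: "nat \<Rightarrow> 'h"
  assumes e: "orthonormal_basis e" and V0: "trivialization X W V0" and V: "trivialization X W V"
    and F: "continuous_map X (top_of_set UF) F"
    and Ff: "\<And>x h. x \<in> topspace X \<Longrightarrow> V0 x (F x h) = map_prod (f x) id (V0 x h)"
  shows "K1_class X (\<lambda>x. stab_transport (V x) (f x)) = K1_class X F"
proof -
  define j where "j x = adj (V x) o\<^sub>L V0 x" for x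
  have iso: "isometry (V x)" "isometry (V0 x)" if "x \<in> topspace X" for x
    using V V0 that unfolding trivialization_def by (blast intro: isometry_of_unitary)+
  have range: "range (V x) = range (V0 x)" if "x \<in> topspace X" for x
    using V V0 that unfolding trivialization_def unitary_onto_def by blast
  have proj: "V x (adj (V x) (V0 x v)) = V0 x v" "V0 x (adj (V0 x) (V x v)) = V x v"
    if x: "x \<in> topspace X" for x v
  proof -
    have "V0 x v \<in> range (V x)" "V x v \<in> range (V0 x)" using range[OF x] by auto
    then obtain w w' where w: "V0 x v = V x w" "V x v = V0 x w'" by blast
    show "V x (adj (V x) (V0 x v)) = V0 x v" unfolding w(1) by (simp add: isometry_adj_cancel[OF iso(1)[OF x]])
    show "V0 x (adj (V0 x) (V x v)) = V x v" unfolding w(2) by (simp add: isometry_adj_cancel[OF iso(2)[OF x]])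
  qed
  have adj_j: "adj (j x) = adj (V0 x) o\<^sub>L V x" for x by (simp add: j_def adj_compose)
  have ju: "unitary_onto UNIV (j x)" if x: "x \<in> topspace X" for x
    unfolding unitary_onto_UNIV_iff adj_j
    using proj[OF x] iso[OF x]
    by (auto simp: j_def isometry_adj_cancel isometry_clinear
        intro!: blinfun_eqI clinear_blinfun_compose clinear_blinfun_adj)
  have "continuous_map X euclidean V" "continuous_map X euclidean V0"
    using V V0 by (auto simp: trivialization_def)
  then have jc: "continuous_map X euclidean j"
    unfolding continuous_map_atin limitin_canonical_iff j_def
    by (auto intro!: tendsto_blinfun_compose tendsto_adj)
  have 1: "UF_homotopic X F (\<lambda>x. conj_iso (j x) (F x))"
    by (rule UF_homotopic_conjugate[OF e F jc ju])
  have "continuous_map X (top_of_set UF) (\<lambda>x. conj_iso (j x) (F x))"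
    using 1 homotopic_with_imp_continuous_maps by blast
  then have 2: "UF_homotopic X (\<lambda>x. conj_iso (j x) (F x)) (\<lambda>x. stab_transport (V x) (f x))"
  proof (rule UF_homotopic_eq)
    fix x assume x: "x \<in> topspace X"
    have "unitary_onto (W x \<times> UNIV) (V x)" using V x unfolding trivialization_def by blast
    then have "stab_transport (V x) (f x) = conj_iso (j x) (F x)"
    proof (rule stab_transport_eqI)
      fix h
      have "conj_iso (j x) (F x) h = j x (F x (adj (j x) h))"
        by (simp add: conj_iso_apply unitary_adj_right[OF ju[OF x]])
      then have "V x (conj_iso (j x) (F x) h) = V0 x (F x (adj (V0 x) (V x h)))"
        using proj[OF x] by (simp add: j_def[of x] adj_compose)
      then show "V x (conj_iso (j x) (F x) h) = map_prod (f x) id (V x h)"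
        by (simp add: Ff[OF x] proj[OF x])
    qed
    then show "conj_iso (j x) (F x) = stab_transport (V x) (f x)" by simp
  qed
  show ?thesis
    by (rule K1_class_eqI[OF homotopic_with_symD[OF homotopic_with_trans[OF 1 2]]])
qed

text \<open>The given \<open>V\<close> makes the definite description satisfiable and independence
  makes it unique. The class is thus found from any \<open>F\<close> that one trivialization
  intertwines with \<open>f\<close>.\<close>

lemma K1_index_family_eq:
  fixes V :: "'x \<Rightarrow> 'h::complex_hilbert \<Rightarrow>\<^sub>L ('w::complex_hilbert \<times> 'h)" and e :: "nat \<Rightarrow> 'h"
  assumes e: "orthonormal_basis e" and V: "trivialization X W V"
    and F: "continuous_map X (top_of_set UF) F"
    and Ff: "\<And>x h. x \<in> topspace X \<Longrightarrow> V x (F x h) = map_prod (f x) id (V x h)"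
  shows "K1_index_family X W f = K1_class X F"
  unfolding K1_index_family_def
proof (rule the_equality)
  show "\<exists>V :: 'x \<Rightarrow> 'h \<Rightarrow>\<^sub>L ('w \<times> 'h). trivialization X W V \<and>
      K1_class X F = K1_class X (\<lambda>x. stab_transport (V x) (f x))"
    using V K1_class_trivialization_independent[OF e V V F Ff] by metis
qed (use K1_class_trivialization_independent[OF e V _ F Ff] in blast)

lemma K1_index_eq:
  fixes V :: "'h::complex_hilbert \<Rightarrow>\<^sub>L ('w::complex_hilbert \<times> 'h)" and e :: "nat \<Rightarrow> 'h"
    and f :: "'x \<Rightarrow> 'w \<Rightarrow>\<^sub>L 'w"
  assumes e: "orthonormal_basis e" and V: "unitary_onto UNIV V"
    and F: "continuous_map X (top_of_set UF) F"
    and Ff: "\<And>x h. x \<in> topspace X \<Longrightarrow> V (F x h) = map_prod (f x) id (V h)"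
  shows "K1_index X f = K1_class X F"
proof -
  have triv: "trivialization X (\<lambda>_. UNIV) (\<lambda>_. V)" if "unitary_onto UNIV V"
    for V :: "'h \<Rightarrow>\<^sub>L ('w \<times> 'h)"
    using that by (simp add: trivialization_def)
  have *: "K1_class X (\<lambda>x. stab_transport U (f x)) = K1_class X F" if "unitary_onto UNIV U"
    for U :: "'h \<Rightarrow>\<^sub>L ('w \<times> 'h)"
    by (rule K1_class_trivialization_independent[OF e triv[OF V] triv[OF that] F]) (rule Ff)
  show ?thesis
    unfolding K1_index_def
  proof (rule the_equality)
    show "\<exists>V :: 'h \<Rightarrow>\<^sub>L ('w \<times> 'h). unitary_onto UNIV V \<and>
        K1_class X F = K1_class X (\<lambda>x. stab_transport V (f x))"
      using V *[OF V] by metis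
  qed (use * in blast)
qed


section \<open>A trivialization of the positive part\<close>

lemma orth_proj_intertwine:
  fixes T :: "'a::complex_hilbert \<Rightarrow>\<^sub>L 'b::complex_hilbert"
  assumes K: "csubspace K" "closed K" and M: "csubspace M" "closed M"
    and T: "\<And>k. k \<in> K \<Longrightarrow> T k \<in> M" "\<And>m. m \<in> M \<Longrightarrow> adj T m \<in> K"
  shows "T (orth_proj K v) = orth_proj M (T v)"
proof -
  have "orth_proj M (T v) = T (orth_proj K v)"
  proof (rule orth_proj_unique[OF M])
    show "T (orth_proj K v) \<in> M" by (rule T(1)[OF orth_proj_mem[OF K]])
    show "inner (T v - T (orth_proj K v)) s = 0" if "s \<in> M" for s
      using orth_proj_orthogonal[OF K T(2)[OF that], of v]
      by (simp add: inner_adj blinfun.diff_right)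
  qed
  then show ?thesis ..
qed

text \<open>The space splits as \<open>\<iota> H \<oplus> \<sigma> H\<close> with \<open>\<sigma>\<close> a pure shift, that is, as a sum of the copies
  \<open>\<sigma>\<^sup>n \<iota> H\<close> of itself. The sum of the copies of \<open>K\<close> is \<open>amplify K\<close>. Shifting its complement by one copy
  makes room for the complement of \<open>K\<close>.\<close>

locale shift =
  fixes e :: "nat \<Rightarrow> 'h::complex_hilbert" and \<iota> \<sigma> :: "'h \<Rightarrow>\<^sub>L 'h"
  assumes basis: "orthonormal_basis e"
    and iota: "isometry \<iota>" "\<And>m. \<iota> (e m) = e (prod_encode (m, 0))"
    and sigma: "isometry \<sigma>" "\<And>m n. \<sigma> (e (prod_encode (m, n))) = e (prod_encode (m, Suc n))"
begin

lemma sigma_iota_orthogonal: "inner (\<sigma> v) (\<iota> w) = 0"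
proof (rule orthogonal_ranges[OF basis])
  fix j k
  obtain m n where "j = prod_encode (m, n)" by (metis prod_decode_inverse surj_pair)
  then show "cinner (\<sigma> (e j)) (\<iota> (e k)) = 0"
    by (simp add: sigma iota orthonormal_cinner[OF basis_orthonormal[OF basis]])
qed (simp_all add: isometry_clinear iota sigma)

lemma adj_sigma_iota [simp]: "adj \<sigma> (\<iota> w) = 0"
proof (rule inner_eqI)
  show "inner z (adj \<sigma> (\<iota> w)) = inner z 0" for z by (simp add: inner_adj sigma_iota_orthogonal)
qed

lemma adj_iota_sigma [simp]: "adj \<iota> (\<sigma> w) = 0"
proof (rule inner_eqI)
  show "inner z (adj \<iota> (\<sigma> w)) = inner z 0" for z
    by (simp add: inner_adj inner_commute[of "\<iota> z"] sigma_iota_orthogonal)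
qed

lemmas [simp] = isometry_adj_cancel[OF iota(1)] isometry_adj_cancel[OF sigma(1)]

lemma split_identity: "\<iota> (adj \<iota> v) + \<sigma> (adj \<sigma> v) = v"
proof -
  have "e k \<in> range \<iota> \<union> range \<sigma>" for k
  proof -
    obtain m n where k: "k = prod_encode (m, n)" by (metis prod_decode_inverse surj_pair)
    show ?thesis
    proof (cases n)
      case 0
      then show ?thesis using iota(2)[of m] k by (metis UnI1 rangeI)
    next
      case (Suc n')
      then show ?thesis using sigma(2)[of m n'] k by (metis UnI2 rangeI)
    qed
  qed
  then have "unitary_onto UNIV (pair_blinfun \<iota> \<sigma>)"
    by (intro unitary_pair_blinfun[OF basis iota(1) sigma(1)])
      (simp_all add: inner_commute[of "\<iota> _"] sigma_iota_orthogonal)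
  from unitary_adj_right[OF this, of v] show ?thesis
    by (simp add: adj_pair_blinfun pair_blinfun_apply)
qed

definition amplify :: "'h set \<Rightarrow> 'h set" where
  "amplify K = {h. \<forall>n. adj \<iota> ((blinfun_apply (adj \<sigma>) ^^ n) h) \<in> K}"

text \<open>The vectors with components in finitely many copies only. They allow induction on the
  number of copies, followed by a density argument.\<close>

definition nilpotent_vectors :: "'h set" where
  "nilpotent_vectors = {h. \<exists>n. (blinfun_apply (adj \<sigma>) ^^ n) h = 0}"

lemma funpow_adj_sigma_0 [simp]: "(blinfun_apply (adj \<sigma>) ^^ n) 0 = 0"
  by (induction n) simp_all

lemma funpow_linear:
  "(blinfun_apply (adj \<sigma>) ^^ n) (x + y) = (blinfun_apply (adj \<sigma>) ^^ n) x + (blinfun_apply (adj \<sigma>) ^^ n) y"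
  "(blinfun_apply (adj \<sigma>) ^^ n) (c *\<^sub>C x) = c *\<^sub>C (blinfun_apply (adj \<sigma>) ^^ n) x"
  using clinear_blinfunD[OF clinear_blinfun_adj[OF isometry_clinear[OF sigma(1)]]]
  by (induction n) (simp_all add: blinfun.add_right)

lemma continuous_funpow: "continuous_on UNIV (blinfun_apply (adj \<sigma>) ^^ n)"
  by (induction n) (auto simp: comp_def intro!: continuous_intros)

lemma closure_nilpotent_vectors: "closure nilpotent_vectors = UNIV"
proof (rule closed_csubspace_eq_UNIV[OF basis csubspace_closure closed_closure])
  show "csubspace nilpotent_vectors"
    unfolding complex_vector.subspace_def
  proof (intro conjI ballI allI)
    fix x y c assume x: "x \<in> nilpotent_vectors" and y: "y \<in> nilpotent_vectors"
    then obtain m n where mn: "(blinfun_apply (adj \<sigma>) ^^ m) x = 0" "(blinfun_apply (adj \<sigma>) ^^ n) y = 0"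
      unfolding nilpotent_vectors_def by blast
    have "(blinfun_apply (adj \<sigma>) ^^ (n + m)) x = 0" "(blinfun_apply (adj \<sigma>) ^^ (m + n)) y = 0"
      using mn by (simp_all add: funpow_add)
    then show "x + y \<in> nilpotent_vectors"
      unfolding nilpotent_vectors_def by (auto simp: funpow_linear add.commute intro!: exI[of _ "n + m"])
    show "c *\<^sub>C x \<in> nilpotent_vectors"
      using mn(1) unfolding nilpotent_vectors_def by (auto simp: funpow_linear intro!: exI[of _ m])
  qed (auto simp: nilpotent_vectors_def)
  have "(blinfun_apply (adj \<sigma>) ^^ Suc n) (e (prod_encode (m, n))) = 0" for m n
  proof (induction n)
    case 0
    have "adj \<sigma> (\<iota> (e m)) = 0" by simp
    then show ?case by (simp add: iota(2))
  next
    case (Suc n)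
    have "adj \<sigma> (\<sigma> (e (prod_encode (m, n)))) = e (prod_encode (m, n))" by simp
    then show ?case using Suc by (simp add: sigma(2) funpow_swap1)
  qed
  then have "e k \<in> nilpotent_vectors" for k
    unfolding nilpotent_vectors_def by (metis (mono_tags, lifting) mem_Collect_eq prod_decode_inverse surj_pair)
  then show "range e \<subseteq> closure nilpotent_vectors" using closure_subset by blast
qed

context
  fixes K :: "'h set"
  assumes K: "csubspace K" "closed K"
begin

lemma zero_mem: "0 \<in> K"
  using K(1) by (simp add: complex_vector.subspace_def)

lemma amplify_subspace: "csubspace (amplify K)" "closed (amplify K)"
proof -
  show "csubspace (amplify K)"
    using K(1) clinear_blinfunD[OF clinear_blinfun_adj[OF isometry_clinear[OF iota(1)]]]
    by (simp add: complex_vector.subspace_def amplify_def funpow_linear blinfun.add_right)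
  have "amplify K = (\<Inter>n. (\<lambda>h. adj \<iota> ((blinfun_apply (adj \<sigma>) ^^ n) h)) -` K)" by (auto simp: amplify_def)
  moreover have "closed ((\<lambda>h. adj \<iota> ((blinfun_apply (adj \<sigma>) ^^ n) h)) -` K)" for n
  proof (rule continuous_closed_vimage[OF K(2)])
    have "continuous_on UNIV (\<lambda>h. adj \<iota> ((blinfun_apply (adj \<sigma>) ^^ n) h))"
      by (rule bounded_linear.continuous_on[OF blinfun.bounded_linear_right continuous_funpow])
    then show "isCont (\<lambda>h. adj \<iota> ((blinfun_apply (adj \<sigma>) ^^ n) h)) x" for x
      by (simp add: continuous_on_eq_continuous_at)
  qed
  ultimately show "closed (amplify K)" by auto
qed

lemma amplify_maps:
  "h \<in> amplify K \<Longrightarrow> \<sigma> h \<in> amplify K" "h \<in> amplify K \<Longrightarrow> adj \<sigma> h \<in> amplify K"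
  "k \<in> K \<Longrightarrow> \<iota> k \<in> amplify K" "h \<in> amplify K \<Longrightarrow> adj \<iota> h \<in> K"
proof -
  assume h: "h \<in> amplify K"
  have "adj \<iota> ((blinfun_apply (adj \<sigma>) ^^ n) (\<sigma> h)) \<in> K" for n
    using h zero_mem by (cases n) (simp_all add: amplify_def funpow_swap1)
  then show "\<sigma> h \<in> amplify K" by (simp add: amplify_def)
  have "adj \<iota> ((blinfun_apply (adj \<sigma>) ^^ Suc n) h) \<in> K" for n using h unfolding amplify_def by blast
  then show "adj \<sigma> h \<in> amplify K" by (simp add: amplify_def funpow_swap1)
  have "adj \<iota> ((blinfun_apply (adj \<sigma>) ^^ 0) h) \<in> K" using h unfolding amplify_def by blast
  then show "adj \<iota> h \<in> K" by simp
next
  assume k: "k \<in> K"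
  have "adj \<iota> ((blinfun_apply (adj \<sigma>) ^^ n) (\<iota> k)) \<in> K" for n
    using k zero_mem by (cases n) (simp_all add: funpow_swap1)
  then show "\<iota> k \<in> amplify K" by (simp add: amplify_def)
qed

lemma amplify_intertwine:
  "orth_proj (amplify K) (\<sigma> v) = \<sigma> (orth_proj (amplify K) v)"
  "orth_proj (amplify K) (adj \<sigma> v) = adj \<sigma> (orth_proj (amplify K) v)"
  "orth_proj (amplify K) (\<iota> v) = \<iota> (orth_proj K v)"
  "orth_proj K (adj \<iota> v) = adj \<iota> (orth_proj (amplify K) v)"
proof -
  note A = amplify_subspace
  show "orth_proj (amplify K) (\<sigma> v) = \<sigma> (orth_proj (amplify K) v)"
    by (rule orth_proj_intertwine[symmetric, OF A A]) (auto intro: amplify_maps)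
  show "orth_proj (amplify K) (adj \<sigma> v) = adj \<sigma> (orth_proj (amplify K) v)"
    by (rule orth_proj_intertwine[symmetric, OF A A]) (auto intro: amplify_maps)
  show "orth_proj (amplify K) (\<iota> v) = \<iota> (orth_proj K v)"
    by (rule orth_proj_intertwine[symmetric, OF K A]) (auto intro: amplify_maps)
  show "orth_proj K (adj \<iota> v) = adj \<iota> (orth_proj (amplify K) v)"
    by (rule orth_proj_intertwine[symmetric, OF A K]) (auto intro: amplify_maps)
qed

end

lemma norm_split: "(norm v)\<^sup>2 = (norm (adj \<iota> v))\<^sup>2 + (norm (adj \<sigma> v))\<^sup>2"
proof -
  have "(norm (\<sigma> (adj \<sigma> v) + \<iota> (adj \<iota> v)))\<^sup>2 = (norm (adj \<sigma> v))\<^sup>2 + (norm (adj \<iota> v))\<^sup>2"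
    using norm_add_scaleR_square[of "\<sigma> (adj \<sigma> v)" 1 "\<iota> (adj \<iota> v)"]
    by (simp add: sigma_iota_orthogonal isometry_norm[OF iota(1)] isometry_norm[OF sigma(1)])
  then show ?thesis using split_identity[of v] by (simp add: add.commute)
qed

text \<open>The difference of the amplified projections is a direct sum of copies of the difference
  of the original ones, so its norm is no larger. This makes amplification norm continuous.\<close>

lemma norm_orth_proj_amplify_diff_le:
  assumes K: "csubspace K" "closed K" and M: "csubspace M" "closed M"
  shows "norm (orth_proj (amplify K) - orth_proj (amplify M)) \<le> norm (orth_proj K - orth_proj M)"
proof -
  define D where "D = orth_proj (amplify K) - orth_proj (amplify M)"
  define d where "d = norm (orth_proj K - orth_proj M)"
  have d0: "0 \<le> d" by (simp add: d_def)
  have D1: "adj \<iota> (D v) = (orth_proj K - orth_proj M) (adj \<iota> v)" for v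
    by (simp add: D_def blinfun.diff_left blinfun.diff_right amplify_intertwine[OF K] amplify_intertwine[OF M])
  have D2: "adj \<sigma> (D v) = D (adj \<sigma> v)" for v
    by (simp add: D_def blinfun.diff_left blinfun.diff_right amplify_intertwine[OF K] amplify_intertwine[OF M])
  have nil: "(norm (D v))\<^sup>2 \<le> d\<^sup>2 * (norm v)\<^sup>2" if "(blinfun_apply (adj \<sigma>) ^^ n) v = 0" for n v
    using that
  proof (induction n arbitrary: v)
    case (Suc n)
    then have IH: "(norm (D (adj \<sigma> v)))\<^sup>2 \<le> d\<^sup>2 * (norm (adj \<sigma> v))\<^sup>2" by (simp add: funpow_swap1)
    have "norm (adj \<iota> (D v)) \<le> d * norm (adj \<iota> v)"
      unfolding D1 d_def by (rule norm_blinfun)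
    then have "(norm (adj \<iota> (D v)))\<^sup>2 \<le> (d * norm (adj \<iota> v))\<^sup>2" by (rule power_mono) simp
    then show ?case
      using IH norm_split[of "D v"] norm_split[of v] by (simp add: D2 power_mult_distrib distrib_left)
  qed simp
  have "closed {v. norm (D v) \<le> d * norm v}" by (intro closed_Collect_le continuous_intros)
  moreover have "nilpotent_vectors \<subseteq> {v. norm (D v) \<le> d * norm v}"
  proof
    fix v assume "v \<in> nilpotent_vectors"
    then obtain n where "(blinfun_apply (adj \<sigma>) ^^ n) v = 0" unfolding nilpotent_vectors_def by blast
    then have "(norm (D v))\<^sup>2 \<le> (d * norm v)\<^sup>2" using nil by (simp add: power_mult_distrib)
    then have "norm (D v) \<le> d * norm v" by (rule power2_le_imp_le) (simp add: d0)
    then show "v \<in> {v. norm (D v) \<le> d * norm v}" by simp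
  qed
  ultimately have "{v. norm (D v) \<le> d * norm v} = UNIV"
    using closure_minimal closure_nilpotent_vectors by blast
  then have "norm D \<le> d" by (intro norm_blinfun_bound[OF d0]) auto
  then show ?thesis by (simp add: D_def d_def)
qed

end

text \<open>The basis is indexed by pairs through the pairing function; the second index counts the
  copies.\<close>

lemma exists_shift:
  assumes e: "orthonormal_basis (e :: nat \<Rightarrow> 'h::complex_hilbert)"
  obtains \<iota> \<sigma> where "shift e \<iota> \<sigma>"
proof -
  have "inj (\<lambda>m. prod_encode (m, 0))" by (simp add: inj_def)
  then obtain \<iota> where i: "isometry \<iota>" "\<And>m. \<iota> (e m) = e (prod_encode (m, 0))"
    using isometry_of_subsequence[OF e] by metis
  have "inj (\<lambda>k. prod_encode (fst (prod_decode k), Suc (snd (prod_decode k))))"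
    by (rule injI) (auto intro: inj_prod_decode[THEN injD] simp: prod_eq_iff)
  then obtain \<sigma> where s: "isometry \<sigma>" "\<And>k. \<sigma> (e k) = e (prod_encode (fst (prod_decode k), Suc (snd (prod_decode k))))"
    using isometry_of_subsequence[OF e, of "\<lambda>k. prod_encode (fst (prod_decode k), Suc (snd (prod_decode k)))"]
    by blast
  have "shift e \<iota> \<sigma>" by unfold_locales (simp_all add: e i s)
  then show ?thesis by (rule that)
qed

section \<open>Eigenspaces of the standard symplectic structure and their trivialization\<close>

lemma eq_i_iff: "y = \<i> *\<^sub>C x \<longleftrightarrow> - x = \<i> *\<^sub>C y" for x y :: "'a::complex_hilbert"
  by (metis scaleC_i_i scaleC_minus_right minus_minus)

lemma J_plus_std: "csubspace K \<Longrightarrow> J_plus J_std (K \<times> K) = {(\<xi>, \<i> *\<^sub>C \<xi>) |\<xi>. \<xi> \<in> K}"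
  by (auto simp: J_plus_def J_std_def scaleC_Pair complex_vector.subspace_def)

lemma J_minus_std: "csubspace K \<Longrightarrow> J_minus J_std (K \<times> K) = {(\<xi>, - \<i> *\<^sub>C \<xi>) |\<xi>. \<xi> \<in> K}"
proof -
  assume K: "csubspace K"
  have "J_std (x, y) = - \<i> *\<^sub>C (x, y) \<longleftrightarrow> y = - (\<i> *\<^sub>C x)" for x y :: 'a
    unfolding J_std_def scaleC_Pair using eq_i_iff[of "- y" x] by (auto simp: minus_equation_iff[of y])
  moreover have "- (\<i> *\<^sub>C x) \<in> K" if "x \<in> K" for x
    using K that by (intro complex_vector.subspace_neg complex_vector.subspace_scale)
  ultimately show ?thesis unfolding J_minus_def by auto
qed

lemma clinear_inl_blinfun: "clinear_blinfun (inl_blinfun :: 'a::complex_hilbert \<Rightarrow>\<^sub>L ('a \<times> 'b::complex_hilbert))"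
  and clinear_inr_blinfun: "clinear_blinfun (inr_blinfun :: 'b::complex_hilbert \<Rightarrow>\<^sub>L ('a::complex_hilbert \<times> 'b))"
  by (simp_all add: clinear_blinfun_def scaleC_Pair)

context shift
begin

lemma unitary_pair: "unitary_onto UNIV (pair_blinfun \<iota> \<sigma>)"
proof -
  have "v \<in> range (pair_blinfun \<iota> \<sigma>)" for v
    by (rule range_eqI[of _ _ "(adj \<iota> v, adj \<sigma> v)"]) (simp add: pair_blinfun_apply split_identity)
  moreover have "norm (pair_blinfun \<iota> \<sigma> p) = norm p" for p
  proof -
    have "(norm (pair_blinfun \<iota> \<sigma> p))\<^sup>2 = (norm (fst p))\<^sup>2 + (norm (snd p))\<^sup>2"
      using norm_split[of "pair_blinfun \<iota> \<sigma> p"] by (simp add: pair_blinfun_apply blinfun.add_right)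
    then show ?thesis by (simp add: norm_prod_def real_sqrt_unique)
  qed
  moreover have "clinear_blinfun (pair_blinfun \<iota> \<sigma>)"
    using isometry_clinear[OF iota(1)] isometry_clinear[OF sigma(1)]
    by (simp add: clinear_blinfun_def pair_blinfun_apply scaleC_add_right)
  ultimately show ?thesis unfolding unitary_onto_def by blast
qed

definition split_map :: "'h \<Rightarrow>\<^sub>L ('h \<times> 'h)" where
  "split_map = adj (pair_blinfun \<iota> \<sigma>)"

lemma unitary_split_map: "unitary_onto UNIV split_map"
  unfolding split_map_def by (rule unitary_adj[OF unitary_pair])

lemma split_map_apply: "split_map v = (adj \<iota> v, adj \<sigma> v)"
  by (simp add: split_map_def adj_pair_blinfun)

lemma adj_conj_iso_iota:
  "adj \<iota> (conj_iso \<iota> c h) = c (adj \<iota> h)" "adj \<sigma> (conj_iso \<iota> c h) = adj \<sigma> h"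
  by (simp_all add: conj_iso_apply blinfun.add_right blinfun.diff_right)

lemma split_map_conj_iso: "split_map (conj_iso \<iota> c h) = map_prod c id (split_map h)"
  by (simp add: split_map_apply adj_conj_iso_iota)

text \<open>The positive part of \<open>K \<oplus> K\<close> consists of the vectors \<open>(\<xi>, i \<xi>)\<close>, and \<open>\<xi> \<mapsto> (\<xi>, i \<xi>) / \<surd>2\<close> is
  a unitary onto it.\<close>

definition triv_map :: "'h set \<Rightarrow> 'h \<Rightarrow>\<^sub>L (('h \<times> 'h) \<times> 'h)" where
  "triv_map K =
     (inl_blinfun o\<^sub>L ((1 / sqrt 2) *\<^sub>R (inl_blinfun + (inr_blinfun o\<^sub>L imul)) o\<^sub>L (orth_proj K o\<^sub>L adj \<iota>))) +
     (inr_blinfun o\<^sub>L ((orth_proj (amplify K) o\<^sub>L adj \<sigma>) +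
        (\<sigma> o\<^sub>L ((id_blinfun - orth_proj (amplify K)) o\<^sub>L adj \<sigma>)) +
        (\<iota> o\<^sub>L ((id_blinfun - orth_proj K) o\<^sub>L adj \<iota>))))"

lemma triv_map_apply:
  "triv_map K h =
     (((1 / sqrt 2) *\<^sub>R orth_proj K (adj \<iota> h), (1 / sqrt 2) *\<^sub>R \<i> *\<^sub>C orth_proj K (adj \<iota> h)),
      orth_proj (amplify K) (adj \<sigma> h) + \<sigma> (adj \<sigma> h - orth_proj (amplify K) (adj \<sigma> h)) +
      \<iota> (adj \<iota> h - orth_proj K (adj \<iota> h)))"
  by (simp add: triv_map_def blinfun.add_left blinfun.diff_left blinfun.scaleR_left)

text \<open>Write \<open>h = \<iota> a + \<sigma> b\<close>. The part of \<open>a\<close> in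
  \<open>K\<close> goes to the positive part. In the second factor, the part of \<open>b\<close> in
  \<open>amplify K\<close> stays, its complement moves up by one copy, and the part of
  \<open>a\<close> orthogonal to \<open>K\<close> fills the vacated copy 0.\<close>

lemma unitary_triv_map:
  assumes K: "csubspace K" "closed K"
  shows "unitary_onto (J_plus J_std (K \<times> K) \<times> UNIV) (triv_map K)"
  unfolding unitary_onto_def
proof (intro conjI allI)
  note A = amplify_subspace[OF K]
  note cl = clinear_blinfun_add clinear_blinfun_diff clinear_blinfun_compose clinear_blinfun_adj
    clinear_orth_proj[OF K] clinear_orth_proj[OF A] isometry_clinear[OF iota(1)]
    isometry_clinear[OF sigma(1)] clinear_blinfun_id clinear_blinfun_scaleR clinear_blinfun_imul
  show "clinear_blinfun (triv_map K)"
    unfolding triv_map_def by (intro cl clinear_inl_blinfun clinear_inr_blinfun)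
  fix h
  define a where "a = adj \<iota> h"
  define b where "b = adj \<sigma> h"
  define P where "P = orth_proj K"
  define Q where "Q = orth_proj (amplify K)"
  have PQ: "P (P v) = P v" "Q (Q v) = Q v" "inner (v - P v) (P w) = 0" "inner (v - Q v) (Q w) = 0"
    for v w
    by (auto simp: P_def Q_def orth_proj_idem[OF K] orth_proj_idem[OF A]
        orth_proj_orthogonal[OF K orth_proj_mem[OF K]] orth_proj_orthogonal[OF A orth_proj_mem[OF A]])
  have 1: "\<sigma> (b - Q b) = \<sigma> b - Q (\<sigma> b)" "\<iota> (a - P a) = \<iota> a - Q (\<iota> a)"
    by (simp_all add: P_def Q_def amplify_intertwine[OF K] blinfun.diff_right)
  have o1: "inner (Q b) (\<sigma> (b - Q b) + \<iota> (a - P a)) = 0"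
    unfolding 1 inner_add_right using PQ(4) by (simp add: inner_commute)
  have n1: "(norm (\<sigma> (b - Q b) + \<iota> (a - P a)))\<^sup>2 = (norm (b - Q b))\<^sup>2 + (norm (a - P a))\<^sup>2"
    using norm_add_scaleR_square[of "\<sigma> (b - Q b)" 1 "\<iota> (a - P a)"]
    by (simp add: sigma_iota_orthogonal isometry_norm[OF iota(1)] isometry_norm[OF sigma(1)])
  have n2: "(norm (Q b + \<sigma> (b - Q b) + \<iota> (a - P a)))\<^sup>2 = (norm b)\<^sup>2 + (norm (a - P a))\<^sup>2"
    using norm_add_scaleR_square[of "Q b" 1 "\<sigma> (b - Q b) + \<iota> (a - P a)"] o1 n1
      norm_orth_proj_Pythagoras[OF A, of b]
    by (simp add: Q_def add.assoc)
  have "(norm (triv_map K h))\<^sup>2 = (norm (P a))\<^sup>2 + ((norm b)\<^sup>2 + (norm (a - P a))\<^sup>2)"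
    unfolding triv_map_apply n2[symmetric]
    by (simp add: norm_prod_def P_def Q_def a_def b_def power_mult_distrib power_divide add.assoc)
  also have "\<dots> = (norm h)\<^sup>2"
    using norm_split[of h] norm_orth_proj_Pythagoras[OF K, of a] by (simp add: a_def b_def P_def)
  finally show "norm (triv_map K h) = norm h" by simp
next
  note A = amplify_subspace[OF K]
  show "range (triv_map K) = J_plus J_std (K \<times> K) \<times> UNIV"
  proof (intro set_eqI iffI)
    fix p assume "p \<in> range (triv_map K)"
    then obtain h where "p = triv_map K h" by blast
    then show "p \<in> J_plus J_std (K \<times> K) \<times> UNIV"
      unfolding triv_map_apply J_plus_std[OF K(1)]
      using subspace_scale[OF csubspace_imp_subspace[OF K(1)] orth_proj_mem[OF K]]
      by (auto simp: scaleC_scaleR)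
  next
    fix p assume "p \<in> J_plus J_std (K \<times> K) \<times> (UNIV :: 'h set)"
    then obtain \<xi> y where p: "p = ((\<xi>, \<i> *\<^sub>C \<xi>), y)" and \<xi>: "\<xi> \<in> K"
      unfolding J_plus_std[OF K(1)] by auto
    define P where "P = orth_proj K"
    define Q where "Q = orth_proj (amplify K)"
    \<comment> \<open>The component of \<open>y\<close> in copy 0 of the complement. It has to come
      from \<open>a\<close>, whereas the rest of \<open>y\<close> comes from
      \<open>b\<close>.\<close>
    define q where "q = adj \<iota> (y - Q y)"
    \<comment> \<open>The factor \<open>sqrt 2\<close> undoes the normalization of the map to the
      positive part.\<close>
    define a where "a = sqrt 2 *\<^sub>R \<xi> + q"
    define b where "b = Q y + adj \<sigma> (y - Q y)"
    have PQ: "P (P v) = P v" "Q (Q v) = Q v" for v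
      by (auto simp: P_def Q_def orth_proj_idem[OF K] orth_proj_idem[OF A])
    have Pq: "P q = 0"
      by (simp add: q_def P_def amplify_intertwine(4)[OF K] blinfun.diff_right Q_def[symmetric] PQ)
    have Pa: "P a = sqrt 2 *\<^sub>R \<xi>"
      using orth_proj_of_mem[OF K \<xi>] Pq by (simp add: a_def blinfun.add_right blinfun.scaleR_right P_def)
    have Qb: "Q b = Q y"
      by (simp add: b_def blinfun.add_right blinfun.diff_right PQ Q_def amplify_intertwine(2)[OF K]
          orth_proj_idem[OF A])
    have "adj \<iota> (\<iota> a + \<sigma> b) = a" "adj \<sigma> (\<iota> a + \<sigma> b) = b" by (simp_all add: blinfun.add_right)
    then have "triv_map K (\<iota> a + \<sigma> b) =
        (((1 / sqrt 2) *\<^sub>R P a, (1 / sqrt 2) *\<^sub>R \<i> *\<^sub>C P a), Q b + \<sigma> (b - Q b) + \<iota> (a - P a))"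
      by (simp add: triv_map_apply P_def Q_def)
    also have "Q b + \<sigma> (b - Q b) + \<iota> (a - P a) = y"
    proof -
      have "\<sigma> (b - Q b) + \<iota> (a - P a) = \<iota> (adj \<iota> (y - Q y)) + \<sigma> (adj \<sigma> (y - Q y))"
        unfolding Pa Qb by (simp add: a_def b_def q_def)
      then show ?thesis unfolding split_identity Qb by (simp add: add.assoc)
    qed
    also have "((1 / sqrt 2) *\<^sub>R P a, (1 / sqrt 2) *\<^sub>R \<i> *\<^sub>C P a) = (\<xi>, \<i> *\<^sub>C \<xi>)"
      by (simp add: Pa scaleC_scaleR)
    finally show "p \<in> range (triv_map K)" using p by (metis rangeI)
  qed
qed

lemma trivialization_triv_map:
  assumes K: "\<And>x. x \<in> topspace X \<Longrightarrow> csubspace (K x) \<and> closed (K x)"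
    and P: "continuous_map X euclidean (\<lambda>x. orth_proj (K x))"
  shows "trivialization X (\<lambda>x. J_plus J_std (K x \<times> K x)) (\<lambda>x. triv_map (K x))"
proof -
  have amp: "((\<lambda>y. orth_proj (amplify (K y))) \<longlongrightarrow> orth_proj (amplify (K x))) (atin X x)"
    if x: "x \<in> topspace X" for x
  proof -
    have "((\<lambda>y. orth_proj (K y) - orth_proj (K x)) \<longlongrightarrow> orth_proj (K x) - orth_proj (K x)) (atin X x)"
      by (intro tendsto_diff tendsto_const continuous_map_tendsto P x)
    then have "((\<lambda>y. norm (orth_proj (K y) - orth_proj (K x))) \<longlongrightarrow> 0) (atin X x)"
      by (simp add: tendsto_norm_zero)
    moreover have "eventually (\<lambda>y. norm (orth_proj (amplify (K y)) - orth_proj (amplify (K x))) \<le>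
        norm (orth_proj (K y) - orth_proj (K x))) (atin X x)"
      using eventually_atin_topspace
      by eventually_elim (use K x in \<open>auto intro: norm_orth_proj_amplify_diff_le\<close>)
    ultimately have "((\<lambda>y. orth_proj (amplify (K y)) - orth_proj (amplify (K x))) \<longlongrightarrow> 0) (atin X x)"
      by (rule Lim_null_comparison[rotated])
    then show ?thesis by (rule LIM_zero_cancel)
  qed
  have "continuous_map X euclidean (\<lambda>x. triv_map (K x))"
    unfolding continuous_map_atin limitin_canonical_iff triv_map_def
    by (intro ballI tendsto_add tendsto_diff tendsto_const tendsto_blinfun_compose amp
        continuous_map_tendsto[OF P])
  then show ?thesis
    unfolding trivialization_def using unitary_triv_map K by blast
qed

end


section \<open>The unitary of a self-adjoint relation\<close>

text \<open>The Cayley transform of \<open>L\<close> on \<open>K\<close>, extended by 1 to the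
  orthogonal complement. Writing it with the projections onto \<open>L\<close> and \<open>K\<close>
  makes its norm continuity in both immediate.\<close>

definition relation_unitary :: "'h::complex_hilbert set \<Rightarrow> ('h \<times> 'h) set \<Rightarrow> 'h \<Rightarrow>\<^sub>L 'h" where
  "relation_unitary K L =
     ((snd_blinfun - (imul o\<^sub>L fst_blinfun)) o\<^sub>L (orth_proj L o\<^sub>L (inr_blinfun - (inl_blinfun o\<^sub>L imul)))) +
     (id_blinfun - orth_proj K)"

lemma cspan_image_fst: "p \<in> cspan B \<Longrightarrow> fst p \<in> cspan (fst ` B)"
proof -
  have "cspan B \<subseteq> {p. fst p \<in> cspan (fst ` B)}"
  proof (rule complex_vector.span_minimal)
    show "B \<subseteq> {p. fst p \<in> cspan (fst ` B)}"
      using complex_vector.span_superset[of "fst ` B"] by auto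
  qed (simp add: complex_vector.subspace_def complex_vector.span_zero complex_vector.span_add
      complex_vector.span_scale)
  then show "p \<in> cspan B \<Longrightarrow> fst p \<in> cspan (fst ` B)" by blast
qed

lemma cspan_image_snd: "p \<in> cspan B \<Longrightarrow> snd p \<in> cspan (snd ` B)"
proof -
  have "cspan B \<subseteq> {p. snd p \<in> cspan (snd ` B)}"
  proof (rule complex_vector.span_minimal)
    show "B \<subseteq> {p. snd p \<in> cspan (snd ` B)}"
      using complex_vector.span_superset[of "snd ` B"] by auto
  qed (simp add: complex_vector.subspace_def complex_vector.span_zero complex_vector.span_add
      complex_vector.span_scale)
  then show "p \<in> cspan B \<Longrightarrow> snd p \<in> cspan (snd ` B)" by blast
qed

context
  fixes K :: "'h::complex_hilbert set" and L :: "('h \<times> 'h) set"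
  assumes K: "csubspace K" "closed K" and L: "csubspace L" "closed L"
    and lagr: "self_adjoint_relation K L"
begin

lemma relation_eq: "L = {z \<in> K \<times> K. \<forall>w\<in>L. cinner (J_std z) w = 0}"
  using lagr unfolding self_adjoint_relation_def lagrangian_def by blast

lemma relation_subset: "(a, b) \<in> L \<Longrightarrow> a \<in> K \<and> b \<in> K"
  using equalityD1[OF relation_eq, THEN subsetD] by blast

lemma relation_isotropic: "(a, b) \<in> L \<Longrightarrow> w \<in> L \<Longrightarrow> cinner (b, - a) w = 0"
  using equalityD1[OF relation_eq, THEN subsetD, of "(a, b)"] by (simp add: J_std_def)

lemma relation_maximal: "a \<in> K \<Longrightarrow> b \<in> K \<Longrightarrow> (\<And>w. w \<in> L \<Longrightarrow> cinner (b, - a) w = 0) \<Longrightarrow> (a, b) \<in> L"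
  using equalityD2[OF relation_eq, THEN subsetD, of "(a, b)"] by (simp add: J_std_def)

lemmas K_closed_ops = complex_vector.subspace_add[OF K(1)] complex_vector.subspace_diff[OF K(1)]
  complex_vector.subspace_scale[OF K(1)] complex_vector.subspace_neg[OF K(1)] complex_vector.subspace_0[OF K(1)]

lemma inner_relation: "(a, b) \<in> L \<Longrightarrow> inner b (\<i> *\<^sub>C a) = 0"
  using relation_isotropic[of a b "(a, b)"] inner_i_left[of a b]
  by (simp add: cinner_eq_0_iff inner_prod_def inner_commute scaleC_Pair)

text \<open>If \<open>(a, b)\<close> is the projection of \<open>(- c v, v)\<close> to the relation, then the orthogonal component is \<open>J\<close> of
  \<open>(b - v, - c v - a)\<close>, so the latter also lies in the relation. A combination of the two solves the equation.\<close>

lemma relation_surjective: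
  assumes c: "c * c = -1" and v: "v \<in> K"
  shows "\<exists>a b. (a, b) \<in> L \<and> v = b + c *\<^sub>C a"
proof -
  define p where "p = (- (c *\<^sub>C v), v)"
  obtain a b where ab: "orth_proj L p = (a, b)" by fastforce
  have abL: "(a, b) \<in> L" using orth_proj_mem[OF L, of p] ab by simp
  have abK: "a \<in> K" "b \<in> K" using relation_subset[OF abL] by auto
  have iL: "\<i> *\<^sub>C w \<in> L" if "w \<in> L" for w using L(1) that by (simp add: complex_vector.subspace_def)
  have "cinner (p - (a, b)) w = 0" if "w \<in> L" for w
    using orth_proj_orthogonal[OF L that, of p] orth_proj_orthogonal[OF L iL[OF that], of p] ab
    by (simp add: cinner_eq_0_iff)
  then have z: "(b - v, - (c *\<^sub>C v) - a) \<in> L"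
    using v abK by (intro relation_maximal K_closed_ops) (auto simp: p_def)
  let ?d = "(a, b) + c *\<^sub>C (b - v, - (c *\<^sub>C v) - a)"
  have "(1/2) *\<^sub>R ?d \<in> L"
    using abL z L(1) by (intro subspace_scale csubspace_imp_subspace) (auto simp: complex_vector.subspace_def)
  moreover have "snd ?d + c *\<^sub>C fst ?d = 2 *\<^sub>R v"
    by (simp add: scaleC_Pair scaleC_add_right scaleC_diff_right scaleC_scaleC c scaleR_2 complex_vector.scale_one)
  then have "snd ((1/2) *\<^sub>R ?d) + c *\<^sub>C fst ((1/2) *\<^sub>R ?d) = v"
    by (simp add: scaleC_scaleR flip: scaleR_add_right)
  ultimately show ?thesis by (metis surjective_pairing)
qed

text \<open>For \<open>v = b + i a\<close> the vector \<open>(- i v, v)\<close> is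
  \<open>(a, b)\<close> minus \<open>i\<close> times \<open>J (a, b)\<close>, and the latter is
  orthogonal to \<open>L\<close>. The projection onto \<open>L\<close> therefore recovers
  \<open>a\<close> and \<open>b\<close>; the contribution of \<open>k\<close> is orthogonal to
  \<open>K \<times> K\<close>.\<close>

lemma relation_unitary_apply:
  assumes ab: "(a, b) \<in> L" and k: "\<And>s. s \<in> K \<Longrightarrow> inner k s = 0"
  shows "relation_unitary K L (b + \<i> *\<^sub>C a + k) = b - \<i> *\<^sub>C a + k"
proof -
  let ?v = "b + \<i> *\<^sub>C a + k"
  have abK: "a \<in> K" "b \<in> K" using relation_subset[OF ab] by auto
  have "orth_proj L (- (\<i> *\<^sub>C ?v), ?v) = (a, b)"
  proof (rule orth_proj_unique[OF L ab])
    fix s assume s: "s \<in> L"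
    obtain s0 s1 where s01: "s = (s0, s1)" by fastforce
    have sK: "s0 \<in> K" "s1 \<in> K" using relation_subset s s01 by auto
    have "inner b (\<i> *\<^sub>C s0) - inner a (\<i> *\<^sub>C s1) = 0"
      using relation_isotropic[OF ab s] by (simp add: cinner_eq_0_iff s01 scaleC_Pair inner_prod_def)
    moreover have "inner k (\<i> *\<^sub>C s0) = 0" "inner k s1 = 0" using k sK K_closed_ops(3) by auto
    ultimately show "inner ((- (\<i> *\<^sub>C ?v), ?v) - (a, b)) s = 0"
      by (simp add: s01 inner_prod_def inner_diff_left inner_add_left inner_i_left scaleC_add_right)
  qed
  moreover have "orth_proj K ?v = b + \<i> *\<^sub>C a"
    by (rule orth_proj_unique[OF K]) (auto intro!: K_closed_ops abK k)
  ultimately show ?thesis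
    by (simp add: relation_unitary_def blinfun.add_left blinfun.diff_left blinfun.diff_right)
qed

lemma relation_decomposition:
  obtains a b k where "v = b + \<i> *\<^sub>C a + k" "(a, b) \<in> L" "\<And>s. s \<in> K \<Longrightarrow> inner k s = 0" "orth_proj K v = b + \<i> *\<^sub>C a"
proof -
  obtain a b where "(a, b) \<in> L" "orth_proj K v = b + \<i> *\<^sub>C a"
    using relation_surjective[of \<i> "orth_proj K v"] orth_proj_mem[OF K] by auto
  then show ?thesis
    using that[of b a "v - orth_proj K v", OF _ _ orth_proj_orthogonal[OF K]] by simp
qed

lemma relation_norm:
  assumes ab: "(a, b) \<in> L" and k: "\<And>s. s \<in> K \<Longrightarrow> inner k s = 0"
  shows "(norm (b + \<i> *\<^sub>C a + k))\<^sup>2 = (norm a)\<^sup>2 + (norm b)\<^sup>2 + (norm k)\<^sup>2"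
    and "(norm (b - \<i> *\<^sub>C a + k))\<^sup>2 = (norm a)\<^sup>2 + (norm b)\<^sup>2 + (norm k)\<^sup>2"
proof -
  have abK: "a \<in> K" "b \<in> K" using relation_subset[OF ab] by auto
  have "inner k b = 0" "inner k (\<i> *\<^sub>C a) = 0" using k abK K_closed_ops by auto
  then show "(norm (b + \<i> *\<^sub>C a + k))\<^sup>2 = (norm a)\<^sup>2 + (norm b)\<^sup>2 + (norm k)\<^sup>2"
    "(norm (b - \<i> *\<^sub>C a + k))\<^sup>2 = (norm a)\<^sup>2 + (norm b)\<^sup>2 + (norm k)\<^sup>2"
    using norm_add_scaleR_square[of b 1 "\<i> *\<^sub>C a"] norm_add_scaleR_square[of b "-1" "\<i> *\<^sub>C a"]
      norm_add_scaleR_square[of "b + \<i> *\<^sub>C a" 1 k] norm_add_scaleR_square[of "b - \<i> *\<^sub>C a" 1 k]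
      inner_relation[OF ab]
    by (simp_all add: inner_commute[of _ k] inner_add_right inner_diff_right)
qed

lemma unitary_relation_unitary: "unitary_onto UNIV (relation_unitary K L)"
  unfolding unitary_onto_def
proof (intro conjI allI)
  show "clinear_blinfun (relation_unitary K L)"
    unfolding relation_unitary_def
    by (intro clinear_blinfun_add clinear_blinfun_diff clinear_blinfun_compose clinear_orth_proj K L)
      (simp_all add: clinear_blinfun_def scaleC_Pair scaleC_scaleC mult.commute)
  show "norm (relation_unitary K L v) = norm v" for v
  proof -
    obtain a b k where v: "v = b + \<i> *\<^sub>C a + k" "(a, b) \<in> L" "\<And>s. s \<in> K \<Longrightarrow> inner k s = 0"
      using relation_decomposition by metis
    have "(norm (relation_unitary K L v))\<^sup>2 = (norm v)\<^sup>2"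
      unfolding v(1) by (simp only: relation_unitary_apply[OF v(2,3)] relation_norm[OF v(2,3)])
    then show ?thesis by simp
  qed
  have "y \<in> range (relation_unitary K L)" for y
  proof -
    obtain a b where ab: "(a, b) \<in> L" "orth_proj K y = b + (- \<i>) *\<^sub>C a"
      using relation_surjective[of "- \<i>" "orth_proj K y"] orth_proj_mem[OF K] by auto
    have "relation_unitary K L (b + \<i> *\<^sub>C a + (y - orth_proj K y)) = y"
      using relation_unitary_apply[OF ab(1), of "y - orth_proj K y", OF orth_proj_orthogonal[OF K]] ab(2)
      by simp
    then show ?thesis by (metis rangeI)
  qed
  then show "range (relation_unitary K L) = UNIV" by blast
qed

text \<open>Solves \<open>v = b + i a + k\<close> and \<open>c v = b - i a + k\<close> for
  \<open>a\<close> and \<open>b + k\<close>; the factor \<open>- i / 2\<close> is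
  \<open>1 / (2 i)\<close>. The left-hand side is \<open>L\<close> with the complement of
  \<open>K\<close> added as multivalued part, on which a Cayley transform is 1.\<close>

lemma relation_unitary_graph:
  "{(\<xi>, \<eta>). (\<xi>, orth_proj K \<eta>) \<in> L} =
   {((- \<i> / 2) *\<^sub>C (v - relation_unitary K L v), (1/2) *\<^sub>C (v + relation_unitary K L v)) |v. True}"
proof -
  have h: "(1/2) *\<^sub>C x = (1/2) *\<^sub>R x" for x :: 'h using scaleC_of_real[of "1/2" x] by simp
  have mh: "(- \<i> / 2) *\<^sub>C (\<i> *\<^sub>C x + \<i> *\<^sub>C x) = x" for x :: 'h
  proof -
    have "(- \<i> / 2) *\<^sub>C (\<i> *\<^sub>C x + \<i> *\<^sub>C x) = ((- \<i> / 2) * \<i> + (- \<i> / 2) * \<i>) *\<^sub>C x"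
      by (simp only: scaleC_add_right scaleC_scaleC scaleC_add_left)
    then show ?thesis using scaleC_of_real[of 1 x] by simp
  qed
  have split: "(- \<i> / 2) *\<^sub>C (v - relation_unitary K L v) = a \<and> (1/2) *\<^sub>C (v + relation_unitary K L v) = b + k"
    if "(a, b) \<in> L" "\<And>s. s \<in> K \<Longrightarrow> inner k s = 0" "v = b + \<i> *\<^sub>C a + k" for a b k v
  proof -
    have "v - relation_unitary K L v = \<i> *\<^sub>C a + \<i> *\<^sub>C a" "v + relation_unitary K L v = 2 *\<^sub>R (b + k)"
      using relation_unitary_apply[OF that(1,2)] that(3) by (simp_all add: scaleR_2)
    then show ?thesis by (simp only: mh) (simp add: h)
  qed
  have P: "orth_proj K (b + k) = b" if "(a, b) \<in> L" "\<And>s. s \<in> K \<Longrightarrow> inner k s = 0" for a b k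
    by (rule orth_proj_unique[OF K]) (use that relation_subset in auto)
  show ?thesis
  proof (intro set_eqI iffI)
    fix p assume "p \<in> {(\<xi>, \<eta>). (\<xi>, orth_proj K \<eta>) \<in> L}"
    then obtain \<xi> \<eta> where p: "p = (\<xi>, \<eta>)" "(\<xi>, orth_proj K \<eta>) \<in> L" by blast
    have orth: "\<And>s. s \<in> K \<Longrightarrow> inner (\<eta> - orth_proj K \<eta>) s = 0" by (rule orth_proj_orthogonal[OF K])
    have "p = ((- \<i> / 2) *\<^sub>C (v - relation_unitary K L v), (1/2) *\<^sub>C (v + relation_unitary K L v))"
      if "v = orth_proj K \<eta> + \<i> *\<^sub>C \<xi> + (\<eta> - orth_proj K \<eta>)" for v
      using split[OF p(2) orth that] p(1) by simp
    then show "p \<in> {((- \<i> / 2) *\<^sub>C (v - relation_unitary K L v), (1/2) *\<^sub>C (v + relation_unitary K L v)) |v. True}"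
      by blast
  next
    fix p assume "p \<in> {((- \<i> / 2) *\<^sub>C (v - relation_unitary K L v), (1/2) *\<^sub>C (v + relation_unitary K L v)) |v. True}"
    then obtain v where p: "p = ((- \<i> / 2) *\<^sub>C (v - relation_unitary K L v), (1/2) *\<^sub>C (v + relation_unitary K L v))"
      by blast
    obtain a b k where v: "v = b + \<i> *\<^sub>C a + k" "(a, b) \<in> L" "\<And>s. s \<in> K \<Longrightarrow> inner k s = 0"
      using relation_decomposition by metis
    have "p = (a, b + k)" using split[OF v(2,3,1)] p by simp
    then show "p \<in> {(\<xi>, \<eta>). (\<xi>, orth_proj K \<eta>) \<in> L}" using P[OF v(2,3)] v(2) by simp
  qed
qed

text \<open>Adding 1 sends \<open>b + i a + k\<close> to \<open>2 (b + k)\<close>. The kernel thus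
  corresponds to the intersection of \<open>L\<close> with \<open>K \<times> {0}\<close>, and the
  range consists of the second components of \<open>L + K \<times> {0}\<close> plus the complement
  of \<open>K\<close>.\<close>

lemma relation_unitary_in_UF:
  assumes F: "Fredholm_relation K L"
  shows "relation_unitary K L \<in> UF"
proof -
  let ?c = "relation_unitary K L"
  define Z where "Z = {l + m | l m. l \<in> L \<and> m \<in> K \<times> {0}}"
  have cl: "closed Z" and fin: "finite_cdim (L \<inter> K \<times> {0})" and cofin: "finite_ccodim_in (K \<times> K) Z"
    using F unfolding Fredholm_relation_def Fredholm_pair_def Z_def by auto
  have sum: "(?c + id_blinfun) (b + \<i> *\<^sub>C a + k) = 2 *\<^sub>R (b + k)"
    if "(a, b) \<in> L" "\<And>s. s \<in> K \<Longrightarrow> inner k s = 0" for a b k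
    using relation_unitary_apply[OF that] by (simp add: blinfun.add_left scaleR_2)
  have Z_iff: "(0, y) \<in> Z \<longleftrightarrow> (\<exists>a. (a, y) \<in> L)" for y
  proof
    assume "(0, y) \<in> Z"
    then show "\<exists>a. (a, y) \<in> L" unfolding Z_def by force
  next
    assume "\<exists>a. (a, y) \<in> L"
    then obtain a where a: "(a, y) \<in> L" by blast
    then have "(- a, 0) \<in> K \<times> {0}" using relation_subset K_closed_ops by auto
    moreover have "(0, y) = (a, y) + (- a, 0)" by simp
    ultimately show "(0, y) \<in> Z" using a unfolding Z_def by blast
  qed
  have ran: "range (?c + id_blinfun) = {y. (0, orth_proj K y) \<in> Z}"
  proof (intro set_eqI iffI)
    fix y assume "y \<in> range (?c + id_blinfun)"
    then obtain v where y: "y = (?c + id_blinfun) v" by blast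
    obtain a b k where v: "v = b + \<i> *\<^sub>C a + k" "(a, b) \<in> L" "\<And>s. s \<in> K \<Longrightarrow> inner k s = 0"
      using relation_decomposition by metis
    have y2: "y = 2 *\<^sub>R b + 2 *\<^sub>R k" unfolding y v(1) by (simp add: sum[OF v(2,3)] scaleR_add_right del: blinfun.add_left)
    have b2: "2 *\<^sub>R (a, b) \<in> L" by (rule subspace_scale[OF csubspace_imp_subspace[OF L(1)] v(2)])
    then have "orth_proj K y = 2 *\<^sub>R b"
      using relation_subset[of "2 *\<^sub>R a" "2 *\<^sub>R b"] y2 v(3)
      by (intro orth_proj_unique[OF K]) auto
    then show "y \<in> {y. (0, orth_proj K y) \<in> Z}" using b2 unfolding mem_Collect_eq Z_iff by auto
  next
    fix y assume "y \<in> {y. (0, orth_proj K y) \<in> Z}"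
    then obtain a where a: "(a, orth_proj K y) \<in> L" unfolding Z_iff by blast
    have a2: "((1/2) *\<^sub>R a, (1/2) *\<^sub>R orth_proj K y) \<in> L"
      using subspace_scale[OF csubspace_imp_subspace[OF L(1)] a, of "1/2"] by simp
    have "inner ((1/2) *\<^sub>R (y - orth_proj K y)) s = 0" if "s \<in> K" for s
      using orth_proj_orthogonal[OF K that] by simp
    from sum[OF a2 this]
    have "(?c + id_blinfun) ((1/2) *\<^sub>R orth_proj K y + \<i> *\<^sub>C (1/2) *\<^sub>R a + (1/2) *\<^sub>R (y - orth_proj K y)) = y"
      by (simp flip: scaleR_add_right)
    then show "y \<in> range (?c + id_blinfun)" by (metis rangeI)
  qed
  have "finite_cdim {v. (?c + id_blinfun) v = 0}"
  proof -
    obtain B where B: "finite B" "L \<inter> K \<times> {0} \<subseteq> cspan B" using fin unfolding finite_cdim_def by blast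
    have "v \<in> cspan (fst ` B)" if "(?c + id_blinfun) v = 0" for v
    proof -
      obtain a b k where v: "v = b + \<i> *\<^sub>C a + k" "(a, b) \<in> L" "\<And>s. s \<in> K \<Longrightarrow> inner k s = 0"
        using relation_decomposition by metis
      have "2 *\<^sub>R (b + k) = 0" using sum[OF v(2,3)] that v(1) by simp
      then have bk: "b + k = 0" by simp
      have abK: "a \<in> K" "b \<in> K" using relation_subset[OF v(2)] by auto
      have "inner (b + k) b = inner b b" using v(3)[OF abK(2)] by (simp add: inner_add_left)
      then have "b = 0" using bk by simp
      then have "(a, b) \<in> L \<inter> K \<times> {0}" using v(2) abK by simp
      then have "a \<in> cspan (fst ` B)" using B(2) cspan_image_fst[of "(a, b)" B] by auto
      then show ?thesis using v(1) \<open>b = 0\<close> bk by (simp add: complex_vector.span_scale)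
    qed
    then show ?thesis unfolding finite_cdim_def using B(1) by blast
  qed
  moreover have "closed (range (?c + id_blinfun))"
  proof -
    have "{y. (0, orth_proj K y) \<in> Z} = (inr_blinfun o\<^sub>L orth_proj K) -` Z" by auto
    moreover have "closed ((inr_blinfun o\<^sub>L orth_proj K) -` Z)"
      by (rule continuous_closed_vimage[OF cl]) (rule linear_continuous_at[OF blinfun.bounded_linear_right])
    ultimately show ?thesis unfolding ran by simp
  qed
  moreover have "finite_ccodim_in UNIV (range (?c + id_blinfun))"
  proof -
    obtain B where B: "finite B" "cspan (Z \<union> B) = K \<times> K" using cofin unfolding finite_ccodim_in_def by blast
    let ?R = "range (?c + id_blinfun)"
    have sndZ: "snd ` Z \<subseteq> ?R"
    proof
      fix y assume "y \<in> snd ` Z"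
      then obtain a where a: "(a, y) \<in> L" unfolding Z_def by force
      then have "orth_proj K y = y" using relation_subset orth_proj_of_mem[OF K] by blast
      then show "y \<in> ?R" using a Z_iff unfolding ran by auto
    qed
    have "y \<in> cspan (?R \<union> snd ` B)" for y
    proof -
      have "(0, orth_proj K y) \<in> cspan (Z \<union> B)" unfolding B(2) using K_closed_ops orth_proj_mem[OF K] by simp
      then have "orth_proj K y \<in> cspan (snd ` (Z \<union> B))" using cspan_image_snd by fastforce
      moreover have "snd ` (Z \<union> B) \<subseteq> ?R \<union> snd ` B" using sndZ by auto
      ultimately have 1: "orth_proj K y \<in> cspan (?R \<union> snd ` B)" using complex_vector.span_mono by blast
      have "orth_proj K (y - orth_proj K y) = 0"
        by (rule orth_proj_of_orthogonal[OF K]) (rule orth_proj_orthogonal[OF K])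
      moreover have "(0, 0) \<in> Z" unfolding Z_iff using complex_vector.subspace_0[OF L(1)] by (auto simp: zero_prod_def)
      ultimately have "y - orth_proj K y \<in> ?R" unfolding ran by simp
      then have 2: "y - orth_proj K y \<in> cspan (?R \<union> snd ` B)" by (intro complex_vector.span_base) blast
      show ?thesis using complex_vector.span_add[OF 1 2] by simp
    qed
    then show ?thesis
      unfolding finite_ccodim_in_def using B(1) by (intro exI[of _ "snd ` B"]) auto
  qed
  ultimately show ?thesis
    unfolding UF_def Fredholm_blinfun_def using unitary_relation_unitary by blast
qed

lemma relation_unitary_preserves:
  "orth_proj K (relation_unitary K L v) = relation_unitary K L (orth_proj K v)"
  "relation_unitary K L v - relation_unitary K L (orth_proj K v) = v - orth_proj K v"
proof -
  obtain a b k where v: "v = b + \<i> *\<^sub>C a + k" "(a, b) \<in> L" "\<And>s. s \<in> K \<Longrightarrow> inner k s = 0" "orth_proj K v = b + \<i> *\<^sub>C a"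
    using relation_decomposition by metis
  have abK: "a \<in> K" "b \<in> K" using relation_subset[OF v(2)] by auto
  have 1: "relation_unitary K L v = b - \<i> *\<^sub>C a + k" unfolding v(1) by (rule relation_unitary_apply[OF v(2,3)])
  have 2: "relation_unitary K L (orth_proj K v) = b - \<i> *\<^sub>C a"
    using relation_unitary_apply[OF v(2), of 0] by (simp add: v(4))
  show "orth_proj K (relation_unitary K L v) = relation_unitary K L (orth_proj K v)"
    unfolding 1 2 by (rule orth_proj_unique[OF K]) (auto intro!: K_closed_ops abK v(3))
  have "relation_unitary K L v - relation_unitary K L (orth_proj K v) = k" unfolding 1 2 by simp
  moreover have "v - orth_proj K v = k" unfolding v(4) by (simp add: v(1))
  ultimately show "relation_unitary K L v - relation_unitary K L (orth_proj K v) = v - orth_proj K v" by simp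
qed

text \<open>Writing \<open>\<xi> = b + i a\<close> with \<open>(a, b)\<close> in \<open>L\<close>,
  the vector and its claimed image add up to \<open>2 i (a, b)\<close>, which lies in
  \<open>L\<close>.\<close>

lemma lagrangian_unitary_relation:
  assumes \<xi>: "\<xi> \<in> K"
  shows "lagrangian_unitary J_std (K \<times> K) L (\<xi>, \<i> *\<^sub>C \<xi>) =
    (- relation_unitary K L \<xi>, \<i> *\<^sub>C relation_unitary K L \<xi>)"
  unfolding lagrangian_unitary_def J_minus_std[OF K(1)]
proof (rule the_equality)
  let ?c = "relation_unitary K L"
  have c: "?c (b + \<i> *\<^sub>C a) = b - \<i> *\<^sub>C a" if "(a, b) \<in> L" for a b
    using relation_unitary_apply[OF that, of 0] by simp
  have PK: "?c \<xi> \<in> K" using relation_unitary_preserves(1)[of \<xi>] orth_proj_mem[OF K] orth_proj_of_mem[OF K \<xi>] by metis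
  obtain a b where ab: "(a, b) \<in> L" "\<xi> = b + \<i> *\<^sub>C a" using relation_surjective[of \<i>, OF _ \<xi>] by auto
  have "(\<xi>, \<i> *\<^sub>C \<xi>) + (- ?c \<xi>, \<i> *\<^sub>C ?c \<xi>) = (2 * \<i>) *\<^sub>C (a, b)"
  proof -
    have d: "(2 * \<i>) *\<^sub>C x = \<i> *\<^sub>C x + \<i> *\<^sub>C x" for x :: 'h
      by (simp add: scaleC_add_left[symmetric])
    show ?thesis using c[OF ab(1)] by (simp add: ab(2) scaleC_Pair d scaleC_add_right scaleC_diff_right)
  qed
  then show "(- ?c \<xi>, \<i> *\<^sub>C ?c \<xi>) \<in> {(\<xi>, - \<i> *\<^sub>C \<xi>) |\<xi>. \<xi> \<in> K} \<and> (\<xi>, \<i> *\<^sub>C \<xi>) + (- ?c \<xi>, \<i> *\<^sub>C ?c \<xi>) \<in> L"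
    using ab(1) L(1) K_closed_ops(4)[OF PK] by (auto simp: complex_vector.subspace_def)
  fix w assume w: "w \<in> {(\<xi>, - \<i> *\<^sub>C \<xi>) |\<xi>. \<xi> \<in> K} \<and> (\<xi>, \<i> *\<^sub>C \<xi>) + w \<in> L"
  then obtain \<eta> where \<eta>: "w = (\<eta>, - (\<i> *\<^sub>C \<eta>))" by auto
  then have "(\<xi> + \<eta>, \<i> *\<^sub>C \<xi> - \<i> *\<^sub>C \<eta>) \<in> L" using w by simp
  from c[OF this] have "?c (\<i> *\<^sub>C \<xi> + \<i> *\<^sub>C \<xi>) = - (\<i> *\<^sub>C \<eta> + \<i> *\<^sub>C \<eta>)"
    by (simp add: scaleC_add_right)
  moreover have "?c (\<i> *\<^sub>C \<xi> + \<i> *\<^sub>C \<xi>) = \<i> *\<^sub>C ?c \<xi> + \<i> *\<^sub>C ?c \<xi>"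
    using clinear_blinfunD[OF unitary_clinear[OF unitary_relation_unitary]] by (simp add: blinfun.add_right)
  ultimately have "2 *\<^sub>R \<i> *\<^sub>C ?c \<xi> = 2 *\<^sub>R (- (\<i> *\<^sub>C \<eta>))" by (simp add: scaleR_2)
  then have e: "\<i> *\<^sub>C ?c \<xi> = - (\<i> *\<^sub>C \<eta>)" unfolding real_vector.scale_cancel_left by simp
  then have "\<i> *\<^sub>C \<i> *\<^sub>C ?c \<xi> = \<i> *\<^sub>C (- (\<i> *\<^sub>C \<eta>))" by simp
  then have "\<eta> = - ?c \<xi>" by simp
  then show "w = (- ?c \<xi>, \<i> *\<^sub>C ?c \<xi>)" using \<eta> by simp
qed

end

section \<open>Adding a bounded self-adjoint operator to the inverse\<close>

text \<open>Let \<open>c\<close> be the Cayley transform of a self-adjoint relation \<open>\<Lambda>\<close>, so that \<open>\<Lambda>\<close> consists of the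
  pairs \<open>((v - c v) / 2i, (v + c v) / 2)\<close>. The Cayley transform of the sheared relation
  \<open>{(\<xi> + t R \<eta>, \<eta>) | (\<xi>, \<eta>) \<in> \<Lambda>}\<close> is \<open>shear_unitary R c t\<close>.\<close>

definition shear_denominator :: "('h::complex_hilbert \<Rightarrow>\<^sub>L 'h) \<Rightarrow> ('h \<Rightarrow>\<^sub>L 'h) \<Rightarrow> real \<Rightarrow> 'h \<Rightarrow>\<^sub>L 'h" where
  "shear_denominator R c t = id_blinfun + (t / 2) *\<^sub>R (imul o\<^sub>L (R o\<^sub>L (id_blinfun + c)))"

definition shear_unitary :: "('h::complex_hilbert \<Rightarrow>\<^sub>L 'h) \<Rightarrow> ('h \<Rightarrow>\<^sub>L 'h) \<Rightarrow> real \<Rightarrow> 'h \<Rightarrow>\<^sub>L 'h" where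
  "shear_unitary R c t = ((id_blinfun + c) o\<^sub>L blinfun_inverse (shear_denominator R c t)) - id_blinfun"

lemma shear_denominator_apply:
  "shear_denominator R c t v = v + (t / 2) *\<^sub>R \<i> *\<^sub>C R (v + c v)"
  by (simp add: shear_denominator_def blinfun.add_left blinfun.scaleR_left blinfun.add_right)

lemma inner_i_symmetric: "adj R = R \<Longrightarrow> clinear_blinfun R \<Longrightarrow> inner x (\<i> *\<^sub>C R x) = 0"
  for R :: "'h::complex_hilbert \<Rightarrow>\<^sub>L 'h"
proof -
  assume R: "adj R = R" "clinear_blinfun R"
  have "inner x (\<i> *\<^sub>C R x) = inner x (R (\<i> *\<^sub>C x))" using R(2) by (simp add: clinear_blinfun_def)
  also have "\<dots> = inner (R x) (\<i> *\<^sub>C x)" using inner_symmetric[OF R(1)] by simp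
  also have "\<dots> = - inner x (\<i> *\<^sub>C R x)" using inner_i_left[of x "R x"] by (simp add: inner_commute)
  finally show ?thesis by simp
qed

context
  fixes R c :: "'h::complex_hilbert \<Rightarrow>\<^sub>L 'h"
  assumes R: "adj R = R" "clinear_blinfun R" and c: "unitary_onto UNIV c"
begin

text \<open>\<open>\<eta>\<close> is the second component of the sheared pair and \<open>w\<close>
  is \<open>i\<close> times its first. Symmetry of the relation and of \<open>R\<close> makes them
  orthogonal for the real inner product, so \<open>\<eta> + w\<close> and \<open>\<eta> - w\<close>,
  which the Cayley transform relates, have equal norm.\<close>

lemma shear_vectors:
  fixes v :: 'h and t :: real
  defines "\<eta> \<equiv> (1/2) *\<^sub>R (v + c v)" and "w \<equiv> (1/2) *\<^sub>R (v - c v) + t *\<^sub>R \<i> *\<^sub>C R ((1/2) *\<^sub>R (v + c v))"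
  shows "shear_denominator R c t v = \<eta> + w" "inner \<eta> w = 0"
    "(norm (\<eta> + w))\<^sup>2 = (norm \<eta>)\<^sup>2 + (norm w)\<^sup>2" "(norm (\<eta> - w))\<^sup>2 = (norm \<eta>)\<^sup>2 + (norm w)\<^sup>2"
proof -
  have "(1/2) *\<^sub>R (v + c v) + (1/2) *\<^sub>R (v - c v) = v"
    by (simp add: scaleR_2[symmetric] flip: scaleR_add_right)
  then show 1: "shear_denominator R c t v = \<eta> + w"
    by (simp add: shear_denominator_apply \<eta>_def w_def blinfun.scaleR_right scaleC_scaleR add.assoc[symmetric]
        del: scaleR_add_right)
  have "inner (v + c v) (v - c v) = 0"
    using inner_commute[of v "c v"] by (simp add: inner_add_left inner_diff_right unitary_inner[OF c])
  then show 2: "inner \<eta> w = 0"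
    using inner_i_symmetric[OF R, of \<eta>] by (simp add: w_def \<eta>_def inner_add_right del: inner_add_left)
  show "(norm (\<eta> + w))\<^sup>2 = (norm \<eta>)\<^sup>2 + (norm w)\<^sup>2" "(norm (\<eta> - w))\<^sup>2 = (norm \<eta>)\<^sup>2 + (norm w)\<^sup>2"
    using norm_add_scaleR_square[of \<eta> 1 w] norm_add_scaleR_square[of \<eta> "-1" w] 2 by simp_all
qed

text \<open>Both \<open>\<eta>\<close> and \<open>w\<close> are bounded by the norm of their sum,
  and \<open>v = \<eta> + w - t i R \<eta>\<close>.\<close>

lemma norm_shear_denominator: "norm v \<le> (2 + \<bar>t\<bar> * norm R) * norm (shear_denominator R c t v)"
proof -
  define \<eta> where "\<eta> = (1/2) *\<^sub>R (v + c v)"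
  define w where "w = (1/2) *\<^sub>R (v - c v) + t *\<^sub>R \<i> *\<^sub>C R \<eta>"
  note s = shear_vectors[where t=t and v=v, folded \<eta>_def, folded w_def]
  let ?n = "norm (shear_denominator R c t v)"
  have "(norm \<eta>)\<^sup>2 \<le> ?n\<^sup>2" "(norm w)\<^sup>2 \<le> ?n\<^sup>2" unfolding s(1,3) by simp_all
  then have le: "norm \<eta> \<le> ?n" "norm w \<le> ?n" using power2_le_imp_le norm_ge_zero by blast+
  have "v = \<eta> + (w - t *\<^sub>R \<i> *\<^sub>C R \<eta>)"
    by (simp add: w_def \<eta>_def scaleR_2[symmetric] flip: scaleR_add_right)
  then have "norm v \<le> norm \<eta> + (norm w + norm (t *\<^sub>R \<i> *\<^sub>C R \<eta>))"
    by (metis add_left_mono norm_triangle_ineq norm_triangle_ineq4 order_trans)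
  also have "norm (t *\<^sub>R \<i> *\<^sub>C R \<eta>) \<le> \<bar>t\<bar> * (norm R * ?n)"
    using order_trans[OF norm_blinfun[of R \<eta>] mult_left_mono[OF le(1)]] by (simp add: mult_left_mono)
  finally show ?thesis using le by (simp add: algebra_simps)
qed

text \<open>If the adjoint kills \<open>v\<close>, then \<open>v\<close> is \<open>t / 2\<close>
  times \<open>r + adj c r\<close> for \<open>r = i R v\<close>, and \<open>v\<close> is orthogonal
  to \<open>r\<close>. Since the squared norm of \<open>r + adj c r\<close> is twice its inner
  product with \<open>r\<close>, either \<open>t = 0\<close> or that vector vanishes; in both cases
  \<open>v = 0\<close>.\<close>

lemma invertible_shear_denominator: "invertible_blinfun (shear_denominator R c t)"
proof (rule invertible_blinfunI)
  have pos: "0 < 2 + \<bar>t\<bar> * norm R" by (intro add_pos_nonneg) simp_all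
  then show "0 < 1 / (2 + \<bar>t\<bar> * norm R)" by simp
  show "1 / (2 + \<bar>t\<bar> * norm R) * norm v \<le> norm (shear_denominator R c t v)" for v
    using norm_shear_denominator[of v t] pos by (simp add: field_simps)
  fix v assume v: "adj (shear_denominator R c t) v = 0"
  have ai: "adj (imul :: 'h \<Rightarrow>\<^sub>L 'h) x = - (\<i> *\<^sub>C x)" for x
    by (rule inner_eqI) (simp add: inner_adj inner_i_left)
  define r where "r = \<i> *\<^sub>C R v"
  have "adj (shear_denominator R c t) v = v - (t / 2) *\<^sub>R (r + adj c r)"
    using R(2)
    by (simp add: shear_denominator_def adj_add adj_scaleR adj_compose R(1) ai blinfun.add_left
        blinfun.scaleR_left r_def clinear_blinfun_def blinfun.minus_right blinfun.add_right algebra_simps)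
  then have veq: "v = (t / 2) *\<^sub>R (r + adj c r)" using v by simp
  have "inner v r = 0" unfolding r_def by (rule inner_i_symmetric[OF R])
  then have "t / 2 * inner (r + adj c r) r = 0" by (subst (asm) veq) simp
  then have "t = 0 \<or> inner r r + inner (c r) r = 0"
    using inner_commute[of r "c r"] by (auto simp: inner_add_left inner_adj_left)
  moreover have "(norm (r + adj c r))\<^sup>2 = 2 * (inner r r + inner (c r) r)"
    using norm_add_scaleR_square[of r 1 "adj c r"] unitary_norm[OF unitary_adj[OF c], of r]
    by (simp add: inner_adj power2_norm_eq_inner)
  ultimately have "t = 0 \<or> (norm (r + adj c r))\<^sup>2 = 0" by argo
  then show "v = 0" using veq by auto
qed

lemma shear_unitary_apply:
  "shear_unitary R c t (shear_denominator R c t v) = v + c v - shear_denominator R c t v"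
  by (simp add: shear_unitary_def blinfun.diff_left blinfun.add_left
      blinfun_inverse_left[OF invertible_shear_denominator])

lemma shear_unitary_0: "shear_unitary R c 0 = c"
proof (rule blinfun_eqI)
  show "shear_unitary R c 0 v = c v" for v
    using shear_unitary_apply[of 0 v] by (simp add: shear_denominator_apply)
qed

end

lemma unitary_shear_unitary:
  fixes R c :: "'h::complex_hilbert \<Rightarrow>\<^sub>L 'h"
  assumes R: "adj R = R" "clinear_blinfun R" and c: "unitary_onto UNIV c"
  shows "unitary_onto UNIV (shear_unitary R c t)"
proof -
  let ?N = "shear_denominator R c t" and ?U = "shear_unitary R c t"
  note inv = invertible_shear_denominator[OF R c]
  have "clinear_blinfun ?N"
    unfolding shear_denominator_def
    by (intro clinear_blinfun_add clinear_blinfun_scaleR clinear_blinfun_compose unitary_clinear[OF c]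
        clinear_blinfun_id clinear_blinfun_imul R)
  then have "clinear_blinfun ?U"
    unfolding shear_unitary_def
    by (intro clinear_blinfun_add clinear_blinfun_diff clinear_blinfun_compose unitary_clinear[OF c]
        clinear_blinfun_id clinear_blinfun_inverse inv)
  moreover have "norm (?U v) = norm v" for v
  proof -
    define x where "x = blinfun_inverse ?N v"
    have Nx: "?N x = v" by (simp add: x_def blinfun_inverse_right[OF inv])
    define \<eta> where "\<eta> = (1/2) *\<^sub>R (x + c x)"
    define w where "w = (1/2) *\<^sub>R (x - c x) + t *\<^sub>R \<i> *\<^sub>C R \<eta>"
    note s = shear_vectors[OF R c, where t=t and v=x, folded \<eta>_def, folded w_def]
    have "x + c x = 2 *\<^sub>R \<eta>" by (simp add: \<eta>_def)
    then have "?U v = \<eta> - w" using shear_unitary_apply[OF R c, of t x] s(1) Nx by (simp add: scaleR_2)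
    then have "(norm (?U v))\<^sup>2 = (norm v)\<^sup>2" using s Nx by simp
    then show ?thesis by simp
  qed
  moreover have "y \<in> range ?U" for y
  proof -
    \<comment> \<open>Passing to \<open>adj c\<close> and \<open>- t\<close> keeps
      \<open>\<eta>\<close> and reverses the sign of \<open>w\<close>, so the denominator of the
      reversed data is \<open>\<eta> - w\<close>. Inverting it gives the preimage.\<close>
    define z where "z = blinfun_inverse (shear_denominator R (adj c) (- t)) y"
    have z: "shear_denominator R (adj c) (- t) z = y"
      by (simp add: z_def blinfun_inverse_right[OF invertible_shear_denominator[OF R unitary_adj[OF c]]])
    have "?U (?N (adj c z)) = y"
      using z unfolding shear_unitary_apply[OF R c]
      by (simp add: shear_denominator_apply unitary_adj_right[OF c] add.commute)
    then show ?thesis by (metis rangeI)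
  qed
  ultimately show ?thesis unfolding unitary_onto_def by blast
qed

text \<open>The shear unitary plus 1, composed with the denominator, is exactly
  \<open>1 + c\<close>, so the criterion holds with equality.\<close>

lemma shear_unitary_in_UF:
  fixes R c :: "'h::complex_hilbert \<Rightarrow>\<^sub>L 'h"
  assumes R: "adj R = R" "clinear_blinfun R" and c: "c \<in> UF"
  shows "shear_unitary R c t \<in> UF"
proof -
  have cu: "unitary_onto UNIV c" using c by (simp add: UF_iff)
  obtain e where e: "0 < e" "essentially_bounded_below e (c + id_blinfun)" using c by (auto simp: UF_iff)
  show ?thesis
  proof (rule UF_of_compose[OF e unitary_shear_unitary[OF R cu] invertible_shear_denominator[OF R cu]])
    show "norm ((c + id_blinfun) v) \<le> norm ((shear_unitary R c t + id_blinfun) (shear_denominator R c t v))" for v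
      by (simp add: shear_unitary_apply[OF R cu] blinfun.add_left add.commute)
  qed
qed

lemma tendsto_shear_unitary:
  fixes R c :: "'x \<Rightarrow> 'h::complex_hilbert \<Rightarrow>\<^sub>L 'h"
  assumes lim: "(R \<longlongrightarrow> R0) F" "(c \<longlongrightarrow> c0) F" "(t \<longlongrightarrow> t0) F"
    and ev: "eventually (\<lambda>x. adj (R x) = R x \<and> clinear_blinfun (R x) \<and> unitary_onto UNIV (c x)) F"
    and R0: "adj R0 = R0" "clinear_blinfun R0" "unitary_onto UNIV c0"
  shows "((\<lambda>x. shear_unitary (R x) (c x) (t x)) \<longlongrightarrow> shear_unitary R0 c0 t0) F"
proof -
  have "((\<lambda>x. t x / 2) \<longlongrightarrow> t0 / 2) F" by (intro tendsto_divide tendsto_const lim) simp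
  then have "((\<lambda>x. shear_denominator (R x) (c x) (t x)) \<longlongrightarrow> shear_denominator R0 c0 t0) F"
    unfolding shear_denominator_def
    by (intro tendsto_add tendsto_const tendsto_scaleR tendsto_blinfun_compose lim)
  then have "((\<lambda>x. blinfun_inverse (shear_denominator (R x) (c x) (t x))) \<longlongrightarrow> blinfun_inverse (shear_denominator R0 c0 t0)) F"
  proof (rule tendsto_blinfun_inverse)
    show "eventually (\<lambda>x. invertible_blinfun (shear_denominator (R x) (c x) (t x))) F"
      using ev by eventually_elim (blast intro: invertible_shear_denominator)
    show "invertible_blinfun (shear_denominator R0 c0 t0)" by (rule invertible_shear_denominator[OF R0])
  qed
  then show ?thesis
    unfolding shear_unitary_def by (intro tendsto_diff tendsto_add tendsto_const tendsto_blinfun_compose lim)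
qed

text \<open>In the parametrization by \<open>v\<close>, the sum \<open>\<eta> + i \<xi>\<close> is
  the denominator at \<open>v\<close> and \<open>\<eta> - i \<xi>\<close> is the shear unitary
  applied to it. Invertibility of the denominator makes the description in
  \<open>cayley_transform\<close> denote.\<close>

lemma cayley_transform_shear:
  fixes R c :: "'h::complex_hilbert \<Rightarrow>\<^sub>L 'h"
  assumes R: "adj R = R" "clinear_blinfun R" and c: "unitary_onto UNIV c"
    and B: "B = {(R \<eta> + \<xi>, \<eta>) |\<xi> \<eta>. (\<xi>, \<eta>) \<in> {((- \<i> / 2) *\<^sub>C (v - c v), (1/2) *\<^sub>C (v + c v)) |v. True}}"
  shows "cayley_transform B = shear_unitary R c 1"
proof -
  let ?N = "shear_denominator R c 1" and ?U = "shear_unitary R c 1"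
  have h: "(1/2) *\<^sub>C x = (1/2) *\<^sub>R x" for x :: 'h using scaleC_of_real[of "1/2" x] by simp
  have ih: "\<i> *\<^sub>C (- \<i> / 2) *\<^sub>C x = (1/2) *\<^sub>R x" for x :: 'h
    unfolding scaleC_scaleC using scaleC_of_real[of "1/2" x] by simp
  have B': "B = {(R ((1/2) *\<^sub>C (v + c v)) + (- \<i> / 2) *\<^sub>C (v - c v), (1/2) *\<^sub>C (v + c v)) |v. True}"
    unfolding B by auto
  have N: "(1/2) *\<^sub>C (v + c v) + \<i> *\<^sub>C (R ((1/2) *\<^sub>C (v + c v)) + (- \<i> / 2) *\<^sub>C (v - c v)) = ?N v" for v
    unfolding shear_vectors(1)[OF R c] scaleC_add_right[of \<i> "R _"] ih h by simp
  have U: "(1/2) *\<^sub>C (v + c v) - \<i> *\<^sub>C (R ((1/2) *\<^sub>C (v + c v)) + (- \<i> / 2) *\<^sub>C (v - c v)) = ?U (?N v)" for v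
  proof -
    let ?X = "(1/2) *\<^sub>C (v + c v)" and ?Y = "\<i> *\<^sub>C (R ((1/2) *\<^sub>C (v + c v)) + (- \<i> / 2) *\<^sub>C (v - c v))"
    have "?X + ?X = v + c v" unfolding h by (simp flip: scaleR_2)
    then have "?U (?N v) = (?X + ?X) - (?X + ?Y)" unfolding shear_unitary_apply[OF R c] N by simp
    then show ?thesis by (simp only: add_diff_cancel_left)
  qed
  have "(THE w. \<exists>(\<xi>, \<eta>)\<in>B. y = \<eta> + \<i> *\<^sub>C \<xi> \<and> w = \<eta> - \<i> *\<^sub>C \<xi>) = ?U y" for y
  proof (rule the_equality)
    define v where "v = blinfun_inverse ?N y"
    have "?N v = y" by (simp add: v_def blinfun_inverse_right[OF invertible_shear_denominator[OF R c]])
    then show "\<exists>(\<xi>, \<eta>)\<in>B. y = \<eta> + \<i> *\<^sub>C \<xi> \<and> ?U y = \<eta> - \<i> *\<^sub>C \<xi>"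
      unfolding B' using N[of v] U[of v]
      by (intro bexI[of _ "(R ((1/2) *\<^sub>C (v + c v)) + (- \<i> / 2) *\<^sub>C (v - c v), (1/2) *\<^sub>C (v + c v))"]) auto
    fix w assume "\<exists>(\<xi>, \<eta>)\<in>B. y = \<eta> + \<i> *\<^sub>C \<xi> \<and> w = \<eta> - \<i> *\<^sub>C \<xi>"
    then obtain v where
      "y = (1/2) *\<^sub>C (v + c v) + \<i> *\<^sub>C (R ((1/2) *\<^sub>C (v + c v)) + (- \<i> / 2) *\<^sub>C (v - c v))"
      "w = (1/2) *\<^sub>C (v + c v) - \<i> *\<^sub>C (R ((1/2) *\<^sub>C (v + c v)) + (- \<i> / 2) *\<^sub>C (v - c v))"
      unfolding B' by blast
    then show "w = ?U y" unfolding N U by simp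
  qed
  then show ?thesis unfolding cayley_transform_def by (simp add: blinfun_apply_inverse)
qed


section \<open>Extensions defined by a reference operator\<close>

text \<open>The Hellinger-Toeplitz argument: the inverse is symmetric and everywhere defined, so its
  values on the unit ball are weakly bounded, hence bounded.\<close>

lemma inverse_of_self_adjoint:
  assumes sa: "self_adjoint_operator B" and inv: "invertible_operator B"
  shows "\<exists>R. adj R = R \<and> clinear_blinfun R \<and> B = {(R \<eta>, \<eta>) |\<eta>. True}"
proof -
  have sub: "csubspace B" and ad: "op_adjoint B = B"
    using sa unfolding self_adjoint_operator_def closed_operator_def by auto
  have ex1: "\<exists>!\<xi>. (\<xi>, \<eta>) \<in> B" for \<eta> using inv unfolding invertible_operator_def by blast
  define f where "f \<eta> = (THE \<xi>. (\<xi>, \<eta>) \<in> B)" for \<eta>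
  have fB: "(f \<eta>, \<eta>) \<in> B" for \<eta> unfolding f_def by (rule theI'[OF ex1])
  have f_eq: "f \<eta> = \<xi>" if "(\<xi>, \<eta>) \<in> B" for \<xi> \<eta> using ex1[of \<eta>] fB[of \<eta>] that by blast
  have add: "f (x + y) = f x + f y" for x y
    using complex_vector.subspace_add[OF sub fB[of x] fB[of y]] by (intro f_eq) simp
  have scale: "f (c *\<^sub>C x) = c *\<^sub>C f x" for c x
    using complex_vector.subspace_scale[OF sub fB[of x], of c] by (intro f_eq) (simp add: scaleC_Pair)
  have sym: "inner (f x) y = inner x (f y)" for x y
  proof -
    have "(f y, y) \<in> op_adjoint B" using fB ad by simp
    then have "cinner x (f y) = cinner (f x) y" using fB[of x] unfolding op_adjoint_def by fastforce
    then have "Re (cinner x (f y)) = Re (cinner (f x) y)" by simp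
    then show ?thesis by (simp add: Re_cinner)
  qed
  have "bounded (f ` {x. norm x \<le> 1})"
  proof (rule weakly_bounded_imp_bounded)
    fix y
    have "\<bar>inner y (f x)\<bar> \<le> norm (f y)" if "norm x \<le> 1" for x
    proof -
      have "\<bar>inner (f y) x\<bar> \<le> norm (f y) * norm x" by (rule Cauchy_Schwarz_ineq2)
      also have "\<dots> \<le> norm (f y) * 1" using that by (intro mult_left_mono) auto
      finally show ?thesis by (simp add: sym)
    qed
    then show "\<exists>C. \<forall>s\<in>f ` {x. norm x \<le> 1}. \<bar>inner y s\<bar> \<le> C" by blast
  qed
  then obtain M where M: "\<And>x. norm x \<le> 1 \<Longrightarrow> norm (f x) \<le> M" unfolding bounded_iff by blast
  have scaleR: "f (r *\<^sub>R x) = r *\<^sub>R f x" for r x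
    using scale[of "complex_of_real r" x] by (simp add: scaleC_of_real)
  have "bounded_linear f"
  proof (rule bounded_linear_intro[where K=M])
    fix x
    show "norm (f x) \<le> norm x * M"
    proof (cases "x = 0")
      case True
      then show ?thesis using scaleR[of 0 0] by simp
    next
      case False
      then have "norm (f ((1 / norm x) *\<^sub>R x)) \<le> M" by (intro M) simp
      then show ?thesis using False by (simp add: scaleR field_simps)
    qed
  qed (simp_all add: add scaleR)
  then have R: "blinfun_apply (Blinfun f) = f" by (rule bounded_linear_Blinfun_apply)
  have "adj (Blinfun f) = Blinfun f" by (rule adjI) (simp add: R sym)
  moreover have "B = {(f \<eta>, \<eta>) |\<eta>. True}"
  proof (intro set_eqI iffI)
    fix p assume "p \<in> B"
    then have "p = (f (snd p), snd p)" using f_eq[of "fst p" "snd p"] by simp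
    then show "p \<in> {(f \<eta>, \<eta>) |\<eta>. True}" by blast
  qed (use fB in auto)
  ultimately show ?thesis
    by (intro exI[of _ "Blinfun f"]) (simp add: R clinear_blinfun_def scale)
qed

locale reference_operator =
  fixes A Aref :: "('h::complex_hilbert \<times> 'h) set" and R :: "'h \<Rightarrow>\<^sub>L 'h" and K :: "'h set"
  assumes symA: "symmetric_operator A" and closedA: "closed (Range A)"
    and ext: "A \<subseteq> Aref"
    and R: "adj R = R" "clinear_blinfun R" and Aref: "Aref = {(R \<eta>, \<eta>) |\<eta>. True}"
    and K: "K = op_kernel (op_adjoint A)"
begin

lemma A_iff: "(\<xi>, \<eta>) \<in> A \<longleftrightarrow> \<eta> \<in> Range A \<and> \<xi> = R \<eta>"
  using ext Aref by auto

lemma csubspace_A: "csubspace A"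
  using symA unfolding symmetric_operator_def closed_operator_def by blast

lemma csubspace_Range: "csubspace (Range A)"
  unfolding complex_vector.subspace_def
proof (intro conjI ballI allI)
  show "0 \<in> Range A" using complex_vector.subspace_0[OF csubspace_A] by (auto simp: zero_prod_def)
  show "x + y \<in> Range A" if "x \<in> Range A" "y \<in> Range A" for x y
    using that complex_vector.subspace_add[OF csubspace_A] by fastforce
  show "c *\<^sub>C x \<in> Range A" if "x \<in> Range A" for c x
    using that complex_vector.subspace_scale[OF csubspace_A, of _ c] by (fastforce simp: scaleC_Pair)
qed

lemma K_iff_cinner: "k \<in> K \<longleftrightarrow> (\<forall>\<eta>\<in>Range A. cinner \<eta> k = 0)"
  unfolding K op_kernel_def op_adjoint_def by (auto simp: Range_iff)

lemma K_iff: "k \<in> K \<longleftrightarrow> (\<forall>\<eta>\<in>Range A. inner \<eta> k = 0)"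
proof
  assume *: "\<forall>\<eta>\<in>Range A. inner \<eta> k = 0"
  have "cinner \<eta> k = 0" if "\<eta> \<in> Range A" for \<eta>
  proof -
    have "inner (\<i> *\<^sub>C \<eta>) k = 0" using * complex_vector.subspace_scale[OF csubspace_Range that] by blast
    then show ?thesis using * that by (simp add: cinner_eq_0_iff inner_i_left)
  qed
  then show "k \<in> K" unfolding K_iff_cinner by blast
qed (simp add: K_iff_cinner cinner_eq_0_iff)

lemma csubspace_K: "csubspace K" and closed_K: "closed K"
proof -
  show "csubspace K"
    by (simp add: complex_vector.subspace_def K_iff_cinner cinner_add_right cinner_scaleC_right)
  have "K = (\<Inter>\<eta>\<in>Range A. {k. inner \<eta> k = 0})" using K_iff by blast
  then show "closed K" by (auto intro!: closed_Collect_eq continuous_intros)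
qed

lemma Range_eq: "\<eta> \<in> Range A \<longleftrightarrow> (\<forall>k\<in>K. inner \<eta> k = 0)"
proof
  assume *: "\<forall>k\<in>K. inner \<eta> k = 0"
  obtain w where w: "w \<in> Range A" "\<And>s. s \<in> Range A \<Longrightarrow> inner (\<eta> - w) s = 0"
    using exists_orthogonal_projection[OF csubspace_imp_subspace[OF csubspace_Range] closedA] by blast
  have k: "\<eta> - w \<in> K" unfolding K_iff using w(2) by (simp add: inner_commute)
  then have "inner (\<eta> - w) (\<eta> - w) = 0"
    using * w(1) K_iff by (simp add: inner_diff_left)
  then show "\<eta> \<in> Range A" using w(1) by simp
qed (auto simp: K_iff)

lemma diff_proj_in_Range: "\<eta> - orth_proj K \<eta> \<in> Range A"
  unfolding Range_eq using orth_proj_orthogonal[OF csubspace_K closed_K] by blast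

text \<open>A pair of the adjoint differs from the pair \<open>(R \<eta>, \<eta>)\<close> of the
  reference operator by \<open>(k, 0)\<close> with \<open>k\<close> in the kernel. It follows by
  moving \<open>R\<close> across the inner product in the adjoint relation.\<close>

lemma adjoint_iff: "(\<xi>, \<eta>) \<in> op_adjoint A \<longleftrightarrow> \<xi> - R \<eta> \<in> K"
proof -
  have cR: "cinner (R x) y = cinner x (R y)" for x y
    using inner_symmetric[OF R(1)] R(2)[unfolded clinear_blinfun_iff]
    by (simp add: cinner_eq inner_symmetric[OF R(1)])
  have "(\<xi>, \<eta>) \<in> op_adjoint A \<longleftrightarrow> (\<forall>\<zeta>\<in>Range A. cinner \<zeta> \<xi> = cinner (R \<zeta>) \<eta>)"
    unfolding op_adjoint_def using A_iff by auto
  also have "\<dots> \<longleftrightarrow> \<xi> - R \<eta> \<in> K"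
    unfolding K_iff_cinner by (simp add: cR cinner_diff_right)
  finally show ?thesis .
qed

text \<open>Density of the domain of \<open>A\<close> makes the adjoint single-valued.\<close>

lemma adjoint_unique:
  assumes "\<xi> - R \<eta> \<in> K" "\<xi> - R \<eta>' \<in> K"
  shows "\<eta> = \<eta>'"
proof -
  have "(\<xi> - R \<eta>') - (\<xi> - R \<eta>) \<in> K" by (rule complex_vector.subspace_diff[OF csubspace_K assms(2,1)])
  then have "0 - R (\<eta>' - \<eta>) \<in> K" by (simp add: blinfun.diff_right)
  then have 0: "(0, \<eta>' - \<eta>) \<in> op_adjoint A" unfolding adjoint_iff .
  have "Domain A \<subseteq> {\<zeta>. inner \<zeta> (\<eta>' - \<eta>) = 0}"
  proof
    fix \<zeta> assume "\<zeta> \<in> Domain A"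
    then have "cinner \<zeta> (\<eta>' - \<eta>) = 0" using 0 unfolding op_adjoint_def by fastforce
    then show "\<zeta> \<in> {\<zeta>. inner \<zeta> (\<eta>' - \<eta>) = 0}" by (simp add: cinner_eq_0_iff)
  qed
  moreover have "closed {\<zeta>. inner \<zeta> (\<eta>' - \<eta>) = 0}" by (intro closed_Collect_eq continuous_intros)
  ultimately have "closure (Domain A) \<subseteq> {\<zeta>. inner \<zeta> (\<eta>' - \<eta>) = 0}" by (rule closure_minimal)
  then have "inner (\<eta>' - \<eta>) (\<eta>' - \<eta>) = 0"
    using symA unfolding symmetric_operator_def by blast
  then show ?thesis by simp
qed

text \<open>\<open>\<eta>\<close> splits along the range of \<open>A\<close> and its complement
  \<open>K\<close>. Applying \<open>R\<close> to the two parts gives a vector of the domain of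
  \<open>A\<close> and the part coming from the reference operator; the remainder
  \<open>\<xi> - R \<eta>\<close> lies in \<open>K\<close>.\<close>

lemma boundary_map_eq:
  assumes "\<xi> - R \<eta> \<in> K"
  shows "boundary_map A Aref \<xi> = (\<xi> - R \<eta>, orth_proj K \<eta>)"
  unfolding boundary_map_def K[symmetric]
proof (rule the_equality)
  have "(R (\<eta> - orth_proj K \<eta>), \<eta> - orth_proj K \<eta>) \<in> A" using A_iff diff_proj_in_Range by blast
  then have "R (\<eta> - orth_proj K \<eta>) \<in> Domain A" by blast
  moreover have "\<xi> = R (\<eta> - orth_proj K \<eta>) + (\<xi> - R \<eta>) + R (orth_proj K \<eta>)" by (simp add: blinfun.diff_right)
  moreover have "(R (orth_proj K \<eta>), orth_proj K \<eta>) \<in> Aref" using Aref by blast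
  ultimately show "case (\<xi> - R \<eta>, orth_proj K \<eta>) of (\<xi>0, \<xi>1) \<Rightarrow> \<xi>0 \<in> K \<and> \<xi>1 \<in> K \<and>
      (\<exists>\<zeta>\<in>Domain A. \<exists>\<theta>. (\<theta>, \<xi>1) \<in> Aref \<and> \<xi> = \<zeta> + \<xi>0 + \<theta>)"
    using assms orth_proj_mem[OF csubspace_K closed_K] by auto
  fix p assume *: "case p of (\<xi>0, \<xi>1) \<Rightarrow> \<xi>0 \<in> K \<and> \<xi>1 \<in> K \<and>
      (\<exists>\<zeta>\<in>Domain A. \<exists>\<theta>. (\<theta>, \<xi>1) \<in> Aref \<and> \<xi> = \<zeta> + \<xi>0 + \<theta>)"
  obtain \<xi>0 \<xi>1 where p1: "p = (\<xi>0, \<xi>1)" by fastforce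
  with *[unfolded p1 prod.case] obtain \<zeta> \<theta> where p: "p = (\<xi>0, \<xi>1)" "\<xi>0 \<in> K" "\<xi>1 \<in> K"
    "\<zeta> \<in> Domain A" "(\<theta>, \<xi>1) \<in> Aref" "\<xi> = \<zeta> + \<xi>0 + \<theta>" by blast
  obtain \<rho> where \<rho>: "\<rho> \<in> Range A" "\<zeta> = R \<rho>" using p(4) A_iff by blast
  have \<theta>: "\<theta> = R \<xi>1" using p(5) Aref by blast
  have eq: "\<xi> - R (\<rho> + \<xi>1) = \<xi>0" using p(6) \<rho>(2) \<theta> by (simp add: blinfun.add_right)
  then have \<eta>: "\<eta> = \<rho> + \<xi>1" using adjoint_unique[OF assms, of "\<rho> + \<xi>1"] p(2) by simp
  have "orth_proj K \<eta> = \<xi>1"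
    by (rule orth_proj_unique[OF csubspace_K closed_K p(3)]) (use \<rho>(1) Range_eq in \<open>auto simp: \<eta>\<close>)
  then show "p = (\<xi> - R \<eta>, orth_proj K \<eta>)" using p(1) eq \<eta> by simp
qed

lemma extension_by_eq:
  assumes L: "\<And>a b. (a, b) \<in> L \<Longrightarrow> a \<in> K"
  shows "extension_by A Aref L = {(R \<eta> + \<xi>, \<eta>) |\<xi> \<eta>. (\<xi>, orth_proj K \<eta>) \<in> L}"
proof (intro set_eqI iffI)
  fix p assume "p \<in> extension_by A Aref L"
  then obtain \<xi> \<eta> where p: "p = (\<xi>, \<eta>)" "\<xi> - R \<eta> \<in> K" "boundary_map A Aref \<xi> \<in> L"
    unfolding extension_by_def adjoint_iff by blast
  then have "(\<xi> - R \<eta>, orth_proj K \<eta>) \<in> L" using boundary_map_eq by simp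
  moreover have "p = (R \<eta> + (\<xi> - R \<eta>), \<eta>)" using p(1) by simp
  ultimately show "p \<in> {(R \<eta> + \<xi>, \<eta>) |\<xi> \<eta>. (\<xi>, orth_proj K \<eta>) \<in> L}" by blast
next
  fix p assume "p \<in> {(R \<eta> + \<xi>, \<eta>) |\<xi> \<eta>. (\<xi>, orth_proj K \<eta>) \<in> L}"
  then obtain \<xi> \<eta> where p: "p = (R \<eta> + \<xi>, \<eta>)" "(\<xi>, orth_proj K \<eta>) \<in> L" by blast
  have k: "R \<eta> + \<xi> - R \<eta> \<in> K" using L[OF p(2)] by simp
  then have "boundary_map A Aref (R \<eta> + \<xi>) \<in> L" using boundary_map_eq[OF k] p(2) by simp
  then show "p \<in> extension_by A Aref L"
    unfolding extension_by_def p(1) using adjoint_iff k by blast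
qed

lemma norm_graph_le: "norm (R \<eta>, \<eta>) \<le> (norm R + 1) * norm \<eta>"
  using norm_Pair_le[of "R \<eta>" \<eta>] norm_blinfun[of R \<eta>] by (simp add: distrib_right)

end


subsection \<open>Continuity of the inverse and of the kernel\<close>

text \<open>\<open>M\<close> is onto, and \<open>adj M\<close> times the inverse of
  \<open>M o\<^sub>L adj M\<close> is a right inverse of it. Projecting its value at
  \<open>v\<close> to \<open>B\<close> gives the point of \<open>B\<close> with second component
  \<open>v\<close>, whose first component is \<open>R v\<close>. This expresses \<open>R\<close>
  through \<open>orth_proj B\<close>, so graph continuity yields norm continuity of
  \<open>R\<close>.\<close>

lemma second_component_inverse:
  fixes R :: "'h::complex_hilbert \<Rightarrow>\<^sub>L 'h"
  assumes B: "B = {(R \<eta>, \<eta>) |\<eta>. True}" "csubspace B" "closed B"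
  defines "M \<equiv> snd_blinfun o\<^sub>L orth_proj B"
  shows "invertible_blinfun (M o\<^sub>L adj M)"
    and "R = (fst_blinfun o\<^sub>L (orth_proj B o\<^sub>L adj M)) o\<^sub>L blinfun_inverse (M o\<^sub>L adj M)"
proof -
  define m where "m = norm R + 1"
  have m: "0 < m" using norm_ge_zero[of R] unfolding m_def by linarith
  have RB: "(R v, v) \<in> B" for v using B(1) by blast
  have lower: "norm v \<le> m * norm (adj M v)" for v
  proof -
    have "M (R v, v) = v" by (simp add: M_def orth_proj_of_mem[OF B(2,3) RB])
    then have "inner v v = inner (R v, v) (adj M v)" by (simp add: inner_adj)
    then have "norm v * norm v \<le> norm (R v, v) * norm (adj M v)"
      using norm_cauchy_schwarz[of "(R v, v)" "adj M v"] by (simp add: power2_norm_eq_inner[symmetric] power2_eq_square)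
    also have "norm (R v, v) \<le> m * norm v"
      using norm_Pair_le[of "R v" v] norm_blinfun[of R v] by (simp add: distrib_right m_def)
    then have "norm (R v, v) * norm (adj M v) \<le> (m * norm v) * norm (adj M v)" by (rule mult_right_mono) simp
    finally have "norm v * norm v \<le> (m * norm (adj M v)) * norm v" by (simp add: mult_ac)
    then show ?thesis by (rule le_of_mult_self_le) (use m in simp_all)
  qed
  have below: "1 / m\<^sup>2 * norm v \<le> norm ((M o\<^sub>L adj M) v)" for v
  proof -
    have "(norm v)\<^sup>2 \<le> (m * norm (adj M v))\<^sup>2" by (rule power_mono[OF lower]) simp
    also have "\<dots> = m\<^sup>2 * inner v ((M o\<^sub>L adj M) v)"
      by (simp add: power_mult_distrib power2_norm_eq_inner inner_adj inner_commute)
    also have "\<dots> \<le> m\<^sup>2 * (norm v * norm ((M o\<^sub>L adj M) v))"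
      by (intro mult_left_mono norm_cauchy_schwarz) simp
    finally have "norm v * norm v \<le> (m\<^sup>2 * norm ((M o\<^sub>L adj M) v)) * norm v"
      by (simp add: power2_eq_square mult_ac)
    then have "norm v \<le> m\<^sup>2 * norm ((M o\<^sub>L adj M) v)" by (rule le_of_mult_self_le) simp_all
    then show ?thesis using m by (simp add: field_simps)
  qed
  have sym: "adj (M o\<^sub>L adj M) = M o\<^sub>L adj M" by (simp add: adj_compose)
  show inv: "invertible_blinfun (M o\<^sub>L adj M)"
  proof (rule invertible_blinfunI[OF _ below])
    show "0 < 1 / m\<^sup>2" using m by simp
    show "v = 0" if "adj (M o\<^sub>L adj M) v = 0" for v
      using that below[of v] m unfolding sym by (simp add: divide_le_0_iff)
  qed
  show "R = (fst_blinfun o\<^sub>L (orth_proj B o\<^sub>L adj M)) o\<^sub>L blinfun_inverse (M o\<^sub>L adj M)"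
  proof (rule blinfun_eqI)
    fix v
    define y where "y = orth_proj B (adj M (blinfun_inverse (M o\<^sub>L adj M) v))"
    have "snd y = v"
      using blinfun_inverse_right[OF inv, of v] by (simp add: y_def M_def)
    moreover have "y \<in> B" unfolding y_def by (rule orth_proj_mem[OF B(2,3)])
    ultimately have "fst y = R v" using B(1) by auto
    then show "R v = ((fst_blinfun o\<^sub>L (orth_proj B o\<^sub>L adj M)) o\<^sub>L blinfun_inverse (M o\<^sub>L adj M)) v"
      by (simp add: y_def)
  qed
qed

context reference_operator
begin

text \<open>\<open>M\<close> has range \<open>Range A\<close>, the complement of \<open>K\<close>,
  and is bounded below on \<open>A\<close> because \<open>R\<close> is bounded. The summand
  \<open>id_blinfun - orth_proj A\<close> compensates for the kernel of \<open>M\<close>, so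
  \<open>T\<close> is invertible, and solving \<open>T q = adj M v\<close> is the normal equation
  for the projection \<open>M q\<close> of \<open>v\<close> onto that range. The projection onto
  \<open>K\<close> thus depends continuously on that onto \<open>A\<close>.\<close>

lemma kernel_projection:
  defines "M \<equiv> snd_blinfun o\<^sub>L orth_proj A"
  defines "T \<equiv> (adj M o\<^sub>L M) + (id_blinfun - orth_proj A)"
  shows "invertible_blinfun T" "orth_proj K = id_blinfun - (M o\<^sub>L (blinfun_inverse T o\<^sub>L adj M))"
proof -
  have A: "csubspace A" "closed A"
    using symA unfolding symmetric_operator_def closed_operator_def by auto
  let ?p = "orth_proj A"
  define m where "m = norm R + 1"
  have m: "1 \<le> m" by (simp add: m_def)
  have Mz: "M z \<in> Range A" "?p z = (R (M z), M z)" for z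
  proof -
    obtain \<xi> \<eta> where p: "?p z = (\<xi>, \<eta>)" by fastforce
    then have "(\<xi>, \<eta>) \<in> A" using orth_proj_mem[OF A, of z] by simp
    then show "M z \<in> Range A" "?p z = (R (M z), M z)" using A_iff p by (auto simp: M_def)
  qed
  have Ma: "M a = snd a" if "a \<in> A" for a using orth_proj_of_mem[OF A that] by (simp add: M_def)
  have sym: "adj T = T" by (simp add: T_def adj_add adj_diff adj_compose adj_orth_proj[OF A])
  have below: "1 / m\<^sup>2 * norm z \<le> norm (T z)" for z
  proof -
    have "norm (?p z) \<le> m * norm (M z)" unfolding Mz(2) m_def by (rule norm_graph_le)
    then have "(norm (?p z))\<^sup>2 \<le> m\<^sup>2 * (norm (M z))\<^sup>2" using power_mono[of "norm (?p z)" "m * norm (M z)" 2]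
      by (simp add: power_mult_distrib)
    moreover have "1 * (norm (z - ?p z))\<^sup>2 \<le> m\<^sup>2 * (norm (z - ?p z))\<^sup>2" using m by (intro mult_right_mono) simp_all
    ultimately have "(norm z)\<^sup>2 \<le> m\<^sup>2 * ((norm (M z))\<^sup>2 + (norm (z - ?p z))\<^sup>2)"
      using norm_orth_proj_Pythagoras[OF A, of z] by (simp add: distrib_left)
    also have "(norm (M z))\<^sup>2 + (norm (z - ?p z))\<^sup>2 = inner z (T z)"
    proof -
      have "inner (z - ?p z) (?p z) = 0" by (rule orth_proj_orthogonal[OF A orth_proj_mem[OF A]])
      then have "(norm (z - ?p z))\<^sup>2 = inner z (z - ?p z)"
        by (simp add: power2_norm_eq_inner inner_diff_right inner_diff_left inner_commute)
      then show ?thesis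
        by (simp add: T_def blinfun.add_left blinfun.diff_left inner_add_right inner_adj power2_norm_eq_inner)
    qed
    also have "inner z (T z) \<le> norm z * norm (T z)" by (rule norm_cauchy_schwarz)
    then have "m\<^sup>2 * inner z (T z) \<le> m\<^sup>2 * (norm z * norm (T z))" by (rule mult_left_mono) simp
    finally have "norm z * norm z \<le> (m\<^sup>2 * norm (T z)) * norm z" by (simp add: power2_eq_square mult_ac)
    then have "norm z \<le> m\<^sup>2 * norm (T z)" by (rule le_of_mult_self_le) simp_all
    then show ?thesis using m by (simp add: field_simps)
  qed
  show inv: "invertible_blinfun T"
  proof (rule invertible_blinfunI[OF _ below])
    show "0 < 1 / m\<^sup>2" using m by simp
    show "z = 0" if "adj T z = 0" for z
      using that below[of z] m unfolding sym by (simp add: divide_le_0_iff)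
  qed
  show "orth_proj K = id_blinfun - (M o\<^sub>L (blinfun_inverse T o\<^sub>L adj M))"
  proof (rule blinfun_eqI)
    fix v
    define q where "q = blinfun_inverse T (adj M v)"
    have "T q = adj M v" by (simp add: q_def blinfun_inverse_right[OF inv])
    then have q: "adj M v - adj M (M q) = q - ?p q"
      by (simp add: T_def blinfun.add_left blinfun.diff_left algebra_simps)
    have "orth_proj K v = v - M q"
    proof (rule orth_proj_unique[OF csubspace_K closed_K])
      show "v - M q \<in> K"
        unfolding K_iff
      proof
        fix \<eta> assume "\<eta> \<in> Range A"
        then have a: "(R \<eta>, \<eta>) \<in> A" using A_iff by blast
        have "inner \<eta> (v - M q) = inner (M (R \<eta>, \<eta>)) (v - M q)" using Ma[OF a] by simp
        also have "\<dots> = inner (R \<eta>, \<eta>) (q - ?p q)"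
          unfolding q[symmetric] by (simp add: inner_adj[symmetric] blinfun.diff_right)
        also have "\<dots> = 0" using orth_proj_orthogonal[OF A a, of q] by (simp add: inner_commute)
        finally show "inner \<eta> (v - M q) = 0" .
      qed
      show "inner (v - (v - M q)) s = 0" if "s \<in> K" for s
        using that Mz(1)[of q] Range_eq by simp
    qed
    then show "orth_proj K v = (id_blinfun - (M o\<^sub>L (blinfun_inverse T o\<^sub>L adj M))) v"
      by (simp add: blinfun.diff_left q_def)
  qed
qed

end

section \<open>The index theorem\<close>

lemma lagrangian_unitary_horizontal:
  assumes K: "csubspace K" and \<xi>: "\<xi> \<in> K"
  shows "lagrangian_unitary J_std (K \<times> K) (K \<times> {0}) (\<xi>, \<i> *\<^sub>C \<xi>) = (\<xi>, - (\<i> *\<^sub>C \<xi>))"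
  unfolding lagrangian_unitary_def J_minus_std[OF K]
proof (rule the_equality)
  show "(\<xi>, - (\<i> *\<^sub>C \<xi>)) \<in> {(\<xi>, - \<i> *\<^sub>C \<xi>) |\<xi>. \<xi> \<in> K} \<and>
      (\<xi>, \<i> *\<^sub>C \<xi>) + (\<xi>, - (\<i> *\<^sub>C \<xi>)) \<in> K \<times> {0}"
    using \<xi> complex_vector.subspace_add[OF K \<xi> \<xi>] by simp
  fix w assume w: "w \<in> {(\<xi>, - \<i> *\<^sub>C \<xi>) |\<xi>. \<xi> \<in> K} \<and> (\<xi>, \<i> *\<^sub>C \<xi>) + w \<in> K \<times> {0}"
  then obtain \<eta> where \<eta>: "w = (\<eta>, - (\<i> *\<^sub>C \<eta>))" by auto
  then have "\<i> *\<^sub>C \<xi> = \<i> *\<^sub>C \<eta>" using w by simp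
  then have "\<i> *\<^sub>C \<i> *\<^sub>C \<xi> = \<i> *\<^sub>C \<i> *\<^sub>C \<eta>" by (rule arg_cong)
  then show "w = (\<xi>, - (\<i> *\<^sub>C \<xi>))" using \<eta> by simp
qed

text \<open>With \<open>c\<close> the relation unitary, the unitary of \<open>L\<close> takes
  \<open>(\<xi>, i \<xi>)\<close> to \<open>(- c \<xi>, i c \<xi>)\<close>, the inverse of the
  horizontal one takes this to \<open>(- c \<xi>, - i c \<xi>)\<close>, and the final sign gives
  \<open>(c \<xi>, i c \<xi>)\<close>. This is where the minus sign in the pair index is accounted
  for.\<close>

lemma lagrangian_pair_unitary:
  assumes K: "csubspace K" "closed K" and L: "csubspace L" "closed L" "self_adjoint_relation K L"
    and \<xi>: "\<xi> \<in> K"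
  shows "- inv_into (J_plus J_std (K \<times> K)) (lagrangian_unitary J_std (K \<times> K) (K \<times> {0}))
      (lagrangian_unitary J_std (K \<times> K) L (\<xi>, \<i> *\<^sub>C \<xi>)) =
    (relation_unitary K L \<xi>, \<i> *\<^sub>C relation_unitary K L \<xi>)"
proof -
  let ?u = "lagrangian_unitary J_std (K \<times> K) (K \<times> {0})" and ?c = "relation_unitary K L"
  have "?c \<xi> = orth_proj K (?c \<xi>)"
    using relation_unitary_preserves(1)[OF K L, of \<xi>] orth_proj_of_mem[OF K \<xi>] by simp
  then have "?c \<xi> \<in> K" using orth_proj_mem[OF K] by metis
  then have mK: "- ?c \<xi> \<in> K" by (rule complex_vector.subspace_neg[OF K(1)])
  have "inj_on ?u (J_plus J_std (K \<times> K))"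
    unfolding J_plus_std[OF K(1)] by (rule inj_onI) (auto simp: lagrangian_unitary_horizontal[OF K(1)])
  moreover have "(- ?c \<xi>, \<i> *\<^sub>C (- ?c \<xi>)) \<in> J_plus J_std (K \<times> K)"
    unfolding J_plus_std[OF K(1)] using mK by blast
  moreover have "?u (- ?c \<xi>, \<i> *\<^sub>C (- ?c \<xi>)) = (- ?c \<xi>, \<i> *\<^sub>C ?c \<xi>)"
    using lagrangian_unitary_horizontal[OF K(1) mK] by simp
  ultimately have "inv_into (J_plus J_std (K \<times> K)) ?u (- ?c \<xi>, \<i> *\<^sub>C ?c \<xi>) = (- ?c \<xi>, \<i> *\<^sub>C (- ?c \<xi>))"
    by (rule inv_into_f_eq)
  then show ?thesis by (simp add: lagrangian_unitary_relation[OF K L \<xi>])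
qed

theorem theorem16p3:
  fixes X :: "'x topology"
    and A Aref :: "'x \<Rightarrow> ('h::complex_hilbert \<times> 'h) set"
    and K :: "'x \<Rightarrow> 'h set"
    and L :: "'x \<Rightarrow> ('h \<times> 'h) set"
  assumes "separable_space (euclidean :: 'h topology)"
    and "\<not> finite_cdim (UNIV :: 'h set)"
    and "continuous_subspaces X A"
    and "\<And>x. x \<in> topspace X \<Longrightarrow>
           symmetric_operator (A x) \<and> semi_Fredholm_operator (A x) \<and> injective_operator (A x)"
    and "continuous_subspaces X Aref"
    and "\<And>x. x \<in> topspace X \<Longrightarrow>
           self_adjoint_operator (Aref x) \<and> invertible_operator (Aref x) \<and> A x \<subseteq> Aref x"
    and "\<And>x. x \<in> topspace X \<Longrightarrow> K x = op_kernel (op_adjoint (A x))"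
    and "continuous_subspaces X L"
    and "\<And>x. x \<in> topspace X \<Longrightarrow>
           self_adjoint_relation (K x) (L x) \<and> Fredholm_relation (K x) (L x)"
  shows "operator_index X (\<lambda>x. extension_by (A x) (Aref x) (L x)) = relation_index X K L \<and>
         relation_index X K L \<in> K1 X"
proof -
  obtain e :: "nat \<Rightarrow> 'h" where e: "orthonormal_basis e"
    using exists_orthonormal_basis[OF assms(1,2)] by blast
  obtain \<iota> \<sigma> where sh: "shift e \<iota> \<sigma>" using exists_shift[OF e] by blast
  interpret shift e \<iota> \<sigma> by fact
  have A: "csubspace (A x)" "closed (A x)" and Ar: "csubspace (Aref x)" "closed (Aref x)"
    and L: "csubspace (L x)" "closed (L x)" if "x \<in> topspace X" for x
    using assms(3,5,8) that unfolding continuous_subspaces_def by blast+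
  have cA: "continuous_map X euclidean (\<lambda>x. orth_proj (A x))"
    and cAr: "continuous_map X euclidean (\<lambda>x. orth_proj (Aref x))"
    and cL: "continuous_map X euclidean (\<lambda>x. orth_proj (L x))"
    using assms(3,5,8) unfolding continuous_subspaces_def by blast+
  have "\<forall>x\<in>topspace X. \<exists>R. adj R = R \<and> clinear_blinfun R \<and> Aref x = {(R \<eta>, \<eta>) |\<eta>. True}"
    using inverse_of_self_adjoint assms(6) by blast
  from bchoice[OF this] obtain R where R: "\<And>x. x \<in> topspace X \<Longrightarrow> adj (R x) = R x"
    "\<And>x. x \<in> topspace X \<Longrightarrow> clinear_blinfun (R x)"
    "\<And>x. x \<in> topspace X \<Longrightarrow> Aref x = {(R x \<eta>, \<eta>) |\<eta>. True}" by blast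
  have ref: "reference_operator (A x) (Aref x) (R x) (K x)" if x: "x \<in> topspace X" for x
  proof unfold_locales
    show "symmetric_operator (A x)" "closed (Range (A x))"
      using assms(4)[OF x] unfolding semi_Fredholm_operator_def by blast+
    show "A x \<subseteq> Aref x" using assms(6)[OF x] by blast
  qed (rule R[OF x] assms(7)[OF x])+
  note K = reference_operator.csubspace_K[OF ref] reference_operator.closed_K[OF ref]
  have lagr: "self_adjoint_relation (K x) (L x)" if "x \<in> topspace X" for x using assms(9)[OF that] by blast

  \<comment> \<open>The formula for \<open>R\<close> in terms of the projection onto the graph is
    valid on the carrier of \<open>X\<close>, which is all that limits along \<open>atin\<close>
    see.\<close>
  have cR: "continuous_map X euclidean R"
    unfolding continuous_map_atin limitin_canonical_iff
  proof
    fix x assume x: "x \<in> topspace X"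
    define M where "M y = snd_blinfun o\<^sub>L orth_proj (Aref y)" for y
    define R' where "R' y = (fst_blinfun o\<^sub>L (orth_proj (Aref y) o\<^sub>L adj (M y))) o\<^sub>L blinfun_inverse (M y o\<^sub>L adj (M y))" for y
    have inv: "invertible_blinfun (M y o\<^sub>L adj (M y))" if "y \<in> topspace X" for y
      unfolding M_def by (rule second_component_inverse(1)[OF R(3)[OF that] Ar[OF that]])
    have eq: "R y = R' y" if "y \<in> topspace X" for y
      unfolding R'_def M_def using second_component_inverse(2)[OF R(3) Ar] that by blast
    have pl: "((\<lambda>y. orth_proj (Aref y)) \<longlongrightarrow> orth_proj (Aref x)) (atin X x)"
      by (rule continuous_map_tendsto[OF cAr x])
    have M: "(M \<longlongrightarrow> M x) (atin X x)"
      unfolding M_def by (intro tendsto_blinfun_compose tendsto_const pl)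
    have ev: "eventually (\<lambda>y. invertible_blinfun (M y o\<^sub>L adj (M y))) (atin X x)"
      using eventually_atin_topspace by (rule eventually_mono) (rule inv)
    have "(R' \<longlongrightarrow> R' x) (atin X x)"
      unfolding R'_def
      by (intro tendsto_blinfun_compose tendsto_const pl tendsto_adj M tendsto_blinfun_inverse ev inv[OF x])
    moreover have "eventually (\<lambda>y. R' y = R y) (atin X x)"
      using eventually_atin_topspace by (rule eventually_mono) (simp add: eq)
    ultimately show "(R \<longlongrightarrow> R x) (atin X x)" using eq[OF x] by (simp add: tendsto_cong)
  qed

  have cP: "continuous_map X euclidean (\<lambda>x. orth_proj (K x))"
    unfolding continuous_map_atin limitin_canonical_iff
  proof
    fix x assume x: "x \<in> topspace X"
    define M where "M y = snd_blinfun o\<^sub>L orth_proj (A y)" for y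
    define T where "T y = (adj (M y) o\<^sub>L M y) + (id_blinfun - orth_proj (A y))" for y
    define P where "P y = id_blinfun - (M y o\<^sub>L (blinfun_inverse (T y) o\<^sub>L adj (M y)))" for y
    note inv = reference_operator.kernel_projection(1)[OF ref, folded M_def, folded T_def]
    have eq: "orth_proj (K y) = P y" if "y \<in> topspace X" for y
      unfolding P_def T_def M_def by (rule reference_operator.kernel_projection(2)[OF ref[OF that]])
    have pl: "((\<lambda>y. orth_proj (A y)) \<longlongrightarrow> orth_proj (A x)) (atin X x)"
      by (rule continuous_map_tendsto[OF cA x])
    have M: "(M \<longlongrightarrow> M x) (atin X x)"
      unfolding M_def by (intro tendsto_blinfun_compose tendsto_const pl)
    have T: "(T \<longlongrightarrow> T x) (atin X x)"
      unfolding T_def by (intro tendsto_add tendsto_diff tendsto_blinfun_compose tendsto_const pl tendsto_adj M)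
    have ev: "eventually (\<lambda>y. invertible_blinfun (T y)) (atin X x)"
      using eventually_atin_topspace by (rule eventually_mono) (rule inv)
    have "(P \<longlongrightarrow> P x) (atin X x)"
      unfolding P_def
      by (intro tendsto_diff tendsto_blinfun_compose tendsto_const tendsto_adj M tendsto_blinfun_inverse T ev inv[OF x])
    moreover have "eventually (\<lambda>y. P y = orth_proj (K y)) (atin X x)"
      using eventually_atin_topspace by (rule eventually_mono) (simp add: eq)
    ultimately show "((\<lambda>y. orth_proj (K y)) \<longlongrightarrow> orth_proj (K x)) (atin X x)"
      using eq[OF x] by (simp add: tendsto_cong)
  qed

  define c where "c x = relation_unitary (K x) (L x)" for x
  note rel = K L lagr
  have c_unit: "unitary_onto UNIV (c x)" if "x \<in> topspace X" for x
    unfolding c_def by (rule unitary_relation_unitary[OF rel[OF that]])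
  have c_UF: "c x \<in> UF" if "x \<in> topspace X" for x
    unfolding c_def using assms(9)[OF that] by (intro relation_unitary_in_UF rel[OF that]) blast
  have cc: "continuous_map X euclidean c"
    unfolding continuous_map_atin limitin_canonical_iff c_def relation_unitary_def
    by (intro ballI tendsto_add tendsto_diff tendsto_blinfun_compose tendsto_const
        continuous_map_tendsto cL cP)
  \<comment> \<open>One family serves both indices: \<open>split_map\<close> and
    \<open>triv_map\<close> both read the component to be transformed through
    \<open>adj \<iota>\<close>, so conjugation by \<open>\<iota>\<close> is the stabilization for
    each of them.\<close>
  define h where "h t x = conj_iso \<iota> (shear_unitary (R x) (c x) t)" for t x
  have h_UF: "h t x \<in> UF" if "x \<in> topspace X" for t x
    unfolding h_def by (intro conj_iso_in_UF iota(1) shear_unitary_in_UF R c_UF that)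
  have hom: "UF_homotopic X (h 0) (h 1)"
  proof (rule UF_homotopicI[where h=h])
    fix p :: "real \<times> 'x" assume p: "p \<in> topspace (cylinder X)"
    then have x: "snd p \<in> topspace X" by auto
    have "eventually (\<lambda>q. snd q \<in> topspace X) (atin (cylinder X) p)"
      using eventually_cylinder by (rule eventually_mono) blast
    then have "eventually (\<lambda>q. adj (R (snd q)) = R (snd q) \<and> clinear_blinfun (R (snd q)) \<and>
        unitary_onto UNIV (c (snd q))) (atin (cylinder X) p)"
      by (rule eventually_mono) (simp add: R c_unit)
    then show "((\<lambda>q. h (fst q) (snd q)) \<longlongrightarrow> h (fst p) (snd p)) (atin (cylinder X) p)"
      unfolding h_def
      by (intro tendsto_conj_iso tendsto_const tendsto_shear_unitary cylinder_tendsto(2)[OF p cR]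
          cylinder_tendsto(2)[OF p cc] cylinder_tendsto(1)[OF p] R(1,2)[OF x] c_unit[OF x])
  qed (simp_all add: h_UF)
  then have h0: "continuous_map X (top_of_set UF) (h 0)" and h1: "continuous_map X (top_of_set UF) (h 1)"
    using homotopic_with_imp_continuous_maps by blast+

  have "operator_index X (\<lambda>x. extension_by (A x) (Aref x) (L x)) = K1_class X (h 1)"
    unfolding operator_index_def
  proof (rule K1_index_eq[OF e unitary_split_map h1])
    fix x v assume x: "x \<in> topspace X"
    have "extension_by (A x) (Aref x) (L x) =
        {(R x \<eta> + \<xi>, \<eta>) |\<xi> \<eta>. (\<xi>, \<eta>) \<in> {(\<xi>, \<eta>). (\<xi>, orth_proj (K x) \<eta>) \<in> L x}}"
      using reference_operator.extension_by_eq[OF ref[OF x], of "L x"] relation_subset[OF rel[OF x]] by simp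
    then have "cayley_transform (extension_by (A x) (Aref x) (L x)) = shear_unitary (R x) (c x) 1"
      unfolding relation_unitary_graph[OF rel[OF x]] c_def[symmetric]
      by (rule cayley_transform_shear[OF R(1,2)[OF x] c_unit[OF x]])
    then show "split_map (h 1 x v) =
        map_prod (cayley_transform (extension_by (A x) (Aref x) (L x))) id (split_map v)"
      unfolding h_def by (simp add: split_map_conj_iso)
  qed
  moreover have "relation_index X K L = K1_class X (h 0)"
    unfolding relation_index_def lagrangian_pair_index_def
  proof (rule K1_index_family_eq[OF e _ h0])
    show "trivialization X (\<lambda>x. J_plus J_std (K x \<times> K x)) (\<lambda>x. triv_map (K x))"
      by (rule trivialization_triv_map[OF _ cP]) (use K in blast)
    fix x v assume x: "x \<in> topspace X"
    show "triv_map (K x) (h 0 x v) =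
        map_prod (\<lambda>z. - inv_into (J_plus J_std (K x \<times> K x))
              (lagrangian_unitary J_std (K x \<times> K x) (K x \<times> {0}))
              (lagrangian_unitary J_std (K x \<times> K x) (L x) z)) id (triv_map (K x) v)"
    proof -
      let ?\<xi> = "(1 / sqrt 2) *\<^sub>R orth_proj (K x) (adj \<iota> v)"
      have \<xi>: "?\<xi> \<in> K x"
        by (intro subspace_scale csubspace_imp_subspace K[OF x] orth_proj_mem)
      have c0: "h 0 x = conj_iso \<iota> (c x)"
        unfolding h_def by (simp add: shear_unitary_0[OF R(1,2)[OF x] c_unit[OF x]])
      \<comment> \<open>\<open>c x\<close> commutes with the projection onto \<open>K x\<close> and
        fixes the complement, so it changes only the component of \<open>triv_map\<close> in the
        positive part.\<close>
      have P: "orth_proj (K x) (c x a) = c x (orth_proj (K x) a)"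
        "c x a - c x (orth_proj (K x) a) = a - orth_proj (K x) a" for a
        unfolding c_def by (rule relation_unitary_preserves[OF rel[OF x]])+
      show ?thesis
        using lagrangian_pair_unitary[OF rel[OF x] \<xi>]
        by (simp add: triv_map_apply c0 adj_conj_iso_iota P c_def[symmetric] blinfun.scaleR_right scaleC_scaleR)
    qed
  qed
  moreover have "K1_class X (h 0) = K1_class X (h 1)" by (rule K1_class_eqI[OF hom])
  moreover have "K1_class X (h 0) \<in> K1 X"
    unfolding K1_def K1_class_def by (rule quotientI) (simp add: h0)
  ultimately show ?thesis by simp
qed

end
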